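(* Let $S=\{c_1,c_2,\dots,c_k\}$ be a finite nonempty multiset of positive integers ($k\ge 1$). Then there is a snark $G$ with a Hist $T$ such that $oc(G,T)=S$ if and only if (i) $c_j\geq 5$ for all $j=1,\dots,k$, and (ii) if $k=1$, then $c_1=6$ or $c_1\geq 10$.
   Context: A snark is a cyclically $4$-edge-connected cubic (3-regular) graph of girth at least $5$ that admits no proper $3$-edge-colouring. A Hist of a cubic graph $G$ is a spanning tree $T$ of $G$ with no vertex of degree two (so every vertex of $T$ has degree $1$ or $3$). Given a Hist $T$ of a cubic graph $G$, the edges of $G$ not in $T$ form vertex-disjoint cycles whose vertices are exactly the leaves of $T$; these are the outer cycles of $(G,T)$. If $C_1,\dots,C_k$ are all outer cycles, $oc(G,T)$ denotes the multiset $\{|V(C_1)|,\dots,|V(C_k)|\}$ of their lengths. *)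

theory Defs
  imports Main "HOL-Library.Multiset"
begin

definition simple_graph :: "'a set \<Rightarrow> 'a set set \<Rightarrow> bool" where
  "simple_graph V E \<longleftrightarrow> finite V \<and>
     (\<forall>e\<in>E. \<exists>u v. e = {u, v} \<and> u \<noteq> v \<and> u \<in> V \<and> v \<in> V)"

definition degree :: "'a set set \<Rightarrow> 'a \<Rightarrow> nat" where
  "degree F v = card {e \<in> F. v \<in> e}"

definition cubic :: "'a set \<Rightarrow> 'a set set \<Rightarrow> bool" where
  "cubic V E \<longleftrightarrow> simple_graph V E \<and> (\<forall>v\<in>V. degree E v = 3)"

definition is_cycle :: "'a set set \<Rightarrow> 'a list \<Rightarrow> bool" where
  "is_cycle F xs \<longleftrightarrow> length xs \<ge> 3 \<and> distinct xs \<and>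
     (\<forall>i < length xs. {xs ! i, xs ! (Suc i mod length xs)} \<in> F)"

definition has_cycle :: "'a set set \<Rightarrow> bool" where
  "has_cycle F \<longleftrightarrow> (\<exists>xs. is_cycle F xs)"

definition girth_ge :: "'a set set \<Rightarrow> nat \<Rightarrow> bool" where
  "girth_ge E g \<longleftrightarrow> (\<forall>xs. is_cycle E xs \<longrightarrow> length xs \<ge> g)"

definition induced_edges :: "'a set set \<Rightarrow> 'a set \<Rightarrow> 'a set set" where
  "induced_edges E X = {e \<in> E. e \<subseteq> X}"

definition cut_edges :: "'a set set \<Rightarrow> 'a set \<Rightarrow> 'a set set" where
  "cut_edges E X = {e \<in> E. e \<inter> X \<noteq> {} \<and> e - X \<noteq> {}}"

definition cyclically_edge_connected :: "'a set \<Rightarrow> 'a set set \<Rightarrow> nat \<Rightarrow> bool" where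
  "cyclically_edge_connected V E k \<longleftrightarrow>
     (\<forall>X \<subseteq> V. has_cycle (induced_edges E X) \<and> has_cycle (induced_edges E (V - X))
        \<longrightarrow> card (cut_edges E X) \<ge> k)"

definition edge_colouring3 :: "'a set set \<Rightarrow> ('a set \<Rightarrow> nat) \<Rightarrow> bool" where
  "edge_colouring3 E c \<longleftrightarrow> (\<forall>e\<in>E. c e < 3) \<and>
     (\<forall>e\<in>E. \<forall>f\<in>E. e \<noteq> f \<and> e \<inter> f \<noteq> {} \<longrightarrow> c e \<noteq> c f)"

definition snark :: "'a set \<Rightarrow> 'a set set \<Rightarrow> bool" where
  "snark V E \<longleftrightarrow> cubic V E \<and> cyclically_edge_connected V E 4 \<and> girth_ge E 5 \<and>
     \<not> (\<exists>c. edge_colouring3 E c)"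

definition adj :: "'a set set \<Rightarrow> 'a \<Rightarrow> 'a \<Rightarrow> bool" where
  "adj F u v \<longleftrightarrow> {u, v} \<in> F"

definition connected_on :: "'a set \<Rightarrow> 'a set set \<Rightarrow> bool" where
  "connected_on V F \<longleftrightarrow> (\<forall>u\<in>V. \<forall>v\<in>V. (adj F)\<^sup>*\<^sup>* u v)"

definition spanning_tree :: "'a set \<Rightarrow> 'a set set \<Rightarrow> 'a set set \<Rightarrow> bool" where
  "spanning_tree V E T \<longleftrightarrow> T \<subseteq> E \<and> connected_on V T \<and> \<not> has_cycle T"

text \<open>A Hist: a spanning tree with no vertex of degree two (all degrees 1 or 3).\<close>
definition hist :: "'a set \<Rightarrow> 'a set set \<Rightarrow> 'a set set \<Rightarrow> bool" where
  "hist V E T \<longleftrightarrow> spanning_tree V E T \<and> (\<forall>v\<in>V. degree T v = 1 \<or> degree T v = 3)"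

definition leaves :: "'a set \<Rightarrow> 'a set set \<Rightarrow> 'a set" where
  "leaves V T = {v \<in> V. degree T v = 1}"

definition outer_cycles :: "'a set \<Rightarrow> 'a set set \<Rightarrow> 'a set set \<Rightarrow> 'a set set" where
  "outer_cycles V E T = {{u. (adj (E - T))\<^sup>*\<^sup>* v u} | v. v \<in> leaves V T}"

definition oc :: "'a set \<Rightarrow> 'a set set \<Rightarrow> 'a set set \<Rightarrow> nat multiset" where
  "oc V E T = image_mset card (mset_set (outer_cycles V E T))"

end

theory Submission
  imports Defs
begin

text \<open>
  Sufficiency: non-colourability of a graph is witnessed by a non-colourable subgraph \<open>U\<close>. Subdividing
  two disjoint edges and joining the new vertices preserves being cubic and, in the form "every vertex
  set with at least two vertices inside and outside has at least four edges leaving it", cyclic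
  4-edge-connectivity. Doing this to a tree edge and a distant edge of an outer cycle, both outside
  \<open>U\<close>, lengthens that cycle by one; five such steps on tree edges outside \<open>U\<close> create a new outer
  5-cycle. Fifteen explicit graphs, found by computer search, start the induction.

  Necessity: outer cycles have length at least 5 by the girth condition. If there is only one, the
  graph is a cubic tree whose leaves are arranged on a cycle. Rooted at a leaf, the tree is a binary
  tree labelled by the positions of its leaves on the cycle, and for 5, 7, 8 and 9 leaves all such
  trees compatible with the girth condition are enumerated and coloured.
\<close>

section \<open>Edge cuts and edge insertion\<close>

text \<open>In both moves the new joining edges go to the tree. Each subdivided tree edge gains an
  inner vertex of degree three, and the other end of the joining edge becomes a leaf, so exactly one
  length is changed or added. The obstacle is that a move must avoid \<open>U\<close>. The induction
  therefore carries a stock of tree edges outside \<open>U\<close>: nine guarantee one far enough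
  from a given cycle edge, six guarantee the five needed for an attachment, and each move leaves at
  least nine. This decides which starting graphs are needed. Those for 6, 10, 11, 12 and {5,5} have
  the whole graph as \<open>U\<close> and serve only themselves. Those for {5,6}, {5,7}, {5,8},
  {6,6}, {6,7} and {5,5,5} are certified with six spare tree edges and serve for attachments. Those
  for 13, {5,9}, {6,8} and {7,7} have nine, and closing edges outside \<open>U\<close>, so their
  cycles can be lengthened. In the necessity part the computation stays small because two leaves
  with a common neighbour are put first: their distance on the cycle is at least three, and their
  colours can be fixed.\<close>

lemma cut_edges_pair: "{u, v} \<in> cut_edges E X \<longleftrightarrow> {u, v} \<in> E \<and> (u \<in> X \<longleftrightarrow> v \<notin> X)"
  by (auto simp: cut_edges_def)

lemma simple_graph_edgeE:
  assumes "simple_graph V E" "e \<in> E"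
  obtains u v where "e = {u, v}" "u \<noteq> v" "u \<in> V" "v \<in> V"
  using assms by (auto simp: simple_graph_def)

lemma simple_graph_pairD:
  assumes "simple_graph V E" "{u, v} \<in> E"
  shows "u \<noteq> v" "u \<in> V" "v \<in> V"
proof -
  obtain x y where "{u, v} = {x, y}" "x \<noteq> y" "x \<in> V" "y \<in> V"
    using assms simple_graph_edgeE by metis
  then show "u \<noteq> v" "u \<in> V" "v \<in> V" by (auto simp: doubleton_eq_iff)
qed

lemma simple_graph_subset: "simple_graph V E \<Longrightarrow> e \<in> E \<Longrightarrow> e \<subseteq> V"
  by (auto simp: simple_graph_def)

lemma simple_graph_finite: "simple_graph V E \<Longrightarrow> finite E"
  by (rule finite_subset[of _ "Pow V"]) (auto simp: simple_graph_def)

text \<open>For cubic graphs this is stronger than the cyclic condition only in appearance: m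
  vertices inducing a forest span at most m - 1 edges, so at least 3m - 2(m - 1) = m + 2 edges leave
  them. The form without cycles suits edge insertion, where one need not know which cycles the new
  graph has on either side.\<close>

definition cut4 :: "'a set \<Rightarrow> 'a set set \<Rightarrow> bool" where
  "cut4 V E \<longleftrightarrow> (\<forall>X \<subseteq> V. 2 \<le> card X \<and> 2 \<le> card (V - X) \<longrightarrow> 4 \<le> card (cut_edges E X))"

lemma cycle_card_ge:
  assumes "has_cycle (induced_edges E X)" "finite X"
  shows "3 \<le> card X"
proof -
  obtain xs where xs: "is_cycle (induced_edges E X) xs"
    using assms by (auto simp: has_cycle_def)
  have "set xs \<subseteq> X"
  proof
    fix x assume "x \<in> set xs"
    then obtain i where "i < length xs" "x = xs ! i" by (auto simp: in_set_conv_nth)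
    then show "x \<in> X" using xs by (force simp: is_cycle_def induced_edges_def)
  qed
  then have "card (set xs) \<le> card X" using assms(2) card_mono by blast
  then show ?thesis using xs by (simp add: is_cycle_def distinct_card)
qed

lemma cut4_cyclically_edge_connected:
  assumes "cut4 V E" "finite V"
  shows "cyclically_edge_connected V E 4"
  unfolding cyclically_edge_connected_def
proof (intro allI impI)
  fix X assume X: "X \<subseteq> V" "has_cycle (induced_edges E X) \<and> has_cycle (induced_edges E (V - X))"
  then have "3 \<le> card X" "3 \<le> card (V - X)"
    using cycle_card_ge finite_subset[OF X(1) assms(2)] assms(2) by (metis, metis finite_Diff)
  then show "4 \<le> card (cut_edges E X)" using assms(1) X(1) by (simp add: cut4_def)
qed

text \<open>In a simple graph this is girth at least five: no triangles, and no two vertices with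
  two common neighbours. Quantifying over vertices rather than cycle lists allows checks by
  neighbourhoods.\<close>

definition no_short_cycle :: "'a set set \<Rightarrow> bool" where
  "no_short_cycle E \<longleftrightarrow> (\<forall>x y z. {x, y} \<in> E \<and> {y, z} \<in> E \<and> x \<noteq> z \<longrightarrow>
     {x, z} \<notin> E \<and> (\<forall>w. {x, w} \<in> E \<and> {w, z} \<in> E \<longrightarrow> w = y))"

lemma no_short_cycle_girth:
  assumes "no_short_cycle E"
  shows "girth_ge E 5"
  unfolding girth_ge_def
proof (intro allI impI)
  fix xs assume xs: "is_cycle E xs"
  show "5 \<le> length xs"
  proof (rule ccontr)
    assume "\<not> 5 \<le> length xs"
    then consider "length xs = 3" | "length xs = 4" using xs by (force simp: is_cycle_def)
    then show False
    proof cases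
      case 1
      then obtain a b c where *: "xs = [a, b, c]" by (auto simp: numeral_eq_Suc length_Suc_conv)
      have "{xs ! i, xs ! (Suc i mod 3)} \<in> E" if "i < 3" for i
        using xs 1 that by (simp add: is_cycle_def)
      from this[of 0] this[of 1] this[of 2] have "{a, b} \<in> E" "{b, c} \<in> E" "{a, c} \<in> E"
        using * by (simp_all add: insert_commute)
      moreover have "a \<noteq> c" using xs * by (simp add: is_cycle_def)
      ultimately show False using assms unfolding no_short_cycle_def by blast
    next
      case 2
      then obtain a b c d where *: "xs = [a, b, c, d]" by (auto simp: numeral_eq_Suc length_Suc_conv)
      have "{xs ! i, xs ! (Suc i mod 4)} \<in> E" if "i < 4" for i
        using xs 2 that by (simp add: is_cycle_def)
      from this[of 0] this[of 1] this[of 2] this[of 3]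
      have "{a, b} \<in> E" "{b, c} \<in> E" "{d, c} \<in> E" "{a, d} \<in> E"
        using * by (simp_all add: insert_commute)
      moreover have "a \<noteq> c" "b \<noteq> d" using xs * by (auto simp: is_cycle_def)
      ultimately show False using assms unfolding no_short_cycle_def by metis
    qed
  qed
qed

section \<open>Inserting an edge between two disjoint edges of a cubic graph\<close>

definition ins :: "'a \<Rightarrow> 'a \<Rightarrow> 'a \<Rightarrow> 'a \<Rightarrow> 'a \<Rightarrow> 'a \<Rightarrow> 'a set set \<Rightarrow> 'a set set" where
  "ins p q a b c d E =
     (E - {{a, b}, {c, d}}) \<union> {{a, p}, {b, p}, {c, q}, {d, q}, {p, q}}"

context
  fixes V :: "'a set" and E :: "'a set set" and a b c d p q :: 'a
  assumes cub: "cubic V E" and ab: "{a, b} \<in> E" and cd: "{c, d} \<in> E"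
    and disj: "{a, b} \<inter> {c, d} = {}" and p: "p \<notin> V" and q: "q \<notin> V" and pq: "p \<noteq> q"
begin

lemma ins_simple_old: "simple_graph V E" using cub by (simp add: cubic_def)

lemma ins_vertices: "a \<in> V" "b \<in> V" "c \<in> V" "d \<in> V" "a \<noteq> b" "c \<noteq> d"
    "a \<noteq> c" "a \<noteq> d" "b \<noteq> c" "b \<noteq> d"
    "a \<noteq> p" "b \<noteq> p" "c \<noteq> p" "d \<noteq> p" "a \<noteq> q" "b \<noteq> q" "c \<noteq> q" "d \<noteq> q"
  using simple_graph_pairD[OF ins_simple_old ab] simple_graph_pairD[OF ins_simple_old cd] disj p q by auto

lemma ins_fresh: "e \<in> E \<Longrightarrow> p \<notin> e" "e \<in> E \<Longrightarrow> q \<notin> e"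
  using simple_graph_subset[OF ins_simple_old] p q by blast+

lemma ins_simple: "simple_graph (insert p (insert q V)) (ins p q a b c d E)"
  unfolding simple_graph_def
proof (intro conjI ballI)
  show "finite (insert p (insert q V))" using ins_simple_old by (simp add: simple_graph_def)
next
  fix e assume "e \<in> ins p q a b c d E"
  then consider "e \<in> E" | "e = {a, p}" | "e = {b, p}" | "e = {c, q}" | "e = {d, q}" | "e = {p, q}"
    by (auto simp: ins_def)
  then show "\<exists>u v. e = {u, v} \<and> u \<noteq> v \<and> u \<in> insert p (insert q V) \<and> v \<in> insert p (insert q V)"
    using ins_vertices pq by cases (use simple_graph_edgeE[OF ins_simple_old, of e] in blast, blast+)
qed

text \<open>Sends every old edge to itself and each of the two subdivided edges to a half of it that
  crosses \<open>X\<close> whenever the old edge does.\<close>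

definition half_edge :: "'a set \<Rightarrow> 'a set \<Rightarrow> 'a set" where
  "half_edge X e = (if e = {a, b} then (if a \<in> X \<longleftrightarrow> p \<in> X then {b, p} else {a, p})
    else if e = {c, d} then (if c \<in> X \<longleftrightarrow> q \<in> X then {d, q} else {c, q}) else e)"

text \<open>Old edges contain neither new vertex, so an image reveals its origin: a half with
  \<open>p\<close> comes from ab, a half with \<open>q\<close> from cd, and everything else is
  unchanged.\<close>

lemma half_edge_inj: "inj_on (half_edge X) E"
proof (rule inj_on_inverseI)
  fix e assume "e \<in> E"
  then have "p \<notin> e" "q \<notin> e" using ins_fresh by blast+
  then show "(\<lambda>f. if p \<in> f then {a, b} else if q \<in> f then {c, d} else f) (half_edge X e) = e"
    using ins_vertices pq by (auto simp: half_edge_def)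
qed

lemma half_edge_new:
  assumes "e \<in> E"
  shows "p \<in> half_edge X e \<Longrightarrow> e = {a, b}" "q \<in> half_edge X e \<Longrightarrow> e = {c, d}"
  using ins_fresh[OF assms] ins_vertices pq by (auto simp: half_edge_def split: if_splits)

text \<open>For an old vertex v take X = {v}: then \<open>half_edge\<close> picks the half that
  contains v, so it matches the old edges at v with the new ones, and the degree carries
  over.\<close>

lemma ins_cubic: "cubic (insert p (insert q V)) (ins p q a b c d E)"
  unfolding cubic_def
proof (intro conjI ballI ins_simple)
  fix v assume v: "v \<in> insert p (insert q V)"
  consider "v = p" | "v = q" | "v \<in> V" using v by blast
  then show "degree (ins p q a b c d E) v = 3"
  proof cases
    case 1
    then have "{e \<in> ins p q a b c d E. v \<in> e} = {{a, p}, {b, p}, {p, q}}"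
      using ins_vertices pq ins_fresh by (auto simp: ins_def)
    then show ?thesis using ins_vertices pq by (simp add: degree_def doubleton_eq_iff)
  next
    case 2
    then have "{e \<in> ins p q a b c d E. v \<in> e} = {{c, q}, {d, q}, {p, q}}"
      using ins_vertices pq ins_fresh by (auto simp: ins_def)
    then show ?thesis using ins_vertices pq by (simp add: degree_def doubleton_eq_iff)
  next
    case 3
    then have vpq: "v \<noteq> p" "v \<noteq> q" using p q by auto
    have "{e \<in> ins p q a b c d E. v \<in> e} = half_edge {v} ` {e \<in> E. v \<in> e}" (is "?L = ?R")
    proof
      show "?L \<subseteq> ?R"
      proof
        fix e assume "e \<in> ?L"
        then consider "e \<in> E" "e \<noteq> {a, b}" "e \<noteq> {c, d}" "v \<in> e"
          | "e = {a, p}" "v = a" | "e = {b, p}" "v = b" | "e = {c, q}" "v = c" | "e = {d, q}" "v = d"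
          using vpq by (auto simp: ins_def)
        then show "e \<in> ?R"
        proof cases
          case 1
          then have "half_edge {v} e = e" by (simp add: half_edge_def)
          then show ?thesis using 1 by (metis (mono_tags, lifting) image_eqI mem_Collect_eq)
        next
          case 2
          then have "half_edge {v} {a, b} = e" using ins_vertices by (simp add: half_edge_def)
          then show ?thesis using 2 ab by blast
        next
          case 3
          then have "half_edge {v} {a, b} = e" using ins_vertices by (simp add: half_edge_def)
          then show ?thesis using 3 ab by blast
        next
          case 4
          then have "half_edge {v} {c, d} = e" using ins_vertices by (simp add: half_edge_def doubleton_eq_iff)
          then show ?thesis using 4 cd by blast
        next
          case 5
          then have "half_edge {v} {c, d} = e" using ins_vertices by (simp add: half_edge_def doubleton_eq_iff)
          then show ?thesis using 5 cd by blast
        qed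
      qed
      show "?R \<subseteq> ?L"
      proof
        fix f assume "f \<in> ?R"
        then obtain e where e: "e \<in> E" "v \<in> e" "f = half_edge {v} e" by blast
        have "e = {a, b} \<Longrightarrow> v = a \<or> v = b" "e = {c, d} \<Longrightarrow> v = c \<or> v = d" using e by auto
        then show "f \<in> ?L" using e vpq by (auto simp: half_edge_def ins_def split: if_splits)
      qed
    qed
    moreover have "card (half_edge {v} ` {e \<in> E. v \<in> e}) = card {e \<in> E. v \<in> e}"
      by (rule card_image) (rule inj_on_subset[OF half_edge_inj], auto)
    ultimately show ?thesis using cub 3 by (simp add: degree_def cubic_def)
  qed
qed

lemma half_edge_cut: "half_edge X ` cut_edges E (X \<inter> V) \<subseteq> cut_edges (ins p q a b c d E) X"
proof
  fix f assume "f \<in> half_edge X ` cut_edges E (X \<inter> V)"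
  then obtain e where e: "e \<in> cut_edges E (X \<inter> V)" "f = half_edge X e" by blast
  then have eE: "e \<in> E" by (simp add: cut_edges_def)
  obtain u v where uv: "e = {u, v}" "u \<in> V" "v \<in> V" using simple_graph_edgeE[OF ins_simple_old eE] by blast
  have crossing: "{u, v} \<in> E" "u \<in> X \<longleftrightarrow> v \<notin> X" using e uv by (auto simp: cut_edges_pair)
  show "f \<in> cut_edges (ins p q a b c d E) X"
  proof (cases "e = {a, b} \<or> e = {c, d}")
    case True
    then have "e = {a, b} \<and> (a \<in> X \<longleftrightarrow> b \<notin> X) \<or> e = {c, d} \<and> (c \<in> X \<longleftrightarrow> d \<notin> X)"
      using crossing uv by (auto simp: doubleton_eq_iff)
    then show ?thesis using e(2) ins_vertices by (auto simp: half_edge_def cut_edges_pair ins_def doubleton_eq_iff)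
  next
    case False
    then show ?thesis using e(2) uv crossing by (auto simp: half_edge_def cut_edges_pair ins_def)
  qed
qed

lemma finite_ins_cut: "finite (cut_edges (ins p q a b c d E) X)"
  using simple_graph_finite[OF ins_simple_old] by (simp add: cut_edges_def ins_def)

lemma card_half_edge_cut: "card (half_edge X ` cut_edges E (X \<inter> V)) = card (cut_edges E (X \<inter> V))"
  by (rule card_image) (rule inj_on_subset[OF half_edge_inj], auto simp: cut_edges_def)

lemma ins_cut_mono: "card (cut_edges E (X \<inter> V)) \<le> card (cut_edges (ins p q a b c d E) X)"
  using card_mono[OF finite_ins_cut half_edge_cut] card_half_edge_cut by metis

text \<open>This is the case about which \<open>cut4\<close> of the old graph says nothing. If X =
  {p, q}, the four outer half edges cross. If X also contains one old vertex w, the three edges at w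
  give three crossing edges and one more must be found: pq if it crosses. Otherwise both new
  vertices lie in X, and a half of that subdivided edge which avoids w crosses as well; it is new
  because its original does not meet w.\<close>

lemma ins_cut_small:
  assumes X: "X \<subseteq> insert p (insert q V)" "2 \<le> card X" "card (X \<inter> V) \<le> 1"
  shows "4 \<le> card (cut_edges (ins p q a b c d E) X)"
proof -
  have fV: "finite V" using ins_simple_old by (simp add: simple_graph_def)
  then have fXV: "finite (X \<inter> V)" by simp
  let ?C = "cut_edges (ins p q a b c d E) X"
  consider "X \<inter> V = {}" | w where "X \<inter> V = {w}"
    using X(3) fXV by (metis One_nat_def card_0_eq card_1_singletonE le_Suc_eq le_zero_eq)
  then show ?thesis
  proof cases
    case 1
    then have "X \<subseteq> {p, q}" using X(1) by blast
    then have "X = {p, q}" using card_seteq[of "{p, q}" X] X(2) pq by simp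
    then have "{{a, p}, {b, p}, {c, q}, {d, q}} \<subseteq> ?C"
      using ins_vertices by (simp add: cut_edges_pair) (simp add: ins_def)
    moreover have "card {{a, p}, {b, p}, {c, q}, {d, q}} = 4"
      using ins_vertices pq by (simp add: doubleton_eq_iff)
    ultimately show ?thesis using card_mono[OF finite_ins_cut] by metis
  next
    case (2 w)
    then have w: "w \<in> X" "w \<in> V" by auto
    have "cut_edges E {w} = {e \<in> E. w \<in> e}"
    proof -
      have "e - {w} \<noteq> {}" if "e \<in> E" for e
        using simple_graph_edgeE[OF ins_simple_old that] by (metis Diff_eq_empty_iff insert_subset singletonD)
      then show ?thesis unfolding cut_edges_def by blast
    qed
    then have "card (cut_edges E (X \<inter> V)) = 3" using 2 w cub by (simp add: cubic_def degree_def)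
    then have c3: "card (half_edge X ` cut_edges E (X \<inter> V)) = 3" using card_half_edge_cut by simp
    have enough: ?thesis if "y \<in> ?C" "y \<notin> half_edge X ` cut_edges E (X \<inter> V)" for y
    proof -
      have "insert y (half_edge X ` cut_edges E (X \<inter> V)) \<subseteq> ?C" using that half_edge_cut by blast
      moreover have "card (insert y (half_edge X ` cut_edges E (X \<inter> V))) = 4"
        using that c3 by (metis card_insert_disjoint card.infinite numeral_eq_Suc pred_numeral_simps(2,3)
          semiring_norm(26,27,28) zero_neq_numeral)
      ultimately show ?thesis using card_mono[OF finite_ins_cut] by metis
    qed
    consider "p \<in> X \<longleftrightarrow> q \<notin> X" | "p \<in> X" "q \<in> X"
    proof -
      have "X \<noteq> {w}" using X(2) by auto
      then have "p \<in> X \<or> q \<in> X" using X(1) 2 by blast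
      then show ?thesis using that by blast
    qed
    then show ?thesis
    proof cases
      case 1
      show ?thesis
      proof (rule enough[of "{p, q}"])
        show "{p, q} \<in> ?C" using 1 by (simp add: cut_edges_pair ins_def)
        show "{p, q} \<notin> half_edge X ` cut_edges E (X \<inter> V)"
        proof
          assume "{p, q} \<in> half_edge X ` cut_edges E (X \<inter> V)"
          then obtain e where "e \<in> E" "half_edge X e = {p, q}" by (auto simp: cut_edges_def)
          then have "{a, b} = {c, d}" using half_edge_new by (metis insertI1 insertI2)
          then show False using disj by auto
        qed
      qed
    next
      case pqX: 2
      show ?thesis
      proof (cases "w \<in> {a, b}")
        case False
        then have "a \<notin> X" "b \<notin> X" using 2 ins_vertices by auto
        show ?thesis
        proof (rule enough[of "{a, p}"])
          show "{a, p} \<in> ?C" using pqX \<open>a \<notin> X\<close> by (simp add: cut_edges_pair ins_def)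
          show "{a, p} \<notin> half_edge X ` cut_edges E (X \<inter> V)"
          proof
            assume "{a, p} \<in> half_edge X ` cut_edges E (X \<inter> V)"
            then obtain e where "e \<in> cut_edges E (X \<inter> V)" "half_edge X e = {a, p}" by auto
            moreover from this have "e = {a, b}"
              using half_edge_new by (metis (no_types, lifting) cut_edges_def insertCI mem_Collect_eq)
            ultimately show False using \<open>a \<notin> X\<close> \<open>b \<notin> X\<close> by (simp add: cut_edges_pair)
          qed
        qed
      next
        case True
        then have "c \<noteq> w" "d \<noteq> w" using disj by auto
        then have "c \<notin> X" "d \<notin> X" using 2 ins_vertices(3,4) by blast+
        show ?thesis
        proof (rule enough[of "{c, q}"])
          show "{c, q} \<in> ?C" using pqX \<open>c \<notin> X\<close> by (simp add: cut_edges_pair ins_def)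
          show "{c, q} \<notin> half_edge X ` cut_edges E (X \<inter> V)"
          proof
            assume "{c, q} \<in> half_edge X ` cut_edges E (X \<inter> V)"
            then obtain e where "e \<in> cut_edges E (X \<inter> V)" "half_edge X e = {c, q}" by auto
            moreover from this have "e = {c, d}"
              using half_edge_new by (metis (no_types, lifting) cut_edges_def insertCI mem_Collect_eq)
            ultimately show False using \<open>c \<notin> X\<close> \<open>d \<notin> X\<close> by (simp add: cut_edges_pair)
          qed
        qed
      qed
    qed
  qed
qed

text \<open>X and its complement have the same cut. Hence either one of the two has at most one old
  vertex and is small in the sense above, or the trace of X splits the old vertices into two sets of
  size at least two and the old bound is inherited.\<close>

lemma ins_cut4:
  assumes "cut4 V E"
  shows "cut4 (insert p (insert q V)) (ins p q a b c d E)"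
  unfolding cut4_def
proof (intro allI impI, elim conjE)
  fix X assume X: "X \<subseteq> insert p (insert q V)" "2 \<le> card X" "2 \<le> card (insert p (insert q V) - X)"
  let ?W = "insert p (insert q V)" and ?E = "ins p q a b c d E"
  have compl: "cut_edges ?E (?W - X) = cut_edges ?E X"
    using simple_graph_subset[OF ins_simple] unfolding cut_edges_def by blast
  consider "card (X \<inter> V) \<le> 1" | "card ((?W - X) \<inter> V) \<le> 1"
    | "2 \<le> card (X \<inter> V)" "2 \<le> card ((?W - X) \<inter> V)" by linarith
  then show "4 \<le> card (cut_edges ?E X)"
  proof cases
    case 1 then show ?thesis using ins_cut_small X by blast
  next
    case 2 then show ?thesis using ins_cut_small[of "?W - X"] X compl by auto
  next
    case 3
    moreover have "(?W - X) \<inter> V = V - X \<inter> V" by auto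
    ultimately have "4 \<le> card (cut_edges E (X \<inter> V))" using assms by (simp add: cut4_def)
    then show ?thesis using ins_cut_mono le_trans by blast
  qed
qed

end

section \<open>Trees and outer cycles\<close>

text \<open>Growth by leaves makes connectedness, acyclicity and stability under subdivision
  inductions. It describes only the trees that are constructed; the Hist given in the necessity part
  is used through its acyclicity.\<close>

inductive tree :: "'a set \<Rightarrow> 'a set set \<Rightarrow> bool" where
  single: "tree {v} {}"
| leaf: "tree V T \<Longrightarrow> u \<in> V \<Longrightarrow> w \<notin> V \<Longrightarrow> tree (insert w V) (insert {u, w} T)"

lemma tree_simple: "tree V T \<Longrightarrow> simple_graph V T"
proof (induction rule: tree.induct)
  case (leaf V T u w)
  show ?case unfolding simple_graph_def
  proof (intro conjI ballI)
    fix e assume "e \<in> insert {u, w} T"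
    then consider "e = {u, w}" | "e \<in> T" by blast
    then show "\<exists>x y. e = {x, y} \<and> x \<noteq> y \<and> x \<in> insert w V \<and> y \<in> insert w V"
    proof cases
      case 1 then show ?thesis using leaf(2,3) by blast
    next
      case 2 then show ?thesis using simple_graph_edgeE[OF leaf(4)] by (metis insertCI)
    qed
  qed (use leaf in \<open>simp add: simple_graph_def\<close>)
qed (simp add: simple_graph_def)

lemma adj_sym: "adj F u v \<Longrightarrow> adj F v u"
  by (simp add: adj_def insert_commute)

lemma adj_star_sym: "(adj F)\<^sup>*\<^sup>* u v \<Longrightarrow> (adj F)\<^sup>*\<^sup>* v u"
  by (induction rule: rtranclp_induct) (auto intro: converse_rtranclp_into_rtranclp adj_sym)

lemma adj_star_mono: "(adj F)\<^sup>*\<^sup>* u v \<Longrightarrow> F \<subseteq> G \<Longrightarrow> (adj G)\<^sup>*\<^sup>* u v"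
  by (erule rtranclp_mono[THEN predicate2D, rotated]) (auto simp: adj_def)

lemma tree_connected: "tree V T \<Longrightarrow> connected_on V T"
proof (induction rule: tree.induct)
  case (single v)
  show ?case unfolding connected_on_def by blast
next
  case (leaf V T u w)
  let ?R = "(adj (insert {u, w} T))\<^sup>*\<^sup>*"
  have old: "?R x y" if "x \<in> V" "y \<in> V" for x y
    by (rule adj_star_mono[of T]) (use leaf(4) that in \<open>auto simp: connected_on_def\<close>)
  have "adj (insert {u, w} T) u w" by (simp add: adj_def)
  then have w: "?R x w" if "x \<in> V" for x
    using old[OF that leaf(2)] by (rule rtranclp.rtrancl_into_rtrancl[rotated])
  show ?case unfolding connected_on_def
  proof (intro ballI)
    fix x y assume "x \<in> insert w V" "y \<in> insert w V"
    then show "?R x y" using old w adj_star_sym[OF w] by (cases "x = w"; cases "y = w") auto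
  qed
qed

text \<open>On a cycle through the new leaf, its predecessor and its successor would both be the
  only neighbour u, but they are distinct on a cycle of length at least three.\<close>

lemma tree_acyclic: "tree V T \<Longrightarrow> \<not> has_cycle T"
proof (induction rule: tree.induct)
  case (single v)
  show ?case by (auto simp: has_cycle_def is_cycle_def intro!: exI[of _ 0])
next
  case (leaf V T u w)
  have w: "x = u" if "{w, x} \<in> insert {u, w} T" for x
    using that leaf(2,3) simple_graph_pairD[OF tree_simple[OF leaf(1)]]
    by (metis doubleton_eq_iff insertE)
  show ?case
  proof
    assume "has_cycle (insert {u, w} T)"
    then obtain xs where xs: "is_cycle (insert {u, w} T) xs" by (auto simp: has_cycle_def)
    let ?n = "length xs"
    have n: "3 \<le> ?n" "distinct xs" using xs by (auto simp: is_cycle_def)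
    have e: "{xs ! i, xs ! (Suc i mod ?n)} \<in> insert {u, w} T" if "i < ?n" for i
      using xs that by (simp add: is_cycle_def)
    show False
    proof (cases "w \<in> set xs")
      case True
      then obtain i where i: "i < ?n" "xs ! i = w" by (auto simp: in_set_conv_nth)
      define k where "k = (if i = 0 then ?n - 1 else i - 1)"
      have k: "k < ?n" "Suc k mod ?n = i" using i n by (auto simp: k_def)
      have "xs ! (Suc i mod ?n) = u" using e[OF i(1)] i(2) w by simp
      moreover have "xs ! k = u" using e[OF k(1)] k(2) i(2) w by (simp add: insert_commute)
      moreover have "Suc i mod ?n < ?n" using n(1) by (intro mod_less_divisor) linarith
      ultimately have "Suc i mod ?n = k" using n(2) k(1) nth_eq_iff_index_eq by metis
      then show False using n(1) i(1) by (auto simp: k_def mod_Suc split: if_splits)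
    next
      case False
      then have "{xs ! i, xs ! (Suc i mod ?n)} \<in> T" if "i < ?n" for i
      proof -
        have "Suc i mod ?n < ?n" using n(1) by (intro mod_less_divisor) linarith
        then have "xs ! i \<noteq> w" "xs ! (Suc i mod ?n) \<noteq> w" using False that nth_mem by metis+
        then show ?thesis using e[OF that] by (auto simp: doubleton_eq_iff)
      qed
      then have "is_cycle T xs" using xs by (simp add: is_cycle_def)
      then show False using leaf(4) by (auto simp: has_cycle_def)
    qed
  qed
qed

text \<open>If the subdivided edge is the one added last, grow \<open>p\<close> first and then the
  leaf from \<open>p\<close>. Otherwise subdivide the smaller tree and add the leaf
  afterwards.\<close>

lemma tree_subdivide:
  assumes "tree V T" "{a, b} \<in> T" "p \<notin> V"
  shows "tree (insert p V) (insert {a, p} (insert {b, p} (T - {{a, b}})))"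
  using assms
proof (induction rule: tree.induct)
  case (leaf V T u w)
  have uw: "{u, w} \<notin> T" using simple_graph_pairD[OF tree_simple[OF leaf(1)]] leaf(3) by blast
  have p: "p \<notin> V" "p \<noteq> w" using leaf(6) by auto
  show ?case
  proof (cases "{a, b} = {u, w}")
    case True
    have "tree (insert w (insert p V)) (insert {p, w} (insert {u, p} T))"
      using leaf p by (intro tree.leaf) auto
    moreover have "insert {a, p} (insert {b, p} (insert {u, w} T - {{a, b}})) = insert {p, w} (insert {u, p} T)"
      using True uw by (auto simp: doubleton_eq_iff insert_commute)
    ultimately show ?thesis by (simp add: insert_commute)
  next
    case False
    then have "tree (insert p V) (insert {a, p} (insert {b, p} (T - {{a, b}})))"
      using leaf p by auto
    then have "tree (insert w (insert p V)) (insert {u, w} (insert {a, p} (insert {b, p} (T - {{a, b}}))))"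
      by (rule tree.leaf) (use leaf p in auto)
    moreover have "insert {a, p} (insert {b, p} (insert {u, w} T - {{a, b}}))
        = insert {u, w} (insert {a, p} (insert {b, p} (T - {{a, b}})))"
      using False by (simp add: insert_Diff_if) (simp add: insert_commute)
    ultimately show ?thesis by (simp add: insert_commute)
  qed
qed simp

section \<open>Cycles as lists of vertices\<close>

fun pedges :: "'a list \<Rightarrow> 'a set set" where
  "pedges (x # y # xs) = insert {x, y} (pedges (y # xs))"
| "pedges _ = {}"

text \<open>The closing edge is kept apart from the path because it is the edge that a lengthening
  step subdivides: the new vertex is appended at the end of the list.\<close>

definition cedges :: "'a list \<Rightarrow> 'a set set" where
  "cedges xs = insert {last xs, hd xs} (pedges xs)"

lemma pedges_nth: "pedges xs = {{xs ! i, xs ! Suc i} | i. Suc i < length xs}"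
proof (induction xs rule: pedges.induct)
  case (1 x y xs)
  have "{{(x # y # xs) ! i, (x # y # xs) ! Suc i} | i. Suc i < length (x # y # xs)}
      = insert {x, y} {{(y # xs) ! i, (y # xs) ! Suc i} | i. Suc i < length (y # xs)}" (is "?L = ?R")
  proof
    show "?L \<subseteq> ?R"
    proof
      fix e assume "e \<in> ?L"
      then obtain i where "e = {(x # y # xs) ! i, (x # y # xs) ! Suc i}" "Suc i < length (x # y # xs)" by blast
      then show "e \<in> ?R" by (cases i) auto
    qed
    show "?R \<subseteq> ?L" by (force intro: exI[of _ "Suc _"] exI[of _ 0])
  qed
  then show ?case using 1 by simp
qed auto

lemma cedges_nth:
  assumes "xs \<noteq> []"
  shows "cedges xs = {{xs ! i, xs ! (Suc i mod length xs)} | i. i < length xs}"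
proof -
  have "{{xs ! i, xs ! (Suc i mod length xs)} | i. i < length xs}
      = insert {last xs, hd xs} {{xs ! i, xs ! Suc i} | i. Suc i < length xs}" (is "?L = ?R")
  proof
    show "?L \<subseteq> ?R"
    proof
      fix e assume "e \<in> ?L"
      then obtain i where i: "e = {xs ! i, xs ! (Suc i mod length xs)}" "i < length xs" by blast
      show "e \<in> ?R"
      proof (cases "Suc i < length xs")
        case False
        then have "Suc i = length xs" using i(2) by simp
        then have "xs ! i = last xs" "xs ! (Suc i mod length xs) = hd xs"
          using assms by (simp_all add: last_conv_nth hd_conv_nth flip: \<open>Suc i = length xs\<close>)
        then show ?thesis using i by simp
      qed (use i in auto)
    qed
    have "{last xs, hd xs} = {xs ! (length xs - 1), xs ! (Suc (length xs - 1) mod length xs)}"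
      using assms by (simp add: last_conv_nth hd_conv_nth)
    moreover have "length xs - 1 < length xs" using assms by simp
    ultimately have "{last xs, hd xs} \<in> ?L" by blast
    moreover have "{xs ! i, xs ! Suc i} \<in> ?L" if "Suc i < length xs" for i
      using that by (metis (mono_tags, lifting) Suc_lessD mem_Collect_eq mod_less)
    ultimately show "?R \<subseteq> ?L" by blast
  qed
  then show ?thesis by (simp add: cedges_def pedges_nth)
qed

lemma is_cycle_iff: "is_cycle F xs \<longleftrightarrow> 3 \<le> length xs \<and> distinct xs \<and> cedges xs \<subseteq> F"
  by (cases "xs = []") (auto simp: is_cycle_def cedges_nth)

lemma pedges_subset: "e \<in> pedges xs \<Longrightarrow> e \<subseteq> set xs"
  by (induction xs rule: pedges.induct) auto

lemma cedges_subset: "xs \<noteq> [] \<Longrightarrow> e \<in> cedges xs \<Longrightarrow> e \<subseteq> set xs"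
  using pedges_subset by (auto simp: cedges_def)

lemma pedges_append: "xs \<noteq> [] \<Longrightarrow> pedges (xs @ [q]) = insert {last xs, q} (pedges xs)"
  by (induction xs rule: pedges.induct) auto

text \<open>With two vertices the closing edge would be the path edge itself. From three vertices
  on, removing it leaves the path intact, which is what appending a vertex relies on.\<close>

lemma closing_edge_notin:
  assumes "distinct xs" "3 \<le> length xs"
  shows "{last xs, hd xs} \<notin> pedges xs"
proof
  assume "{last xs, hd xs} \<in> pedges xs"
  then obtain i where i: "Suc i < length xs" "{last xs, hd xs} = {xs ! i, xs ! Suc i}"
    by (auto simp: pedges_nth)
  have "last xs = xs ! (length xs - 1)" "hd xs = xs ! 0"
    using last_conv_nth[of xs] hd_conv_nth[of xs] assms(2) by force+
  then have "{xs ! (length xs - 1), xs ! 0} = {xs ! i, xs ! Suc i}" using i by simp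
  moreover have "0 < length xs" "length xs - 1 < length xs" "i < length xs" using assms(2) i(1) by auto
  ultimately have "i = 0 \<and> Suc i = length xs - 1 \<or> i = length xs - 1"
    using assms(1) i(1) by (metis doubleton_eq_iff nth_eq_iff_index_eq)
  then show False using assms(2) i(1) by auto
qed

lemma cedges_append:
  assumes "distinct xs" "3 \<le> length xs"
  shows "cedges (xs @ [q]) = cedges xs - {{last xs, hd xs}} \<union> {{last xs, q}, {hd xs, q}}"
proof -
  have "xs \<noteq> []" using assms(2) by auto
  then have "hd (xs @ [q]) = hd xs" by simp
  then show ?thesis using closing_edge_notin[OF assms] \<open>xs \<noteq> []\<close>
    by (simp add: cedges_def pedges_append insert_commute)
qed

lemma cedges_degree:
  assumes "distinct xs" "3 \<le> length xs" "v \<in> set xs"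
  shows "card {e \<in> cedges xs. v \<in> e} = 2"
proof -
  let ?n = "length xs"
  have ne: "xs \<noteq> []" using assms(2) by auto
  obtain i where i: "i < ?n" "xs ! i = v" using assms(3) by (auto simp: in_set_conv_nth)
  \<comment> \<open>The cyclic predecessor of position i.\<close>
  define k where "k = (if i = 0 then ?n - 1 else i - 1)"
  have k: "k < ?n" "Suc k mod ?n = i" using i assms(2) by (auto simp: k_def)
  let ?j = "Suc i mod ?n"
  have j: "?j < ?n" "?j \<noteq> k" "?j \<noteq> i" using i assms(2) by (auto simp: k_def mod_Suc split: if_splits)
  have "{e \<in> cedges xs. v \<in> e} = {{v, xs ! ?j}, {xs ! k, v}}" (is "?L = ?R")
  proof
    show "?L \<subseteq> ?R"
    proof
      fix e assume "e \<in> ?L"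
      then obtain l where l: "l < ?n" "e = {xs ! l, xs ! (Suc l mod ?n)}" "v \<in> e"
        using ne by (auto simp: cedges_nth)
      then have "xs ! l = xs ! i \<or> xs ! (Suc l mod ?n) = xs ! i" using i by auto
      moreover have "Suc l mod ?n < ?n" using l(1) by (intro mod_less_divisor) linarith
      ultimately have "l = i \<or> Suc l mod ?n = i"
        using i(1) l(1) assms(1) by (simp add: nth_eq_iff_index_eq)
      moreover have "l = k" if "Suc l mod ?n = i"
        using that l(1) i assms(2) by (auto simp: k_def mod_Suc split: if_splits)
      ultimately show "e \<in> ?R" using l i k by auto
    qed
    show "?R \<subseteq> ?L" using i k ne by (force simp: cedges_nth)
  qed
  moreover have "xs ! ?j \<noteq> xs ! k" using j k assms(1) by (simp add: nth_eq_iff_index_eq)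
  moreover have "xs ! ?j \<noteq> v" using j i assms(1) by (auto simp: nth_eq_iff_index_eq)
  ultimately show ?thesis by (auto simp: doubleton_eq_iff)
qed

lemma cedges_connected:
  assumes "cedges xs \<subseteq> F" "v \<in> set xs" "u \<in> set xs"
  shows "(adj F)\<^sup>*\<^sup>* v u"
proof -
  have start: "(adj F)\<^sup>*\<^sup>* (xs ! 0) (xs ! i)" if "i < length xs" for i
    using that
  proof (induction i)
    case (Suc i)
    then have "{xs ! i, xs ! Suc i} \<in> F" using assms(1) by (auto simp: cedges_def pedges_nth)
    then show ?case using Suc by (simp add: adj_def rtranclp.rtrancl_into_rtrancl)
  qed simp
  obtain i j where "i < length xs" "xs ! i = v" "j < length xs" "xs ! j = u"
    using assms(2,3) by (metis in_set_conv_nth)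
  then show ?thesis using start adj_star_sym by (metis rtranclp_trans)
qed

section \<open>Cubic graphs decomposed into a tree and disjoint cycles\<close>

lemma reach_closed:
  assumes "(adj F)\<^sup>*\<^sup>* v u" "v \<in> A" "\<And>x y. x \<in> A \<Longrightarrow> {x, y} \<in> F \<Longrightarrow> y \<in> A"
  shows "u \<in> A"
  using assms(1,2) by induction (use assms(3) in \<open>auto simp: adj_def\<close>)

text \<open>The degree condition of a Hist is a consequence: a vertex of a listed cycle has exactly
  two non-tree edges, hence tree degree 3 - 2 = 1, and any other vertex has none, hence tree degree
  3. Distinctness of the concatenation says that the cycles are simple and pairwise
  disjoint.\<close>

definition hist_decomp :: "'a set \<Rightarrow> 'a set set \<Rightarrow> 'a set set \<Rightarrow> 'a list list \<Rightarrow> bool" where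
  "hist_decomp V E T cs \<longleftrightarrow> cubic V E \<and> tree V T \<and> T \<subseteq> E \<and> E - T = \<Union> (cedges ` set cs) \<and>
     distinct (concat cs) \<and> (\<forall>xs \<in> set cs. 3 \<le> length xs)"

lemma distinct_concat_same:
  "distinct (concat cs) \<Longrightarrow> xs \<in> set cs \<Longrightarrow> ys \<in> set cs \<Longrightarrow> x \<in> set xs \<Longrightarrow> x \<in> set ys \<Longrightarrow> xs = ys"
  by (induction cs) auto

lemma distinct_concat_sets:
  "distinct (concat cs) \<Longrightarrow> [] \<notin> set cs \<Longrightarrow> distinct (map set cs)"
proof (induction cs)
  case (Cons xs cs)
  then have "xs \<noteq> []" by auto
  then have "set xs \<notin> set ` set cs" using Cons(2) by (cases xs) auto
  then show ?case using Cons by simp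
qed simp

context
  fixes V :: "'a set" and E T :: "'a set set" and cs :: "'a list list"
  assumes dec: "hist_decomp V E T cs"
begin

lemma decomp_facts:
  "cubic V E" "tree V T" "T \<subseteq> E" "E - T = \<Union> (cedges ` set cs)" "distinct (concat cs)"
  "\<And>xs. xs \<in> set cs \<Longrightarrow> 3 \<le> length xs" "simple_graph V E"
  using dec by (auto simp: hist_decomp_def cubic_def)

lemma decomp_cycle:
  assumes "xs \<in> set cs"
  shows "xs \<noteq> []" "distinct xs" "cedges xs \<subseteq> E - T" "set xs \<subseteq> V"
proof -
  show ne: "xs \<noteq> []" and d: "distinct xs"
    using decomp_facts(5,6) assms by (fastforce simp: distinct_concat_iff)+
  show ed: "cedges xs \<subseteq> E - T" using decomp_facts(4) assms by blast
  show "set xs \<subseteq> V"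
  proof
    fix v assume v: "v \<in> set xs"
    have "card {e \<in> cedges xs. v \<in> e} = 2"
      by (rule cedges_degree[OF d decomp_facts(6)[OF assms] v])
    then have "{e \<in> cedges xs. v \<in> e} \<noteq> {}" by (metis card.empty zero_neq_numeral)
    then obtain e where "e \<in> cedges xs" "v \<in> e" by blast
    then show "v \<in> V" using ed simple_graph_subset[OF decomp_facts(7)] by blast
  qed
qed

lemma decomp_edges_at:
  assumes "xs \<in> set cs" "v \<in> set xs"
  shows "{e \<in> E - T. v \<in> e} = {e \<in> cedges xs. v \<in> e}"
proof -
  have "e \<in> cedges xs" if "e \<in> cedges ys" "ys \<in> set cs" "v \<in> e" for e ys
  proof -
    have "v \<in> set ys" using cedges_subset decomp_cycle that by blast
    then show ?thesis using distinct_concat_same[OF decomp_facts(5) assms(1)] that assms(2) by blast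
  qed
  then show ?thesis using decomp_facts(4) decomp_cycle(3)[OF assms(1)] by blast
qed

lemma decomp_degree:
  assumes "v \<in> V"
  shows "degree T v = (if v \<in> set (concat cs) then 1 else 3)"
proof -
  have fin: "finite E" using simple_graph_finite decomp_facts(7) by blast
  have "{e \<in> E. v \<in> e} = {e \<in> T. v \<in> e} \<union> {e \<in> E - T. v \<in> e}" using decomp_facts(3) by blast
  moreover have "card ({e \<in> T. v \<in> e} \<union> {e \<in> E - T. v \<in> e}) = card {e \<in> T. v \<in> e} + card {e \<in> E - T. v \<in> e}"
    using fin finite_subset[OF decomp_facts(3) fin] by (intro card_Un_disjoint) auto
  ultimately have 3: "degree T v + card {e \<in> E - T. v \<in> e} = 3"
    using decomp_facts(1) assms unfolding cubic_def degree_def by metis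
  show ?thesis
  proof (cases "v \<in> set (concat cs)")
    case True
    then obtain xs where xs: "xs \<in> set cs" "v \<in> set xs" by auto
    then have "card {e \<in> E - T. v \<in> e} = 2"
      using decomp_edges_at[OF xs] cedges_degree[OF decomp_cycle(2)[OF xs(1)] decomp_facts(6)[OF xs(1)] xs(2)]
      by simp
    then show ?thesis using 3 True by simp
  next
    case False
    have "{e \<in> E - T. v \<in> e} = {}"
    proof -
      have "v \<notin> e" if "e \<in> cedges ys" "ys \<in> set cs" for e ys
        using cedges_subset[OF decomp_cycle(1)] that False by fastforce
      then show ?thesis using decomp_facts(4) by blast
    qed
    then have "card {e \<in> E - T. v \<in> e} = 0" by (metis card.empty)
    then show ?thesis using 3 False by presburger
  qed
qed

lemma decomp_hist: "hist V E T"
  unfolding hist_def spanning_tree_def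
  using decomp_facts(2,3) decomp_degree by (auto simp: tree_connected tree_acyclic)

text \<open>The cycle is connected, and disjointness of the cycles means that every non-tree edge at
  one of its vertices is an edge of this same cycle, so nothing outside it is reachable.\<close>

lemma decomp_component:
  assumes "xs \<in> set cs" "v \<in> set xs"
  shows "{u. (adj (E - T))\<^sup>*\<^sup>* v u} = set xs"
proof
  show "set xs \<subseteq> {u. (adj (E - T))\<^sup>*\<^sup>* v u}"
    using cedges_connected[OF decomp_cycle(3)[OF assms(1)] assms(2)] by blast
  show "{u. (adj (E - T))\<^sup>*\<^sup>* v u} \<subseteq> set xs"
  proof
    fix u assume "u \<in> {u. (adj (E - T))\<^sup>*\<^sup>* v u}"
    then have "(adj (E - T))\<^sup>*\<^sup>* v u" by simp
    then show "u \<in> set xs"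
    proof (rule reach_closed[OF _ assms(2)])
      fix x y assume "x \<in> set xs" "{x, y} \<in> E - T"
      then have "{x, y} \<in> cedges xs" using decomp_edges_at[OF assms(1), of x] by blast
      then show "y \<in> set xs" using cedges_subset decomp_cycle assms(1) by blast
    qed
  qed
qed

lemma decomp_oc: "oc V E T = mset (map length cs)"
proof -
  have leaves: "leaves V T = \<Union> (set ` set cs)"
  proof
    show "leaves V T \<subseteq> \<Union> (set ` set cs)"
    proof
      fix v assume "v \<in> leaves V T"
      then have "v \<in> V" "degree T v = 1" by (auto simp: leaves_def)
      then have "v \<in> set (concat cs)"
        using decomp_degree[of v] by (metis numeral_eq_one_iff semiring_norm(86))
      then show "v \<in> \<Union> (set ` set cs)" by simp
    qed
    show "\<Union> (set ` set cs) \<subseteq> leaves V T"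
    proof
      fix v assume "v \<in> \<Union> (set ` set cs)"
      then obtain xs where "xs \<in> set cs" "v \<in> set xs" by blast
      then have "v \<in> V" "v \<in> set (concat cs)" using decomp_cycle(4) by auto
      then have "degree T v = 1" using decomp_degree[of v] by presburger
      then show "v \<in> leaves V T" using \<open>v \<in> V\<close> unfolding leaves_def by blast
    qed
  qed
  have "outer_cycles V E T = set (map set cs)"
  proof
    show "outer_cycles V E T \<subseteq> set (map set cs)"
    proof
      fix A assume "A \<in> outer_cycles V E T"
      then obtain v where "v \<in> \<Union> (set ` set cs)" "A = {u. (adj (E - T))\<^sup>*\<^sup>* v u}"
        unfolding outer_cycles_def leaves by blast
      then show "A \<in> set (map set cs)" using decomp_component by auto
    qed
    show "set (map set cs) \<subseteq> outer_cycles V E T"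
    proof
      fix A assume "A \<in> set (map set cs)"
      then obtain xs where xs: "xs \<in> set cs" "A = set xs" by auto
      then have "hd xs \<in> set xs" using decomp_cycle(1) by simp
      then have "{u. (adj (E - T))\<^sup>*\<^sup>* (hd xs) u} = A" "hd xs \<in> leaves V T"
        using decomp_component xs by (blast, auto simp: leaves)
      then show "A \<in> outer_cycles V E T" unfolding outer_cycles_def by blast
    qed
  qed
  \<comment> \<open>Outer cycles form a set of vertex sets. Cycles of equal length are still counted
    separately because their vertex sets are nonempty and disjoint, hence different.\<close>
  moreover have "distinct (map set cs)"
    using distinct_concat_sets[OF decomp_facts(5)] decomp_cycle(1) by blast
  ultimately have "oc V E T = image_mset card (mset (map set cs))"
    by (simp only: oc_def mset_set_set)
  also have "\<dots> = mset (map length cs)"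
  proof -
    have "image_mset card (mset (map set cs)) = mset (map (card \<circ> set) cs)"
      by (simp add: multiset.map_comp)
    also have "map (card \<circ> set) cs = map length cs"
      using decomp_cycle(2) by (auto simp: distinct_card)
    finally show ?thesis .
  qed
  finally show ?thesis .
qed

end

section \<open>Lengthening an outer cycle\<close>

lemma no_short_cycle_triangle:
  assumes "no_short_cycle E" "{x, y} \<in> E" "{y, z} \<in> E" "x \<noteq> z"
  shows "{x, z} \<notin> E"
  using assms unfolding no_short_cycle_def by blast

lemma no_short_cycle_quad:
  assumes "no_short_cycle E" "{x, y} \<in> E" "{y, z} \<in> E" "x \<noteq> z" "{x, w} \<in> E" "{w, z} \<in> E"
  shows "w = y"
  using assms unfolding no_short_cycle_def by blast

lemma no_short_cycleI:
  assumes tri: "\<And>x y z. {x, y} \<in> E \<Longrightarrow> {y, z} \<in> E \<Longrightarrow> {z, x} \<in> E \<Longrightarrow> x \<noteq> z \<Longrightarrow> False"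
    and quad: "\<And>x y z w. {x, y} \<in> E \<Longrightarrow> {y, z} \<in> E \<Longrightarrow> {z, w} \<in> E \<Longrightarrow> {w, x} \<in> E
      \<Longrightarrow> x \<noteq> z \<Longrightarrow> y \<noteq> w \<Longrightarrow> False"
  shows "no_short_cycle E"
  unfolding no_short_cycle_def
proof (intro allI impI conjI notI)
  fix x y z assume *: "{x, y} \<in> E \<and> {y, z} \<in> E \<and> x \<noteq> z" and "{x, z} \<in> E"
  then have "{z, x} \<in> E" by (simp add: insert_commute)
  then show False using tri * by blast
next
  fix x y z w assume *: "{x, y} \<in> E \<and> {y, z} \<in> E \<and> x \<noteq> z" "{x, w} \<in> E \<and> {w, z} \<in> E"
  then have "{z, w} \<in> E" "{w, x} \<in> E" by (simp_all add: insert_commute)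
  then show "w = y" using quad[of x y z w] * by blast
qed

text \<open>A triangle or quadrilateral of the larger graph either has only old vertices, and then
  lies in the old graph, or can be read off starting from one of its new vertices. Thus only the
  neighbourhoods of new vertices require inspection.\<close>

lemma no_short_cycle_extend:
  assumes nsc: "no_short_cycle E" and sgE: "simple_graph W F"
    and old: "\<And>x y. x \<in> V \<Longrightarrow> y \<in> V \<Longrightarrow> {x, y} \<in> F \<Longrightarrow> {x, y} \<in> E"
    and tri: "\<And>x y z. x \<in> W - V \<Longrightarrow> {x, y} \<in> F \<Longrightarrow> {x, z} \<in> F \<Longrightarrow> y \<noteq> z \<Longrightarrow> {y, z} \<in> F \<Longrightarrow> False"
    and quad: "\<And>x y z w. x \<in> W - V \<Longrightarrow> {x, y} \<in> F \<Longrightarrow> {x, z} \<in> F \<Longrightarrow> y \<noteq> z \<Longrightarrow> {y, w} \<in> F \<Longrightarrow> {z, w} \<in> F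
      \<Longrightarrow> w \<noteq> x \<Longrightarrow> False"
  shows "no_short_cycle F"
proof (rule no_short_cycleI)
  fix x y z assume *: "{x, y} \<in> F" "{y, z} \<in> F" "{z, x} \<in> F" "x \<noteq> z"
  have W: "x \<in> W" "y \<in> W" "z \<in> W" using simple_graph_pairD[OF sgE] * by blast+
  have ne: "x \<noteq> y" "y \<noteq> z" using simple_graph_pairD[OF sgE] * by blast+
  have **: "{y, x} \<in> F" "{z, y} \<in> F" "{x, z} \<in> F" using * by (simp_all add: insert_commute)
  show False
  proof (cases "x \<in> V \<and> y \<in> V \<and> z \<in> V")
    case True
    then show False using no_short_cycle_triangle[OF nsc] old * ** by metis
  next
    case False
    then consider "x \<in> W - V" | "y \<in> W - V" | "z \<in> W - V" using W by blast
    then show False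
    proof cases
      case 1 then show ?thesis using tri[of x y z] * ** ne by blast
    next
      case 2 then show ?thesis using tri[of y x z] * ** ne by blast
    next
      case 3 then show ?thesis using tri[of z x y] * ** ne by blast
    qed
  qed
next
  fix x y z w assume *: "{x, y} \<in> F" "{y, z} \<in> F" "{z, w} \<in> F" "{w, x} \<in> F" "x \<noteq> z" "y \<noteq> w"
  have W: "x \<in> W" "y \<in> W" "z \<in> W" "w \<in> W" using simple_graph_pairD[OF sgE] * by blast+
  have **: "{y, x} \<in> F" "{z, y} \<in> F" "{w, z} \<in> F" "{x, w} \<in> F" using * by (simp_all add: insert_commute)
  show False
  proof (cases "x \<in> V \<and> y \<in> V \<and> z \<in> V \<and> w \<in> V")
    case True
    then have "w = y" using no_short_cycle_quad[OF nsc, of x y z w] old * ** by blast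
    then show False using * by blast
  next
    case False
    then consider "x \<in> W - V" | "y \<in> W - V" | "z \<in> W - V" | "w \<in> W - V" using W by blast
    then show False
    proof cases
      case 1 then show ?thesis using quad[of x y w z] * ** by blast
    next
      case 2 then show ?thesis using quad[of y x z w] * ** by blast
    next
      case 3 then show ?thesis using quad[of z y w x] * ** by blast
    next
      case 4 then show ?thesis using quad[of w x z y] * ** by blast
    qed
  qed
qed

text \<open>The neighbours of \<open>p\<close> are a, b and q. A short cycle through
  \<open>p\<close> would use the deleted edge ab, an edge between {a, b} and {c, d}, which
  \<open>far\<close> forbids, or a common neighbour of a and b, which together with ab is a triangle
  of the old graph. The same holds for \<open>q\<close>.\<close>

lemma ins_no_short_cycle:
  assumes g: "cubic V E" "{a, b} \<in> E" "{c, d} \<in> E" "{a, b} \<inter> {c, d} = {}" "p \<notin> V" "q \<notin> V" "p \<noteq> q"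
    and nsc: "no_short_cycle E"
    and far: "\<And>x y. x \<in> {a, b} \<Longrightarrow> y \<in> {c, d} \<Longrightarrow> {x, y} \<notin> E"
  shows "no_short_cycle (ins p q a b c d E)"
proof -
  let ?F = "ins p q a b c d E"
  have sgE: "simple_graph V E" using g(1) by (simp add: cubic_def)
  note V = simple_graph_pairD[OF sgE]
  have mem: "a \<in> V" "b \<in> V" "c \<in> V" "d \<in> V" "a \<noteq> b" "c \<noteq> d" using V g(2,3) by blast+
  have old: "{x, y} \<in> E \<and> {x, y} \<noteq> {a, b} \<and> {x, y} \<noteq> {c, d}" if "x \<in> V" "y \<in> V" "{x, y} \<in> ?F" for x y
    using that g(5,6) by (auto simp: ins_def doubleton_eq_iff)
  have Np: "y \<in> {a, b, q}" if "{p, y} \<in> ?F" for y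
    using that V[of p y] g(5-7) mem by (auto simp: ins_def doubleton_eq_iff)
  have Nq: "y \<in> {c, d, p}" if "{q, y} \<in> ?F" for y
    using that V[of q y] g(5-7) mem by (auto simp: ins_def doubleton_eq_iff)
  have pqV: "p \<noteq> x" "q \<noteq> x" if "x \<in> V" for x using that g(5,6) by auto
  have disj: "a \<noteq> c" "a \<noteq> d" "b \<noteq> c" "b \<noteq> d" using g(4) by auto
  have ab: "{a, b} \<notin> ?F" "{b, a} \<notin> ?F" "{c, d} \<notin> ?F" "{d, c} \<notin> ?F"
    using old mem by (metis insert_commute)+
  have cross: "{x, y} \<notin> ?F" "{y, x} \<notin> ?F" if "x \<in> {a, b}" "y \<in> {c, d}" for x y
    using far[OF that] old[of x y] old[of y x] that mem by (auto simp: insert_commute)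
  have qa: "{q, x} \<notin> ?F" "{x, q} \<notin> ?F" if "x \<in> {a, b}" for x
    using that Nq[of x] disj pqV mem by (auto simp: insert_commute)
  have pc: "{p, y} \<notin> ?F" "{y, p} \<notin> ?F" if "y \<in> {c, d}" for y
    using that Np[of y] disj pqV mem by (auto simp: insert_commute)
  have sgF: "simple_graph (insert p (insert q V)) ?F" by (rule ins_simple[OF g])
  have common: False if "{x, y} \<in> E" "x \<in> V" "y \<in> V" "w \<in> V" "{x, w} \<in> ?F" "{y, w} \<in> ?F" for x y w
    using no_short_cycle_triangle[OF nsc that(1), of w] old[OF that(2,4,5)] old[OF that(3,4,6)] V(1)[of x w] by blast
  have four: "x = p \<or> x = q \<or> x \<in> V" if "{x, y} \<in> ?F" for x y
    using simple_graph_pairD(2)[OF sgF that] by blast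
  show ?thesis
  proof (rule no_short_cycle_extend[OF nsc sgF, of V])
    show "{x, y} \<in> E" if "x \<in> V" "y \<in> V" "{x, y} \<in> ?F" for x y using old that by blast
  next
    fix x y z assume *: "x \<in> insert p (insert q V) - V" "{x, y} \<in> ?F" "{x, z} \<in> ?F" "y \<noteq> z" "{y, z} \<in> ?F"
    then consider "x = p" "y \<in> {a, b, q}" "z \<in> {a, b, q}" | "x = q" "y \<in> {c, d, p}" "z \<in> {c, d, p}"
      using Np Nq by blast
    then show False
    proof cases
      case 1 then show ?thesis using *(4,5) ab qa by blast
    next
      case 2 then show ?thesis using *(4,5) ab pc by blast
    qed
  next
    fix x y z w assume *: "x \<in> insert p (insert q V) - V" "{x, y} \<in> ?F" "{x, z} \<in> ?F" "y \<noteq> z"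
      "{y, w} \<in> ?F" "{z, w} \<in> ?F" "w \<noteq> x"
    have wW: "w = p \<or> w = q \<or> w \<in> V" using simple_graph_pairD(3)[OF sgF *(5)] by blast
    from *(1) consider "x = p" | "x = q" by blast
    then show False
    proof cases
      case 1
      have no: False if "u \<in> {a, b}" "{u, w} \<in> ?F" "{q, w} \<in> ?F" for u
        using Nq[OF that(3)] cross(1)[OF that(1)] that(2) *(7) 1 by blast
      have yz: "y \<in> {a, b, q}" "z \<in> {a, b, q}" using Np * 1 by blast+
      show ?thesis
      proof (cases "y = q \<or> z = q")
        case True
        then show ?thesis using no yz *(4-6) by blast
      next
        case False
        then have "{y, z} = {a, b}" using yz *(4) by blast
        moreover have "w \<in> V" using wW qa *(5,7) yz False 1 by blast
        ultimately show ?thesis using common[of y z w] g(2) yz False *(5,6) mem by auto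
      qed
    next
      case 2
      have no: False if "u \<in> {c, d}" "{u, w} \<in> ?F" "{p, w} \<in> ?F" for u
        using Np[OF that(3)] cross(2)[OF _ that(1)] that(2) *(7) 2 by blast
      have yz: "y \<in> {c, d, p}" "z \<in> {c, d, p}" using Nq * 2 by blast+
      show ?thesis
      proof (cases "y = p \<or> z = p")
        case True
        then show ?thesis using no yz *(4-6) by blast
      next
        case False
        then have "{y, z} = {c, d}" using yz *(4) by blast
        moreover have "w \<in> V" using wW pc *(5,7) yz False 2 by blast
        ultimately show ?thesis using common[of y z w] g(3) yz False *(5,6) mem by auto
      qed
    qed
  qed
qed

text \<open>\<open>U\<close> is carried through all constructions unchanged. Since no step deletes
  one of its edges, the absence of a 3-edge-colouring never has to be proved again.\<close>

definition hist_snark ::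
  "'a set \<Rightarrow> 'a set set \<Rightarrow> 'a set set \<Rightarrow> 'a list list \<Rightarrow> 'a set set \<Rightarrow> bool" where
  "hist_snark V E T cs U \<longleftrightarrow> hist_decomp V E T cs \<and> cut4 V E \<and> no_short_cycle E \<and>
     U \<subseteq> E \<and> \<not> (\<exists>c. edge_colouring3 U c)"

lemma edge_colouring3_subset: "edge_colouring3 E c \<Longrightarrow> U \<subseteq> E \<Longrightarrow> edge_colouring3 U c"
  unfolding edge_colouring3_def by (meson subsetD)

lemma hist_snark_snark:
  assumes "hist_snark V E T cs U"
  shows "snark V E" "hist V E T" "oc V E T = mset (map length cs)"
proof -
  have dec: "hist_decomp V E T cs" using assms by (simp add: hist_snark_def)
  then have "cubic V E" "finite V" by (auto simp: hist_decomp_def cubic_def simple_graph_def)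
  then show "snark V E"
    using assms cut4_cyclically_edge_connected no_short_cycle_girth edge_colouring3_subset
    unfolding snark_def hist_snark_def by metis
  show "hist V E T" "oc V E T = mset (map length cs)"
    using decomp_hist[OF dec] decomp_oc[OF dec] by auto
qed

text \<open>A cycle can be lengthened if its closing edge may be deleted, that is, if that edge is
  not part of the non-colourable subgraph.\<close>

definition free :: "'a set set \<Rightarrow> 'a list \<Rightarrow> bool" where
  "free U xs \<longleftrightarrow> {last xs, hd xs} \<notin> U"

text \<open>The invariant of the induction: \<open>k\<close> bounds from below the stock of tree
  edges that may be subdivided, \<open>A\<close> records lengths of cycles whose closing edge is
  still free, and \<open>M\<close> is the multiset reached. Both \<open>k\<close> and
  \<open>A\<close> are lower bounds, so they can be relaxed between steps.\<close>

definition attains :: "nat \<Rightarrow> nat multiset \<Rightarrow> nat multiset \<Rightarrow> bool" where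
  "attains k A M \<longleftrightarrow> (\<exists>n E T cs U. hist_snark {..<n :: nat} E T cs U \<and> k \<le> card (T - U) \<and>
     A \<subseteq># mset (map length (filter (free U) cs)) \<and> mset (map length cs) = M)"

context
  fixes V :: "'a set" and E T :: "'a set set" and cs :: "'a list list"
  assumes dec: "hist_decomp V E T cs"
begin

lemma leaf_nbrs:
  assumes xs: "xs \<in> set cs" and v: "v \<in> set xs" and m: "{v, m} \<in> cedges xs"
  shows "\<exists>v1 t. v1 \<in> set xs \<and> {v, t} \<in> T \<and> (\<forall>y. {v, y} \<in> E \<longrightarrow> y = m \<or> y = v1 \<or> y = t) \<and>
    (\<forall>e \<in> T. v \<in> e \<longrightarrow> e = {v, t})"
proof -
  note fs = decomp_facts[OF dec] and cy = decomp_cycle[OF dec xs]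
  have "card {e \<in> cedges xs. v \<in> e} = 2" by (rule cedges_degree[OF cy(2) fs(6)[OF xs] v])
  then obtain e1 e2 where e12: "{e \<in> cedges xs. v \<in> e} = {e1, e2}" by (auto simp: card_2_iff)
  have "{v, m} \<in> {e \<in> cedges xs. v \<in> e}" using m by simp
  then have "{v, m} = e1 \<or> {v, m} = e2" unfolding e12 by blast
  then obtain e' where e': "{e \<in> cedges xs. v \<in> e} = {{v, m}, e'}"
    using e12 by (metis insert_commute)
  then have "e' \<in> cedges xs" "v \<in> e'" by blast+
  then obtain v1 where v1: "e' = {v, v1}" "v1 \<in> set xs"
  proof -
    have "e' \<in> E" using \<open>e' \<in> cedges xs\<close> cy(3) by blast
    then obtain x y where "e' = {x, y}" using simple_graph_edgeE[OF fs(7)] by metis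
    then obtain z where "e' = {v, z}" using \<open>v \<in> e'\<close> by (metis insertE insert_commute singletonD)
    moreover have "z \<in> set xs" using cedges_subset[OF cy(1) \<open>e' \<in> cedges xs\<close>] calculation by blast
    ultimately show ?thesis using that by blast
  qed
  have "v \<in> V" "v \<in> set (concat cs)" using v xs cy(4) by auto
  then have "degree T v = 1" using decomp_degree[OF dec, of v] by presburger
  then obtain et where et: "{e \<in> T. v \<in> e} = {et}" unfolding degree_def by (rule card_1_singletonE)
  then have "et \<in> T" "v \<in> et" by blast+
  then obtain x y where "et = {x, y}" using simple_graph_edgeE[OF fs(7)] fs(3) by (metis subsetD)
  then obtain t where t: "et = {v, t}" using \<open>v \<in> et\<close> by (metis insertE insert_commute singletonD)
  have nb: "y = m \<or> y = v1 \<or> y = t" if "{v, y} \<in> E" for y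
  proof (cases "{v, y} \<in> T")
    case True
    then have "{v, y} \<in> {e \<in> T. v \<in> e}" by simp
    then have "{v, y} = {v, t}" unfolding et t by simp
    then show ?thesis by (auto simp: doubleton_eq_iff)
  next
    case False
    then have "{v, y} \<in> {e \<in> cedges xs. v \<in> e}"
      using that decomp_edges_at[OF dec xs v] by blast
    then have "{v, y} = {v, m} \<or> {v, y} = {v, v1}" unfolding e' v1(1) by simp
    then show ?thesis by (auto simp: doubleton_eq_iff)
  qed
  have uniq: "e = {v, t}" if "e \<in> T" "v \<in> e" for e
  proof -
    have "e \<in> {e \<in> T. v \<in> e}" using that by simp
    then show ?thesis unfolding et t by simp
  qed
  have "{v, t} \<in> T" using \<open>et \<in> T\<close> t by simp
  then show ?thesis using v1(2) nb uniq by blast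
qed

text \<open>Apart from c and d, the vertices adjacent to c or d are the cycle neighbours
  \<open>c1\<close>, \<open>d1\<close> and the tree neighbours \<open>ct\<close>, \<open>dt\<close>.
  The former are leaves and meet one tree edge each, the latter at most three each, so at most 1 + 1
  + 3 + 3 = 8 tree edges are blocked and a ninth is far. The tree edges at c and d themselves are
  among the blocked ones, as they contain \<open>ct\<close> and \<open>dt\<close>.\<close>

lemma far_tree_edge:
  assumes xs: "xs \<in> set cs" and pool: "9 \<le> card (T - U)" and cd: "{c, d} \<in> cedges xs"
  shows "\<exists>a b. {a, b} \<in> T - U \<and> {a, b} \<inter> {c, d} = {} \<and> (\<forall>x \<in> {a, b}. \<forall>y \<in> {c, d}. {x, y} \<notin> E)"
proof -
  note fs = decomp_facts[OF dec] and cy = decomp_cycle[OF dec xs]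
  have fT: "finite T" using simple_graph_finite[OF fs(7)] fs(3) finite_subset by blast
  have cdx: "c \<in> set xs" "d \<in> set xs" using cedges_subset[OF cy(1) cd] by auto
  have dc: "{d, c} \<in> cedges xs" using cd by (simp add: insert_commute)
  obtain c1 ct where c: "c1 \<in> set xs" "{c, ct} \<in> T" "\<forall>y. {c, y} \<in> E \<longrightarrow> y = d \<or> y = c1 \<or> y = ct"
    "\<forall>e \<in> T. c \<in> e \<longrightarrow> e = {c, ct}" using leaf_nbrs[OF xs cdx(1) cd] by blast
  obtain d1 dt where d: "d1 \<in> set xs" "{d, dt} \<in> T" "\<forall>y. {d, y} \<in> E \<longrightarrow> y = c \<or> y = d1 \<or> y = dt"
    "\<forall>e \<in> T. d \<in> e \<longrightarrow> e = {d, dt}"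
    using leaf_nbrs[OF xs cdx(2) dc] by blast
  define B where "B = {e \<in> T. c1 \<in> e} \<union> {e \<in> T. d1 \<in> e} \<union> {e \<in> T. ct \<in> e} \<union> {e \<in> T. dt \<in> e}"
  have 1: "card {e \<in> T. v \<in> e} = 1" if "v \<in> set xs" for v
  proof -
    have "v \<in> V" "v \<in> set (concat cs)" using that xs cy(4) by auto
    then show ?thesis using decomp_degree[OF dec, of v] unfolding degree_def by presburger
  qed
  have 3: "card {e \<in> T. v \<in> e} \<le> 3" if "v \<in> V" for v
    using decomp_degree[OF dec that] unfolding degree_def by (metis one_le_numeral order_refl)
  have "ct \<in> V" "dt \<in> V" using simple_graph_pairD(3)[OF fs(7)] c(2) d(2) fs(3) by blast+
  then have "card B \<le> 1 + 1 + 3 + 3" unfolding B_def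
    using 1[OF c(1)] 1[OF d(1)] 3[of ct] 3[of dt] by (intro order_trans[OF card_Un_le] add_mono) auto
  moreover have "finite B" using fT by (simp add: B_def)
  ultimately have "\<not> T - U \<subseteq> B" using pool card_mono[of B "T - U"] by linarith
  then obtain e where e: "e \<in> T - U" "e \<notin> B" by blast
  then obtain a b where ab: "e = {a, b}" using simple_graph_edgeE[OF fs(7)] fs(3) by (metis DiffD1 subsetD)
  have noB: "x \<noteq> c1" "x \<noteq> d1" "x \<noteq> ct" "x \<noteq> dt" if "x \<in> e" for x using e that by (auto simp: B_def)
  have noc: "x \<noteq> c" "x \<noteq> d" if "x \<in> e" for x
  proof -
    have "e \<in> T" using e by blast
    then show "x \<noteq> c" "x \<noteq> d" using c(4) d(4) that noB(3,4) by blast+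
  qed
  have "{x, y} \<notin> E" if "x \<in> e" "y \<in> {c, d}" for x y
  proof
    assume "{x, y} \<in> E"
    then have "{y, x} \<in> E" by (simp add: insert_commute)
    then show False using that(2) c(3) d(3) noB[OF that(1)] noc[OF that(1)] by blast
  qed
  moreover have "e \<inter> {c, d} = {}" using noc by blast
  ultimately show ?thesis using e(1) unfolding ab by blast
qed

end

text \<open>Vertex n subdivides the far tree edge and \<open>Suc n\<close> the closing edge of the
  cycle; their joining edge enters the tree, so \<open>Suc n\<close> is a leaf between the last and
  the first vertex. The step can be repeated: the new closing edge contains \<open>Suc n\<close>,
  hence is free, and the stock of spare tree edges does not shrink.\<close>

lemma lengthen_cycle:
  fixes E :: "nat set set"
  assumes hs: "hist_snark {..<n} E T (us @ xs # vs) U" and pool: "9 \<le> card (T - U)" and fr: "free U xs"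
  obtains E' T' where "hist_snark {..<n + 2} E' T' (us @ (xs @ [Suc n]) # vs) U" "9 \<le> card (T' - U)"
    "free U (xs @ [Suc n])"
proof -
  let ?cs = "us @ xs # vs"
  have dec: "hist_decomp {..<n} E T ?cs" using hs by (simp add: hist_snark_def)
  note fs = decomp_facts[OF dec]
  have xs: "xs \<in> set ?cs" by simp
  note cy = decomp_cycle[OF dec xs]
  define c d where "c = last xs" and "d = hd xs"
  have cd: "{c, d} \<in> cedges xs" by (simp add: cedges_def c_def d_def)
  then have cdE: "{c, d} \<in> E" "{c, d} \<notin> T" using cy(3) by blast+
  obtain a b where ab: "{a, b} \<in> T - U" "{a, b} \<inter> {c, d} = {}"
    "\<forall>x \<in> {a, b}. \<forall>y \<in> {c, d}. {x, y} \<notin> E"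
    using far_tree_edge[OF dec xs pool cd] by blast
  then have abE: "{a, b} \<in> E" "{a, b} \<in> T" using fs(3) by blast+
  define E' where "E' = ins n (Suc n) a b c d E"
  define T' where "T' = insert {n, Suc n} (insert {a, n} (insert {b, n} (T - {{a, b}})))"
  have E'_eq: "E' = (E - {{a, b}, {c, d}}) \<union> {{a, n}, {b, n}, {n, Suc n}} \<union> {{c, Suc n}, {d, Suc n}}"
    by (auto simp: E'_def ins_def)
  have T'_eq: "T' = (T - {{a, b}}) \<union> {{a, n}, {b, n}, {n, Suc n}}" by (auto simp: T'_def)
  have V: "insert n (insert (Suc n) {..<n}) = {..<n + 2}" by auto
  note g = fs(1) abE(1) cdE(1) ab(2)
  have g': "n \<notin> {..<n}" "Suc n \<notin> {..<n}" "n \<noteq> Suc n" by auto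
  have lt: "a < n" "b < n" "c < n" "d < n" using simple_graph_pairD[OF fs(7)] abE(1) cdE(1) by blast+
  have new: "{x, n} \<notin> E" "{x, Suc n} \<notin> E" for x
    using simple_graph_pairD(3)[OF fs(7), of x n] simple_graph_pairD(3)[OF fs(7), of x "Suc n"] by auto
  have cub: "cubic {..<n + 2} E'" using ins_cubic[OF g g'] by (simp add: E'_def V)
  have "cut4 {..<n} E" "no_short_cycle E" "U \<subseteq> E" and nocol: "\<not> (\<exists>c. edge_colouring3 U c)"
    using hs by (simp_all add: hist_snark_def)
  then have cut: "cut4 {..<n + 2} E'" and nsc: "no_short_cycle E'"
    using ins_cut4[OF g g'] ins_no_short_cycle[OF g g'] ab(3) by (simp_all add: E'_def V)
  have "{c, d} \<notin> U" using fr by (simp add: free_def c_def d_def)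
  then have U: "U \<subseteq> E'" using \<open>U \<subseteq> E\<close> ab(1) by (auto simp: E'_def ins_def)
  have tr: "tree {..<n + 2} T'"
  proof -
    have "tree (insert n {..<n}) (insert {a, n} (insert {b, n} (T - {{a, b}})))"
      by (rule tree_subdivide[OF fs(2) abE(2)]) simp
    then have "tree (insert (Suc n) (insert n {..<n})) T'" unfolding T'_def
      by (rule tree.leaf) auto
    then show ?thesis by (simp add: V insert_commute)
  qed
  have newU: "{x, n} \<notin> U" "{x, Suc n} \<notin> U" for x using new \<open>U \<subseteq> E\<close> by blast+
  have len: "3 \<le> length xs" by (rule fs(6)[OF xs])
  have ce: "cedges (xs @ [Suc n]) = cedges xs - {{c, d}} \<union> {{c, Suc n}, {d, Suc n}}"
    using cedges_append[OF cy(2) len] by (simp add: c_def d_def)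
  have others: "{c, d} \<notin> cedges ys" if "ys \<in> set us \<union> set vs" for ys
  proof
    assume *: "{c, d} \<in> cedges ys"
    have ys: "ys \<in> set ?cs" using that by auto
    have "c \<in> set ys" "c \<in> set xs"
      using cedges_subset[OF decomp_cycle(1)[OF dec ys] *] cedges_subset[OF cy(1) cd] by auto
    then show False using fs(5) that by (auto simp: distinct_concat_iff)
  qed
  have diff: "E' - T' = \<Union> (cedges ` set (us @ (xs @ [Suc n]) # vs))"
  proof -
    have "E' - T' = (E - T) - {{c, d}} \<union> {{c, Suc n}, {d, Suc n}}"
    proof -
      \<comment> \<open>Here x is the subdivided tree edge, y the subdivided cycle edge, N the three
        new tree edges and M the two new cycle edges.\<close>
      have calc: "E' - T' = E - T - {y} \<union> M"
        if "E' = (E - {x, y}) \<union> N \<union> M" "T' = (T - {x}) \<union> N" "N \<inter> E = {}" "M \<inter> T' = {}" "x \<in> T"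
        for x y N M using that by blast
      have "{c, Suc n} \<notin> T'" "{d, Suc n} \<notin> T'"
        using new fs(3) lt by (auto simp: T'_def doubleton_eq_iff)
      then have 1: "{{c, Suc n}, {d, Suc n}} \<inter> T' = {}" by blast
      have 2: "{{a, n}, {b, n}, {n, Suc n}} \<inter> E = {}" using new by blast
      show ?thesis by (rule calc[OF E'_eq T'_eq 2 1 abE(2)])
    qed
    moreover have "E - T = cedges xs \<union> \<Union> (cedges ` (set us \<union> set vs))" using fs(4) by auto
    moreover have "{c, d} \<notin> \<Union> (cedges ` (set us \<union> set vs))" using others by blast
    ultimately have "E' - T' = cedges (xs @ [Suc n]) \<union> \<Union> (cedges ` (set us \<union> set vs))"
      unfolding ce by blast
    then show ?thesis by auto
  qed
  have TE: "T' \<subseteq> E'"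
  proof -
    have "T - {x} \<union> N \<subseteq> (E - {x, y}) \<union> N \<union> M" if "y \<notin> T" for x y N M using fs(3) that by blast
    then show ?thesis unfolding E'_eq T'_eq using cdE(2) .
  qed
  have dist: "distinct (concat (us @ (xs @ [Suc n]) # vs))"
  proof -
    have "set (concat ?cs) \<subseteq> {..<n}" using decomp_cycle(4)[OF dec] by auto
    then have "Suc n \<notin> set (concat ?cs)" by auto
    then show ?thesis using fs(5) by auto
  qed
  have "hist_decomp {..<n + 2} E' T' (us @ (xs @ [Suc n]) # vs)"
  proof -
    have "3 \<le> length ys" if "ys \<in> set (us @ (xs @ [Suc n]) # vs)" for ys
      using that fs(6)[of ys] len by (cases "ys = xs @ [Suc n]") auto
    then show ?thesis unfolding hist_decomp_def using cub tr TE diff dist by blast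
  qed
  then have "hist_snark {..<n + 2} E' T' (us @ (xs @ [Suc n]) # vs) U"
    unfolding hist_snark_def using cut nsc U nocol by blast
  moreover have "9 \<le> card (T' - U)"
  proof -
    have fT: "finite T" using simple_graph_finite[OF fs(7)] fs(3) finite_subset by blast
    \<comment> \<open>The lost spare edge {a, b} is replaced by {a, n}, which contains a new vertex
      and so lies outside \<open>U\<close>.\<close>
    have "card (T - U) \<le> card (insert {a, n} (T - U - {{a, b}}))"
      using ab(1) new fs(3) fT by (subst card_insert_disjoint) (auto simp: card_Diff_singleton)
    also have "\<dots> \<le> card (T' - U)" using newU fT by (intro card_mono) (auto simp: T'_def)
    finally show ?thesis using pool by simp
  qed
  moreover have "free U (xs @ [Suc n])" using newU cy(1) by (simp add: free_def insert_commute)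
  ultimately show ?thesis by (rule that)
qed

lemma attains_lengthen:
  assumes "attains 9 (add_mset c A) (add_mset c M)"
  shows "attains 9 (add_mset (Suc c) A) (add_mset (Suc c) M)"
proof -
  obtain n E T cs U where *: "hist_snark {..<n :: nat} E T cs U" "9 \<le> card (T - U)"
      "add_mset c A \<subseteq># mset (map length (filter (free U) cs))" "mset (map length cs) = add_mset c M"
    using assms by (auto simp: attains_def)
  have "c \<in># mset (map length (filter (free U) cs))" using *(3) by (meson mset_subset_eqD union_single_eq_member)
  then obtain xs where xs: "xs \<in> set cs" "free U xs" "length xs = c" by auto
  then obtain us vs where cs: "cs = us @ xs # vs" by (meson split_list)
  obtain E' T' where "hist_snark {..<n + 2} E' T' (us @ (xs @ [Suc n]) # vs) U" "9 \<le> card (T' - U)"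
      "free U (xs @ [Suc n])"
    by (rule lengthen_cycle[OF *(1)[unfolded cs] *(2) xs(2)])
  moreover have "add_mset (Suc c) A \<subseteq># mset (map length (filter (free U) (us @ (xs @ [Suc n]) # vs)))"
    using *(3) xs calculation(3) by (simp add: cs)
  moreover have "mset (map length (us @ (xs @ [Suc n]) # vs)) = add_mset (Suc c) M"
    using *(4) xs by (simp add: cs)
  ultimately show ?thesis unfolding attains_def by blast
qed

lemma attains_lengthen_le:
  assumes "attains 9 (add_mset c A) (add_mset c M)" "c \<le> d"
  shows "attains 9 (add_mset d A) (add_mset d M)"
  using assms(2,1) by (induction rule: dec_induct) (auto intro: attains_lengthen)

lemma attains_weaken:
  assumes "attains k A M" "k' \<le> k" "A' \<subseteq># A"
  shows "attains k' A' M"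
proof -
  obtain n E T cs U where "hist_snark {..<n :: nat} E T cs U" "k \<le> card (T - U)"
      "A \<subseteq># mset (map length (filter (free U) cs))" "mset (map length cs) = M"
    using assms(1) unfolding attains_def by blast
  moreover from this have "k' \<le> card (T - U)" "A' \<subseteq># mset (map length (filter (free U) cs))"
    using assms(2,3) by (simp, blast intro: subset_mset.order_trans)
  ultimately show ?thesis unfolding attains_def by blast
qed

section \<open>Attaching a new outer cycle\<close>

text \<open>The 5-cycle \<open>n + 5, \<dots>, n + 9\<close>, whose vertex \<open>n + 5 + i\<close> is joined to
  a new vertex \<open>n + i\<close> subdividing the edge \<open>{a i, b i}\<close>.\<close>

definition spokes :: "nat \<Rightarrow> (nat \<Rightarrow> nat) \<Rightarrow> (nat \<Rightarrow> nat) \<Rightarrow> nat \<Rightarrow> nat set set" where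
  "spokes n a b k = (\<Union>i<k. {{a i, n + i}, {b i, n + i}, {n + i, n + 5 + i}})"

definition rim :: "nat \<Rightarrow> nat set set" where
  "rim n = cedges [n + 5, n + 6, n + 7, n + 8, n + 9]"

text \<open>In the new Hist all spokes are tree edges and the rim is the additional outer cycle;
  only tree edges are subdivided, so the old outer cycles remain as they are.\<close>

definition attach :: "nat \<Rightarrow> (nat \<Rightarrow> nat) \<Rightarrow> (nat \<Rightarrow> nat) \<Rightarrow> nat set set \<Rightarrow> nat set set" where
  "attach n a b E = (E - (\<lambda>i. {a i, b i}) ` {..<5}) \<union> spokes n a b 5 \<union> rim n"

lemma lessThan_5: "{..<5 :: nat} = {0, 1, 2, 3, 4}"
  by (auto simp: numeral_eq_Suc less_Suc_eq)

lemma rim_eq: "rim n = {{n + 5, n + 6}, {n + 6, n + 7}, {n + 7, n + 8}, {n + 8, n + 9}, {n + 9, n + 5}}"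
  by (auto simp: rim_def cedges_def)

context
  fixes n :: nat and a b :: "nat \<Rightarrow> nat" and E :: "nat set set"
  assumes cub: "cubic {..<n} E" and ab: "\<And>i. i < 5 \<Longrightarrow> {a i, b i} \<in> E"
    and inj: "inj_on (\<lambda>i. {a i, b i}) {..<5}"
begin

lemma attach_sg: "simple_graph {..<n} E"
  using cub by (simp add: cubic_def)

lemma attach_lt: "i < 5 \<Longrightarrow> a i < n" "i < 5 \<Longrightarrow> b i < n" "i < 5 \<Longrightarrow> a i \<noteq> b i"
  using simple_graph_pairD[OF attach_sg ab] by auto

lemma attach_old_lt: "{x, y} \<in> E \<Longrightarrow> x < n \<and> y < n"
  using simple_graph_pairD[OF attach_sg] by blast

lemma attach_old_new:
  assumes "{x, y} \<in> attach n a b E" "x < n"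
  shows "y < n \<and> {x, y} \<in> E \<and> {x, y} \<notin> (\<lambda>i. {a i, b i}) ` {..<5} \<or> (\<exists>i<5. y = n + i \<and> x \<in> {a i, b i})"
proof -
  consider "{x, y} \<in> E" "{x, y} \<notin> (\<lambda>i. {a i, b i}) ` {..<5}"
    | i where "i < 5" "{x, y} \<in> {{a i, n + i}, {b i, n + i}, {n + i, n + 5 + i}}" | "{x, y} \<in> rim n"
    using assms(1) unfolding attach_def spokes_def by blast
  then show ?thesis
  proof cases
    case 1 then show ?thesis using attach_old_lt by blast
  next
    case (2 i)
    then have "y = n + i \<and> x \<in> {a i, b i}" using assms(2) by (auto simp: doubleton_eq_iff)
    then show ?thesis using 2(1) by blast
  next
    case 3 then show ?thesis using assms(2) by (auto simp: rim_eq doubleton_eq_iff)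
  qed
qed

lemma attach_sub_nbrs:
  assumes "{n + i, y} \<in> attach n a b E" "i < 5"
  shows "y = a i \<or> y = b i \<or> y = n + 5 + i"
proof -
  consider "{n + i, y} \<in> E"
    | j where "j < 5" "{n + i, y} \<in> {{a j, n + j}, {b j, n + j}, {n + j, n + 5 + j}}" | "{n + i, y} \<in> rim n"
    using assms(1) unfolding attach_def spokes_def by blast
  then show ?thesis
  proof cases
    case 1 then show ?thesis using attach_old_lt[of "n + i" y] by simp
  next
    case (2 j)
    then show ?thesis using attach_lt(1,2)[of j] assms(2) by (auto simp: doubleton_eq_iff)
  next
    case 3 then show ?thesis using assms(2) by (auto simp: rim_eq doubleton_eq_iff)
  qed
qed

lemma attach_rim_nbrs:
  assumes "{n + 5 + i, y} \<in> attach n a b E" "i < 5"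
  shows "y = n + i \<or> y = n + 5 + (i + 1) mod 5 \<or> y = n + 5 + (i + 4) mod 5"
proof -
  consider "{n + 5 + i, y} \<in> E"
    | j where "j < 5" "{n + 5 + i, y} \<in> {{a j, n + j}, {b j, n + j}, {n + j, n + 5 + j}}" | "{n + 5 + i, y} \<in> rim n"
    using assms(1) unfolding attach_def spokes_def by blast
  then show ?thesis
  proof cases
    case 1 then show ?thesis using attach_old_lt[of "n + 5 + i" y] by simp
  next
    case (2 j)
    then show ?thesis using attach_lt(1,2)[of j] assms(2) by (auto simp: doubleton_eq_iff)
  next
    case 3
    have "i = 0 \<or> i = 1 \<or> i = 2 \<or> i = 3 \<or> i = 4" using assms(2) by linarith
    then show ?thesis using 3 by (elim disjE) (auto simp: rim_eq doubleton_eq_iff)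
  qed
qed

text \<open>The rim has length five, and distinct rim vertices lead to distinct subdividing
  vertices. The remaining danger is a common neighbour of the two ends of a subdivided edge: an old
  one would give a triangle in the old graph, and a new one \<open>n + j\<close> would mean that the
  edges with indices i and j coincide, against injectivity.\<close>

lemma attach_no_short_cycle:
  assumes nsc: "no_short_cycle E" and sgF: "simple_graph {..<n + 10} (attach n a b E)"
  shows "no_short_cycle (attach n a b E)"
proof (rule no_short_cycle_extend[OF nsc sgF, of "{..<n}"])
  let ?F = "attach n a b E"
  have comm: "{y, x} \<in> ?F" if "{x, y} \<in> ?F" for x y using that by (simp add: insert_commute)
  have s5: "(i + 1) mod 5 < (5::nat)" "(i + 4) mod 5 < (5::nat)" for i :: nat by simp_all
  \<comment> \<open>Arithmetic on the rim: + 1 is the cyclic successor and + 4 the cyclic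
    predecessor modulo 5.\<close>
  have c5: "(i + 1) mod 5 \<noteq> i \<and> (i + 4) mod 5 \<noteq> i \<and> (i + 1) mod 5 \<noteq> (i + 4) mod 5
      \<and> ((i + 1) mod 5 + 1) mod 5 \<noteq> (i + 4) mod 5 \<and> ((i + 1) mod 5 + 4) mod 5 = i
      \<and> ((i + 4) mod 5 + 4) mod 5 \<noteq> (i + 1) mod 5 \<and> ((i + 4) mod 5 + 1) mod 5 = i
      \<and> ((i + 1) mod 5 + 1) mod 5 \<noteq> ((i + 4) mod 5 + 4) mod 5" if "i < 5" for i :: nat
  proof -
    have "i = 0 \<or> i = 1 \<or> i = 2 \<or> i = 3 \<or> i = 4" using that by linarith
    then show ?thesis by (elim disjE) simp_all
  qed
  have old_rim: "{x, n + 5 + i} \<notin> ?F" if "x < n" "i < 5" for x i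
    using attach_old_new[of x "n + 5 + i"] that by auto
  have not_ab: "{a i, b i} \<notin> ?F" "{b i, a i} \<notin> ?F" if "i < 5" for i
    using attach_old_new[of "a i" "b i"] attach_lt(1,2)[OF that] comm that by auto
  have split: "(\<exists>i<5. x = n + i) \<or> (\<exists>i<5. x = n + 5 + i)" if "x \<in> {..<n + 10} - {..<n}" for x
  proof -
    have "n \<le> x" "x < n + 10" using that by auto
    then show ?thesis by (cases "x < n + 5") (auto intro: exI[of _ "x - n"] exI[of _ "x - n - 5"])
  qed
  have lt: "y < n" if "y = a i \<or> y = b i" "i < 5" for y i using attach_lt that by blast
  {
    fix x y assume "x \<in> {..<n}" "y \<in> {..<n}" "{x, y} \<in> ?F"
    then show "{x, y} \<in> E" using attach_old_new[of x y] by auto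
  next
    fix x y z assume *: "x \<in> {..<n + 10} - {..<n}" "{x, y} \<in> ?F" "{x, z} \<in> ?F" "y \<noteq> z" "{y, z} \<in> ?F"
    from split[OF *(1)] consider i where "i < 5" "x = n + i" | i where "i < 5" "x = n + 5 + i" by blast
    then show False
    proof cases
      case (1 i)
      then have "y = a i \<or> y = b i \<or> y = n + 5 + i" "z = a i \<or> z = b i \<or> z = n + 5 + i"
        using attach_sub_nbrs * by blast+
      then show False using * not_ab[OF 1(1)] old_rim[OF _ 1(1)] lt[OF _ 1(1)] comm by metis
    next
      case (2 i)
      define j l where "j = (i + 1) mod 5" and "l = (i + 4) mod 5"
      have jl: "j < 5" "l < 5" "j \<noteq> i" "l \<noteq> i" "j \<noteq> l" "(j + 1) mod 5 \<noteq> l" "(j + 4) mod 5 = i"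
        using c5[OF 2(1)] s5[of i] unfolding j_def l_def by blast+
      have yz: "y = n + i \<or> y = n + 5 + j \<or> y = n + 5 + l" "z = n + i \<or> z = n + 5 + j \<or> z = n + 5 + l"
        using attach_rim_nbrs[OF _ 2(1)] * 2(2) unfolding j_def l_def by blast+
      have no1: "{n + i, n + 5 + j'} \<notin> ?F" if "j' \<noteq> i" for j'
        using attach_sub_nbrs[OF _ 2(1), of "n + 5 + j'"] that attach_lt(1,2)[OF 2(1)] by auto
      have no2: "{n + 5 + j, n + 5 + l} \<notin> ?F"
      proof
        assume "{n + 5 + j, n + 5 + l} \<in> ?F"
        then have "n + 5 + l = n + j \<or> n + 5 + l = n + 5 + (j + 1) mod 5 \<or> n + 5 + l = n + 5 + (j + 4) mod 5"
          by (rule attach_rim_nbrs[OF _ jl(1)])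
        then show False using jl by simp
      qed
      show False using yz *(4,5) no1[OF jl(3)] no1[OF jl(4)] no2 comm by metis
    qed
  next
    fix x y z w assume *: "x \<in> {..<n + 10} - {..<n}" "{x, y} \<in> ?F" "{x, z} \<in> ?F" "y \<noteq> z"
      "{y, w} \<in> ?F" "{z, w} \<in> ?F" "w \<noteq> x"
    from split[OF *(1)] consider i where "i < 5" "x = n + i" | i where "i < 5" "x = n + 5 + i" by blast
    then show False
    proof cases
      case (1 i)
      have yz: "y = a i \<or> y = b i \<or> y = n + 5 + i" "z = a i \<or> z = b i \<or> z = n + 5 + i"
        using attach_sub_nbrs[OF _ 1(1)] * 1(2) by blast+
      have rimw: False if "{u, w} \<in> ?F" "u < n" "{n + 5 + i, w} \<in> ?F" for u
        using attach_rim_nbrs[OF that(3) 1(1)] old_rim[OF that(2)] that(1) *(7) 1(2) s5 by blast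
      have ab: False if "{a i, w} \<in> ?F" "{b i, w} \<in> ?F"
      proof -
        from attach_old_new[OF that(1) attach_lt(1)[OF 1(1)]] consider "w < n" "{a i, w} \<in> E"
          | j where "j < 5" "w = n + j" by blast
        then show False
        proof cases
          case 1
          then have "{b i, w} \<in> E"
            using attach_old_new[OF that(2) attach_lt(2)[OF \<open>i < 5\<close>]] by auto
          then have "{w, b i} \<in> E" by (simp add: insert_commute)
          then show False
            using no_short_cycle_triangle[OF nsc \<open>{a i, w} \<in> E\<close>] ab[OF \<open>i < 5\<close>] attach_lt(3)[OF \<open>i < 5\<close>] by blast
        next
          case (2 j)
          have "j \<noteq> i" using *(7) \<open>x = n + i\<close> 2 by blast
          have "{n + j, a i} \<in> ?F" "{n + j, b i} \<in> ?F" using that comm 2 by blast+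
          then have "a i = a j \<or> a i = b j" "b i = a j \<or> b i = b j"
            using attach_sub_nbrs[OF _ 2(1)] attach_lt[OF \<open>i < 5\<close>] by fastforce+
          then have "{a i, b i} = {a j, b j}" using attach_lt(3)[OF \<open>i < 5\<close>] by auto
          then have "i = j" using inj_onD[OF inj] 2(1) \<open>i < 5\<close> by simp
          then show False using \<open>j \<noteq> i\<close> by simp
        qed
      qed
      show False using yz *(4-6) ab rimw lt[OF _ 1(1)] by metis
    next
      case (2 i)
      define j l where "j = (i + 1) mod 5" and "l = (i + 4) mod 5"
      have jl: "j < 5" "l < 5" "(j + 4) mod 5 = i" "(l + 1) mod 5 = i" "(j + 1) mod 5 \<noteq> (l + 4) mod 5" "j \<noteq> l"
        using c5[OF 2(1)] s5[of i] unfolding j_def l_def by blast+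
      have yz: "y = n + i \<or> y = n + 5 + j \<or> y = n + 5 + l" "z = n + i \<or> z = n + 5 + j \<or> z = n + 5 + l"
        using attach_rim_nbrs[OF _ 2(1)] * 2(2) unfolding j_def l_def by blast+
      have pw: False if "{n + i, w} \<in> ?F" "{n + 5 + j', w} \<in> ?F" "j' < 5" for j'
        using attach_sub_nbrs[OF that(1) 2(1)] lt[OF _ 2(1)] old_rim[OF _ that(3)] comm[OF that(2)] *(7) 2(2)
        by blast
      have vw: False if "{n + 5 + j, w} \<in> ?F" "{n + 5 + l, w} \<in> ?F"
      proof -
        have "w = n + j \<or> w = n + 5 + (j + 1) mod 5" using attach_rim_nbrs[OF that(1) jl(1)] jl(3) *(7) 2(2) by auto
        moreover have "w = n + l \<or> w = n + 5 + (l + 4) mod 5" using attach_rim_nbrs[OF that(2) jl(2)] jl(4) *(7) 2(2) by auto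
        ultimately show False using jl by auto
      qed
      show False using yz *(4-6) pw[OF _ _ jl(1)] pw[OF _ _ jl(2)] vw by metis
    qed
  }
qed

text \<open>Keeps a chain of insertions in the normal form "old edges minus deleted ones, plus new
  ones", so that the result of five insertions can be computed explicitly.\<close>

lemma attach_layer:
  "ins p q u v w x ((E - G) \<union> N) =
    (E - (G \<union> {{u, v}, {w, x}})) \<union> ((N - {{u, v}, {w, x}}) \<union> {{u, p}, {v, p}, {w, q}, {x, q}, {p, q}})"
  by (auto simp: ins_def)

text \<open>The attachment is a composition of five edge insertions, each of which preserves both
  properties. First join the subdivisions of edges 0 and 1, and those of edges 3 and 4. Then
  subdivide the two joining edges by \<open>n + 5\<close> and \<open>n + 9\<close> and join these.
  Next \<open>n + 6\<close> and \<open>n + 8\<close> subdivide one edge at each of them and are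
  joined; finally \<open>n + 7\<close> on that last joining edge is connected to the subdivision of
  edge 2. The two disjointness assumptions are the conditions for the first two insertions; in the
  later ones new vertices ensure disjointness.\<close>

lemma attach_cubic_cut4:
  assumes disj: "{a 0, b 0} \<inter> {a 1, b 1} = {}" "{a 3, b 3} \<inter> {a 4, b 4} = {}" and cut: "cut4 {..<n} E"
  shows "cubic {..<n + 10} (attach n a b E)" "cut4 {..<n + 10} (attach n a b E)"
proof -
  have lt: "a 0 < n" "b 0 < n" "a 1 < n" "b 1 < n" "a 2 < n" "b 2 < n" "a 3 < n" "b 3 < n" "a 4 < n" "b 4 < n"
    using attach_lt by simp_all
  have E: "{a 0, b 0} \<in> E" "{a 1, b 1} \<in> E" "{a 2, b 2} \<in> E" "{a 3, b 3} \<in> E" "{a 4, b 4} \<in> E"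
    using ab by simp_all
  have ne: "{a i, b i} \<noteq> {a j, b j}" if "i < 5" "j < 5" "i \<noteq> j" for i j
    using inj_onD[OF inj, of i j] that by auto
  have nE: "{x, n + k} \<notin> E" "{n + k, x} \<notin> E" for x k
    using attach_old_lt[of x "n + k"] attach_old_lt[of "n + k" x] by auto
  have old: "(a i = n + k) = False" "(b i = n + k) = False" "(n + k = a i) = False" "(n + k = b i) = False"
      "(a i = n) = False" "(b i = n) = False" "(n = a i) = False" "(n = b i) = False" if "i < 5" for i k
    using attach_lt[OF that] by auto
  have five: "(0::nat) < 5" "(1::nat) < 5" "(2::nat) < 5" "(3::nat) < 5" "(4::nat) < 5" by simp_all
  have num: "(n + j = n + k) = (j = k)" "(n = n + k) = (k = 0)" "(n + k = n) = (k = 0)" for j k by auto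
  have fresh: "E - (G \<union> X) = E - G" if "X \<inter> E = {}" for G X using that by blast
  have fresh': "E - ({p, q, r, s} \<union> {x, y}) = E - {p, q, r, s, y}" if "x \<notin> E" for p q r s x y
    using that by blast
  note eval = insert_Diff_if insert_iff empty_iff doubleton_eq_iff if_False if_True simp_thms empty_Diff
    old[OF five(1)] old[OF five(2)] old[OF five(3)] old[OF five(4)] old[OF five(5)] num rel_simps
    numeral_neq_zero zero_neq_numeral one_neq_zero one_eq_numeral_iff numeral_eq_one_iff
  have step: "cubic (insert p (insert q W)) (ins p q u v w x F) \<and> cut4 (insert p (insert q W)) (ins p q u v w x F)"
    if "cubic W F \<and> cut4 W F" "{u, v} \<in> F" "{w, x} \<in> F" "{u, v} \<inter> {w, x} = {}" "p \<notin> W" "q \<notin> W" "p \<noteq> q"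
    for W p q u v w x and F :: "nat set set"
    using ins_cubic[of W F u v w x p q] ins_cut4[of W F u v w x p q] that by simp
  let ?g = "\<lambda>i. {a i, b i}"
  define E1 where "E1 = ins (n + 1) n (a 1) (b 1) (a 0) (b 0) E"
  have E1: "E1 = (E - {{a 1, b 1}, {a 0, b 0}}) \<union> {{a 1, n + 1}, {b 1, n + 1}, {a 0, n}, {b 0, n}, {n + 1, n}}"
    unfolding E1_def ins_def by (rule refl)
  define E2 where "E2 = ins (n + 3) (n + 4) (a 3) (b 3) (a 4) (b 4) E1"
  have E2: "E2 = (E - {{a 1, b 1}, {a 0, b 0}, {a 3, b 3}, {a 4, b 4}}) \<union> {{a 1, n + 1}, {b 1, n + 1}, {a 0, n}, {b 0, n}, {n + 1, n}, {a 3, n + 3}, {b 3, n + 3}, {a 4, n + 4}, {b 4, n + 4}, {n + 3, n + 4}}"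
  proof -
    have 1: "{{a 1, n + 1}, {b 1, n + 1}, {a 0, n}, {b 0, n}, {n + 1, n}} - {{a 3, b 3}, {a 4, b 4}} = {{a 1, n + 1}, {b 1, n + 1}, {a 0, n}, {b 0, n}, {n + 1, n}}"
      by (simp only: eval)
    have 2: "E - ({{a 1, b 1}, {a 0, b 0}} \<union> {{a 3, b 3}, {a 4, b 4}}) = E - {{a 1, b 1}, {a 0, b 0}, {a 3, b 3}, {a 4, b 4}}"
      by (simp only: Un_insert_left Un_empty_left)
    show ?thesis unfolding E2_def E1 attach_layer 1 2 by (simp only: Un_insert_left Un_empty_left)
  qed
  define E3 where "E3 = ins (n + 5) (n + 9) (n + 1) n (n + 3) (n + 4) E2"
  have E3: "E3 = (E - {{a 1, b 1}, {a 0, b 0}, {a 3, b 3}, {a 4, b 4}}) \<union> {{a 1, n + 1}, {b 1, n + 1}, {a 0, n}, {b 0, n}, {a 3, n + 3}, {b 3, n + 3}, {a 4, n + 4}, {b 4, n + 4}, {n + 1, n + 5}, {n, n + 5}, {n + 3, n + 9}, {n + 4, n + 9}, {n + 5, n + 9}}"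
  proof -
    have 1: "{{a 1, n + 1}, {b 1, n + 1}, {a 0, n}, {b 0, n}, {n + 1, n}, {a 3, n + 3}, {b 3, n + 3}, {a 4, n + 4}, {b 4, n + 4}, {n + 3, n + 4}} - {{n + 1, n}, {n + 3, n + 4}} = {{a 1, n + 1}, {b 1, n + 1}, {a 0, n}, {b 0, n}, {a 3, n + 3}, {b 3, n + 3}, {a 4, n + 4}, {b 4, n + 4}}"
      by (simp only: eval)
    have 2: "E - ({{a 1, b 1}, {a 0, b 0}, {a 3, b 3}, {a 4, b 4}} \<union> {{n + 1, n}, {n + 3, n + 4}}) = E - {{a 1, b 1}, {a 0, b 0}, {a 3, b 3}, {a 4, b 4}}"
      by (rule fresh) (simp only: Int_insert_left nE if_False Int_empty_left)
    show ?thesis unfolding E3_def E2 attach_layer 1 2 by (simp only: Un_insert_left Un_empty_left)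
  qed
  define E4 where "E4 = ins (n + 6) (n + 8) (n + 1) (n + 5) (n + 3) (n + 9) E3"
  have E4: "E4 = (E - {{a 1, b 1}, {a 0, b 0}, {a 3, b 3}, {a 4, b 4}}) \<union> {{a 1, n + 1}, {b 1, n + 1}, {a 0, n}, {b 0, n}, {a 3, n + 3}, {b 3, n + 3}, {a 4, n + 4}, {b 4, n + 4}, {n, n + 5}, {n + 4, n + 9}, {n + 5, n + 9}, {n + 1, n + 6}, {n + 5, n + 6}, {n + 3, n + 8}, {n + 9, n + 8}, {n + 6, n + 8}}"
  proof -
    have 1: "{{a 1, n + 1}, {b 1, n + 1}, {a 0, n}, {b 0, n}, {a 3, n + 3}, {b 3, n + 3}, {a 4, n + 4}, {b 4, n + 4}, {n + 1, n + 5}, {n, n + 5}, {n + 3, n + 9}, {n + 4, n + 9}, {n + 5, n + 9}} - {{n + 1, n + 5}, {n + 3, n + 9}} = {{a 1, n + 1}, {b 1, n + 1}, {a 0, n}, {b 0, n}, {a 3, n + 3}, {b 3, n + 3}, {a 4, n + 4}, {b 4, n + 4}, {n, n + 5}, {n + 4, n + 9}, {n + 5, n + 9}}"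
      by (simp only: eval)
    have 2: "E - ({{a 1, b 1}, {a 0, b 0}, {a 3, b 3}, {a 4, b 4}} \<union> {{n + 1, n + 5}, {n + 3, n + 9}}) = E - {{a 1, b 1}, {a 0, b 0}, {a 3, b 3}, {a 4, b 4}}"
      by (rule fresh) (simp only: Int_insert_left nE if_False Int_empty_left)
    show ?thesis unfolding E4_def E3 attach_layer 1 2 by (simp only: Un_insert_left Un_empty_left)
  qed
  define E5 where "E5 = ins (n + 7) (n + 2) (n + 6) (n + 8) (a 2) (b 2) E4"
  have E5: "E5 = (E - {{a 1, b 1}, {a 0, b 0}, {a 3, b 3}, {a 4, b 4}, {a 2, b 2}}) \<union> {{a 1, n + 1}, {b 1, n + 1}, {a 0, n}, {b 0, n}, {a 3, n + 3}, {b 3, n + 3}, {a 4, n + 4}, {b 4, n + 4}, {n, n + 5}, {n + 4, n + 9}, {n + 5, n + 9}, {n + 1, n + 6}, {n + 5, n + 6}, {n + 3, n + 8}, {n + 9, n + 8}, {n + 6, n + 7}, {n + 8, n + 7}, {a 2, n + 2}, {b 2, n + 2}, {n + 7, n + 2}}"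
  proof -
    have 1: "{{a 1, n + 1}, {b 1, n + 1}, {a 0, n}, {b 0, n}, {a 3, n + 3}, {b 3, n + 3}, {a 4, n + 4}, {b 4, n + 4}, {n, n + 5}, {n + 4, n + 9}, {n + 5, n + 9}, {n + 1, n + 6}, {n + 5, n + 6}, {n + 3, n + 8}, {n + 9, n + 8}, {n + 6, n + 8}} - {{n + 6, n + 8}, {a 2, b 2}} = {{a 1, n + 1}, {b 1, n + 1}, {a 0, n}, {b 0, n}, {a 3, n + 3}, {b 3, n + 3}, {a 4, n + 4}, {b 4, n + 4}, {n, n + 5}, {n + 4, n + 9}, {n + 5, n + 9}, {n + 1, n + 6}, {n + 5, n + 6}, {n + 3, n + 8}, {n + 9, n + 8}}"
      by (simp only: eval)
    have 2: "E - ({{a 1, b 1}, {a 0, b 0}, {a 3, b 3}, {a 4, b 4}} \<union> {{n + 6, n + 8}, {a 2, b 2}}) = E - {{a 1, b 1}, {a 0, b 0}, {a 3, b 3}, {a 4, b 4}, {a 2, b 2}}"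
      by (rule fresh') (rule nE)
    show ?thesis unfolding E5_def E4 attach_layer 1 2 by (simp only: Un_insert_left Un_empty_left)
  qed
  have "attach n a b E = E5"
  proof -
    have g: "?g ` {..<5} = {{a 1, b 1}, {a 0, b 0}, {a 3, b 3}, {a 4, b 4}, {a 2, b 2}}" unfolding lessThan_5 by auto
    have flat: "{x0, y0, s0} \<union> ({x1, y1, s1} \<union> ({x2, y2, s2} \<union> ({x3, y3, s3} \<union> ({x4, y4, s4} \<union> {}))))
        = {x0, y0, s0, x1, y1, s1, x2, y2, s2, x3, y3, s3, x4, y4, s4}"
      for x0 y0 s0 x1 y1 s1 x2 y2 s2 x3 y3 s3 x4 y4 s4 :: "nat set"
      by (simp only: Un_insert_left Un_empty_left)
    have num: "n + 0 = n" "n + 5 + 0 = n + 5" "n + 5 + 1 = n + 6" "n + 5 + 2 = n + 7" "n + 5 + 3 = n + 8" "n + 5 + 4 = n + 9"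
      by simp_all
    have s: "spokes n a b 5 = {{a 0, n}, {b 0, n}, {n, n + 5}, {a 1, n + 1}, {b 1, n + 1}, {n + 1, n + 6}, {a 2, n + 2}, {b 2, n + 2}, {n + 2, n + 7}, {a 3, n + 3}, {b 3, n + 3}, {n + 3, n + 8}, {a 4, n + 4}, {b 4, n + 4}, {n + 4, n + 9}}"
      unfolding spokes_def lessThan_5 UN_insert UN_empty flat num by (rule refl)
    \<comment> \<open>Both descriptions list the same twenty new edges, fifteen in spokes and five
      in the rim, in different orders.\<close>
    have perm: "X \<union> {x2, x3, x8, x0, x1, x11, x17, x18, x19, x4, x5, x13, x6, x7, x9} \<union> {x12, x15, x16, x14, x10}
        = X \<union> {x0, x1, x2, x3, x4, x5, x6, x7, x8, x9, x10, x11, x12, x13, x14, x15, x16, x17, x18, x19}"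
      for X and x0 x1 x2 x3 x4 x5 x6 x7 x8 x9 x10 x11 x12 x13 x14 x15 x16 x17 x18 x19 :: "nat set"
      by (simp only: Un_assoc Un_insert_left Un_empty_left) (simp only: insert_commute)
    have c: "{n + 5, n + 9} = {n + 9, n + 5}" "{n + 9, n + 8} = {n + 8, n + 9}" "{n + 8, n + 7} = {n + 7, n + 8}" "{n + 7, n + 2} = {n + 2, n + 7}"
      by (simp_all add: insert_commute)
    have E5': "E5 = (E - {{a 1, b 1}, {a 0, b 0}, {a 3, b 3}, {a 4, b 4}, {a 2, b 2}}) \<union> {{a 1, n + 1}, {b 1, n + 1}, {a 0, n}, {b 0, n}, {a 3, n + 3}, {b 3, n + 3}, {a 4, n + 4}, {b 4, n + 4}, {n, n + 5}, {n + 4, n + 9}, {n + 9, n + 5}, {n + 1, n + 6}, {n + 5, n + 6}, {n + 3, n + 8}, {n + 8, n + 9}, {n + 6, n + 7}, {n + 7, n + 8}, {a 2, n + 2}, {b 2, n + 2}, {n + 2, n + 7}}"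
      unfolding E5 c by (rule refl)
    show ?thesis unfolding attach_def g s rim_eq E5' by (rule perm)
  qed
  have "cubic (insert (n + 1) (insert n {..<n})) E1 \<and> cut4 (insert (n + 1) (insert n {..<n})) E1" (is "cubic ?V1 _ \<and> _")
    unfolding E1_def by (rule step) (use cub cut E disj in auto)
  then have "cubic (insert (n + 3) (insert (n + 4) ?V1)) E2 \<and> cut4 (insert (n + 3) (insert (n + 4) ?V1)) E2"
      (is "cubic ?V2 _ \<and> _")
    unfolding E2_def by (rule step) (use E disj ne[of 3] ne[of 4] in \<open>auto simp: E1\<close>)
  then have "cubic (insert (n + 5) (insert (n + 9) ?V2)) E3 \<and> cut4 (insert (n + 5) (insert (n + 9) ?V2)) E3"
      (is "cubic ?V3 _ \<and> _")
    unfolding E3_def by (rule step) (auto simp: E2)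
  then have "cubic (insert (n + 6) (insert (n + 8) ?V3)) E4 \<and> cut4 (insert (n + 6) (insert (n + 8) ?V3)) E4"
      (is "cubic ?V4 _ \<and> _")
    unfolding E4_def by (rule step) (auto simp: E3)
  then have "cubic (insert (n + 7) (insert (n + 2) ?V4)) E5 \<and> cut4 (insert (n + 7) (insert (n + 2) ?V4)) E5"
      (is "cubic ?V5 _ \<and> _")
    unfolding E5_def by (rule step) (use E(3) ne[of 2] lt in \<open>auto simp: E4\<close>)
  moreover have "?V5 = {..<n + 10}"
  proof (rule set_eqI)
    fix x show "x \<in> ?V5 \<longleftrightarrow> x \<in> {..<n + 10}" unfolding insert_iff lessThan_iff by presburger
  qed
  ultimately show "cubic {..<n + 10} (attach n a b E)" "cut4 {..<n + 10} (attach n a b E)"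
    using \<open>attach n a b E = E5\<close> by simp_all
qed

end

text \<open>Each index subdivides one tree edge and grows a leaf at the subdividing vertex.
  Injectivity ensures that the edge to be subdivided has survived the earlier steps.\<close>

lemma attach_tree:
  assumes tr: "tree {..<n} T" and ab: "\<And>i. i < 5 \<Longrightarrow> {a i, b i} \<in> T"
    and inj: "inj_on (\<lambda>i. {a i, b i}) {..<5}" and k: "k \<le> 5"
  shows "tree ({..<n} \<union> {n..<n + k} \<union> {n + 5..<n + 5 + k}) ((T - (\<lambda>i. {a i, b i}) ` {..<k}) \<union> spokes n a b k)"
  using k
proof (induction k)
  case 0
  then show ?case using tr by (simp add: spokes_def)
next
  case (Suc k)
  let ?V = "{..<n} \<union> {n..<n + k} \<union> {n + 5..<n + 5 + k}"
  let ?T = "(T - (\<lambda>i. {a i, b i}) ` {..<k}) \<union> spokes n a b k"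
  have k5: "k < 5" using Suc by simp
  have lt: "a i < n \<and> b i < n" if "i < 5" for i
    using simple_graph_pairD[OF tree_simple[OF tr] ab[OF that]] by auto
  have T: "tree ?V ?T" using Suc by simp
  have new: "{a k, b k} \<notin> spokes n a b k"
    using lt[OF k5] by (auto simp: spokes_def doubleton_eq_iff)
  have "{a k, b k} \<notin> (\<lambda>i. {a i, b i}) ` {..<k}"
  proof
    assume "{a k, b k} \<in> (\<lambda>i. {a i, b i}) ` {..<k}"
    then obtain i where "i < k" "{a k, b k} = {a i, b i}" by blast
    then show False using inj_onD[OF inj, of k i] k5 by simp
  qed
  then have "{a k, b k} \<in> ?T" using ab[OF k5] by blast
  then have "tree (insert (n + k) ?V) (insert {a k, n + k} (insert {b k, n + k} (?T - {{a k, b k}})))"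
    by (rule tree_subdivide[OF T]) (use k5 in auto)
  then have "tree (insert (n + 5 + k) (insert (n + k) ?V))
      (insert {n + k, n + 5 + k} (insert {a k, n + k} (insert {b k, n + k} (?T - {{a k, b k}}))))"
    by (rule tree.leaf) (use k5 in auto)
  moreover have "insert (n + 5 + k) (insert (n + k) ?V) = {..<n} \<union> {n..<n + Suc k} \<union> {n + 5..<n + 5 + Suc k}"
    by auto
  moreover have "insert {n + k, n + 5 + k} (insert {a k, n + k} (insert {b k, n + k} (?T - {{a k, b k}})))
      = (T - (\<lambda>i. {a i, b i}) ` {..<Suc k}) \<union> spokes n a b (Suc k)"
  proof -
    have "spokes n a b (Suc k) = insert {n + k, n + 5 + k} (insert {a k, n + k} (insert {b k, n + k} (spokes n a b k)))"
      unfolding spokes_def lessThan_Suc by blast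
    moreover have "spokes n a b k - {{a k, b k}} = spokes n a b k" using new by blast
    moreover have "insert x (insert y (insert z (T - G \<union> S - {w}))) = T - insert w G \<union> insert x (insert y (insert z S))"
      if "S - {w} = S" for x y z w G and S :: "nat set set" using that by blast
    ultimately show ?thesis by (simp only: lessThan_Suc image_insert)
  qed
  ultimately show ?case by simp
qed

text \<open>Pairwise intersecting edges form a star or a triangle. A star has at most three edges in
  a cubic graph, and triangles are excluded, so four edges contain a disjoint pair.\<close>

lemma disjoint_pair:
  assumes cub: "cubic V E" and nsc: "no_short_cycle E" and S: "S \<subseteq> E" "4 \<le> card S"
  shows "\<exists>e \<in> S. \<exists>f \<in> S. e \<inter> f = {}"
proof (rule ccontr)
  assume "\<not> ?thesis"
  then have meet: "e \<inter> f \<noteq> {}" if "e \<in> S" "f \<in> S" for e f using that by blast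
  have sg: "simple_graph V E" using cub by (simp add: cubic_def)
  have pair: "\<exists>u v. e = {u, v} \<and> u \<noteq> v \<and> u \<in> V" if "e \<in> S" for e
    using simple_graph_edgeE[OF sg, of e] that S(1) by blast
  have not_star: "\<exists>f \<in> S. x \<notin> f" if "x \<in> V" for x
  proof (rule ccontr)
    assume "\<not> (\<exists>f \<in> S. x \<notin> f)"
    then have "S \<subseteq> {e \<in> E. x \<in> e}" using S(1) by blast
    then have "card S \<le> 3"
      using card_mono[of "{e \<in> E. x \<in> e}" S] simple_graph_finite[OF sg] cub that by (simp add: cubic_def degree_def)
    then show False using S(2) by simp
  qed
  obtain e where e: "e \<in> S" using S(2) by fastforce
  then obtain a b where ab: "e = {a, b}" "a \<noteq> b" "a \<in> V" "b \<in> V" using simple_graph_edgeE[OF sg, of e] S(1) by blast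
  obtain f where f: "f \<in> S" "a \<notin> f" using not_star ab by blast
  obtain g where g: "g \<in> S" "b \<notin> g" using not_star ab by blast
  have "b \<in> f" "a \<in> g" using meet[OF e f(1)] meet[OF e g(1)] f g ab by auto
  obtain c where c: "f = {b, c}" using pair[OF f(1)] \<open>b \<in> f\<close> by (metis insertE insert_commute singletonD)
  obtain d where d: "g = {a, d}" using pair[OF g(1)] \<open>a \<in> g\<close> by (metis insertE insert_commute singletonD)
  have "c = d" using meet[OF f(1) g(1)] c d f g by auto
  then have "{b, c} \<in> E" "{c, a} \<in> E" "{b, a} \<in> E" using c d f g e ab S(1) by (auto simp: insert_commute)
  then show False using no_short_cycle_triangle[OF nsc] ab(2) by metis
qed

lemma spokes_witness: "e \<in> spokes n a b k \<Longrightarrow> \<exists>i<k. n + i \<in> e"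
  by (auto simp: spokes_def)

lemma rim_ge: "e \<in> rim n \<Longrightarrow> x \<in> e \<Longrightarrow> n + 5 \<le> x"
  by (auto simp: rim_eq)

text \<open>Six spare tree edges suffice: they contain a disjoint pair, the remaining four contain
  another one, and of the last two one serves as the fifth edge. The edges {a i, n + i} and the
  spokes to the rim are ten new tree edges, so afterwards the stock is large enough for
  lengthening.\<close>

lemma attach_cycle:
  fixes E :: "nat set set"
  assumes hs: "hist_snark {..<n} E T cs U" and pool: "6 \<le> card (T - U)"
  obtains E' T' where "hist_snark {..<n + 10} E' T' ([n + 5, n + 6, n + 7, n + 8, n + 9] # cs) U"
    "9 \<le> card (T' - U)" "free U [n + 5, n + 6, n + 7, n + 8, n + 9]"
proof -
  have dec: "hist_decomp {..<n} E T cs" and cut: "cut4 {..<n} E" and nsc: "no_short_cycle E"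
    and UE: "U \<subseteq> E" and nocol: "\<not> (\<exists>c. edge_colouring3 U c)"
    using hs by (simp_all add: hist_snark_def)
  note fs = decomp_facts[OF dec]
  have fT: "finite T" using simple_graph_finite[OF fs(7)] fs(3) finite_subset by blast
  define P where "P = T - U"
  have P: "P \<subseteq> E" "P \<subseteq> T" "finite P" "6 \<le> card P" using fs(3) fT pool by (auto simp: P_def)
  have P': "P - X \<subseteq> E" for X using P(1) by blast
  have card_less: "card P - k \<le> card (P - X)" if "finite X" "card X \<le> k" for X k
    using diff_card_le_card_Diff[OF that(1), of P] that(2) by linarith
  obtain e0 e1 where e01: "e0 \<in> P" "e1 \<in> P" "e0 \<inter> e1 = {}"
    using disjoint_pair[OF fs(1) nsc P(1)] P(4) by auto
  have "card {e0, e1} \<le> 2" using card_insert_le_m1[of 2 "{e1}" e0] by simp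
  then have card4: "4 \<le> card (P - {e0, e1})" using card_less[of "{e0, e1}" 2] P(4) by simp
  obtain e3 e4 where e34: "e3 \<in> P - {e0, e1}" "e4 \<in> P - {e0, e1}" "e3 \<inter> e4 = {}"
    using disjoint_pair[OF fs(1) nsc P' card4] by blast
  have "card {e0, e1, e3, e4} \<le> 4" by (simp add: card_insert_if)
  then have "2 \<le> card (P - {e0, e1, e3, e4})" using card_less[of "{e0, e1, e3, e4}" 4] P(4) by simp
  then have "P - {e0, e1, e3, e4} \<noteq> {}" by (metis card.empty not_numeral_le_zero)
  then obtain e2 where e2: "e2 \<in> P - {e0, e1, e3, e4}" by blast
  have ne: "e \<noteq> {}" if "e \<in> P" for e using simple_graph_edgeE[OF fs(7), of e] that P(1) by blast
  \<comment> \<open>The order matters: the disjoint pairs must occupy the indices 0, 1 and 3,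
    4.\<close>
  define es where "es = [e0, e1, e2, e3, e4]"
  have "e0 \<noteq> e1" "e3 \<noteq> e4" using e01 e34 ne by auto
  then have dist: "distinct es" using e01 e34 e2 unfolding es_def by auto
  have len: "length es = 5" by (simp add: es_def)
  have "\<forall>e \<in> E. \<exists>u v. e = {u, v}" using simple_graph_edgeE[OF fs(7)] by metis
  then obtain u v where uv: "\<And>e. e \<in> E \<Longrightarrow> e = {u e, v e}" by metis
  define a b where "a = (\<lambda>i. u (es ! i))" and "b = (\<lambda>i. v (es ! i))"
  have esP: "es ! i \<in> P" if "i < 5" for i
  proof -
    have "set es \<subseteq> P" using e01 e34 e2 by (simp add: es_def)
    then show ?thesis using that len nth_mem by (metis subsetD)
  qed
  have g: "{a i, b i} = es ! i" if "i < 5" for i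
    using uv[of "es ! i"] esP[OF that] P(1) by (auto simp: a_def b_def)
  have inj: "inj_on (\<lambda>i. {a i, b i}) {..<5}"
    using dist len g by (auto simp: inj_on_def nth_eq_iff_index_eq)
  have gE: "{a i, b i} \<in> E" and gT: "{a i, b i} \<in> T" if "i < 5" for i
    using g[OF that] esP[OF that] P by auto
  have disj: "{a 0, b 0} \<inter> {a 1, b 1} = {}" "{a 3, b 3} \<inter> {a 4, b 4} = {}"
    using g[of 0] g[of 1] g[of 3] g[of 4] e01(3) e34(3) by (simp_all add: es_def)
  let ?G = "(\<lambda>i. {a i, b i}) ` {..<5}" and ?S = "spokes n a b 5" and ?R = "rim n"
  define E' where "E' = attach n a b E"
  define T' where "T' = (T - ?G) \<union> ?S"
  have E'_eq: "E' = (E - ?G) \<union> ?S \<union> ?R" by (simp add: E'_def attach_def)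
  have cub: "cubic {..<n + 10} E'" "cut4 {..<n + 10} E'"
    using attach_cubic_cut4[OF fs(1) gE inj disj cut] by (simp_all add: E'_def)
  then have sg': "simple_graph {..<n + 10} E'" by (simp add: cubic_def)
  then have nsc': "no_short_cycle E'"
    using attach_no_short_cycle[OF fs(1) gE inj nsc] by (simp add: E'_def)
  have lt: "x < n" if "e \<in> E" "x \<in> e" for e x using simple_graph_subset[OF fs(7) that(1)] that(2) by blast
  have SE: "?S \<inter> E = {}" using spokes_witness lt by fastforce
  have RE: "?R \<inter> E = {}"
  proof -
    have False if "e \<in> ?R" "e \<in> E" for e
    proof -
      obtain x where "x \<in> e" using \<open>e \<in> ?R\<close> by (auto simp: rim_eq)
      then show False using rim_ge[OF that(1)] lt[OF that(2)] by fastforce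
    qed
    then show ?thesis by blast
  qed
  have RS: "?R \<inter> ?S = {}" using spokes_witness rim_ge by fastforce
  have GT: "?G \<subseteq> T" using gT by auto
  have gU: "{a i, b i} \<notin> U" if "i < 5" for i using g[OF that] esP[OF that] by (simp add: P_def)
  have tr: "tree {..<n + 10} T'"
  proof -
    have "{..<n} \<union> {n..<n + 5} \<union> {n + 5..<n + 5 + 5} = {..<n + 10}" by auto
    then show ?thesis using attach_tree[OF fs(2) gT inj, of 5] by (simp add: T'_def)
  qed
  have TE: "T' \<subseteq> E'" unfolding T'_def E'_eq using fs(3) by blast
  have diff: "E' - T' = (E - T) \<union> ?R"
    unfolding T'_def E'_eq using SE RE RS GT fs(3) by blast
  let ?c = "[n + 5, n + 6, n + 7, n + 8, n + 9]"
  have dist': "distinct (concat (?c # cs))"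
  proof -
    have "x < n" if "x \<in> set (concat cs)" for x using decomp_cycle(4)[OF dec] that by auto
    then have "set ?c \<inter> set (concat cs) = {}" by fastforce
    then show ?thesis using fs(5) by simp
  qed
  have "E' - T' = \<Union> (cedges ` set (?c # cs))" using diff fs(4) by (auto simp: rim_def)
  moreover have "3 \<le> length xs" if "xs \<in> set (?c # cs)" for xs using that fs(6)[of xs] by auto
  ultimately have dec': "hist_decomp {..<n + 10} E' T' (?c # cs)"
    unfolding hist_decomp_def using cub(1) tr TE dist' by blast
  have "U \<subseteq> E'" unfolding E'_eq using UE gU by blast
  then have hs': "hist_snark {..<n + 10} E' T' (?c # cs) U"
    unfolding hist_snark_def using dec' cub(2) nsc' nocol by blast
  have "card ((\<lambda>i. {a i, n + i}) ` {..<5} \<union> (\<lambda>i. {n + i, n + 5 + i}) ` {..<5}) = 10"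
  proof -
    have alt: "a i < n" if "i < 5" for i using lt gE that by blast
    have "inj_on (\<lambda>i. {a i, n + i}) {..<5}"
    proof (rule inj_onI)
      fix i j assume "i \<in> {..<5}" "j \<in> {..<5}" "{a i, n + i} = {a j, n + j}"
      then show "i = j" using alt[of i] alt[of j] by (auto simp: doubleton_eq_iff)
    qed
    moreover have "inj_on (\<lambda>i. {n + i, n + 5 + i}) {..<5}"
      by (auto simp: inj_on_def doubleton_eq_iff)
    moreover have "(\<lambda>i. {a i, n + i}) ` {..<5} \<inter> (\<lambda>i. {n + i, n + 5 + i}) ` {..<5} = {}"
    proof -
      have False if "i < 5" "{a i, n + i} = {n + j, n + 5 + j}" for i j
        using that alt[of i] by (auto simp: doubleton_eq_iff)
      then show ?thesis by blast
    qed
    ultimately show ?thesis by (simp add: card_Un_disjoint card_image)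
  qed
  moreover have "(\<lambda>i. {a i, n + i}) ` {..<5} \<union> (\<lambda>i. {n + i, n + 5 + i}) ` {..<5} \<subseteq> T' - U"
  proof -
    have "(\<lambda>i. {a i, n + i}) ` {..<5} \<union> (\<lambda>i. {n + i, n + 5 + i}) ` {..<5} \<subseteq> ?S"
      unfolding spokes_def by blast
    then show ?thesis unfolding T'_def using SE UE by blast
  qed
  moreover have "finite (T' - U)" using simple_graph_finite[OF tree_simple[OF tr]] by simp
  ultimately have "10 \<le> card (T' - U)"
    using card_mono[of "T' - U" "(\<lambda>i. {a i, n + i}) ` {..<5} \<union> (\<lambda>i. {n + i, n + 5 + i}) ` {..<5}"]
    by presburger
  moreover have "free U ?c"
  proof -
    have "{n + 9, n + 5} \<in> ?R" by (simp add: rim_eq)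
    then show ?thesis using RE UE by (auto simp: free_def)
  qed
  ultimately show ?thesis using that[OF hs'] by simp
qed

lemma attains_attach:
  assumes "attains 6 A M"
  shows "attains 9 (add_mset 5 A) (add_mset 5 M)"
proof -
  obtain n E T cs U where *: "hist_snark {..<n :: nat} E T cs U" "6 \<le> card (T - U)"
      "A \<subseteq># mset (map length (filter (free U) cs))" "mset (map length cs) = M"
    using assms unfolding attains_def by blast
  let ?c = "[n + 5, n + 6, n + 7, n + 8, n + 9]"
  obtain E' T' where "hist_snark {..<n + 10} E' T' (?c # cs) U" "9 \<le> card (T' - U)" "free U ?c"
    using attach_cycle[OF *(1,2)] by blast
  moreover have "add_mset 5 A \<subseteq># mset (map length (filter (free U) (?c # cs)))"
    using *(3) calculation(3) by (simp add: eval_nat_numeral)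
  moreover have "mset (map length (?c # cs)) = add_mset 5 M" using *(4) by (simp add: eval_nat_numeral)
  ultimately show ?thesis unfolding attains_def by blast
qed

text \<open>Attach a 5-cycle and lengthen it to c. Only the freshly attached cycle is lengthened, so
  it alone is retained among the free cycles.\<close>

lemma attains_add:
  assumes "attains 6 A M" "5 \<le> c"
  shows "attains 9 {#} (add_mset c M)"
proof -
  have "attains 9 {#5#} (add_mset 5 M)"
    by (rule attains_weaken[OF attains_attach[OF assms(1)]]) auto
  then have "attains 9 {#c#} (add_mset c M)" by (rule attains_lengthen_le[OF _ assms(2)])
  then show ?thesis by (rule attains_weaken) auto
qed

lemma attains_add_all:
  assumes "attains 6 A M" "\<forall>c \<in># N. 5 \<le> c"
  shows "attains 6 {#} (N + M)"
  using assms(2)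
proof (induction N)
  case empty
  show ?case using attains_weaken[OF assms(1)] by simp
next
  case (add c N)
  then have "attains 6 {#} (N + M)" "5 \<le> c" by auto
  then have "attains 9 {#} (add_mset c (N + M))" by (rule attains_add)
  then show ?case using attains_weaken[of 9 _ _ 6] by simp
qed

section \<open>Certificates for explicit graphs\<close>

definition edge_of :: "nat \<times> nat \<Rightarrow> nat set" where
  "edge_of p = {fst p, snd p}"

lemma edge_of_inj: "inj_on edge_of {(a, b). a < b}"
  by (auto simp: inj_on_def edge_of_def doubleton_eq_iff)

text \<open>Pairs are stored with the smaller vertex first, which makes \<open>edge_of\<close>
  injective: different list entries are different edges, and deleting an entry deletes exactly one
  edge.\<close>

definition grown :: "nat \<Rightarrow> (nat \<times> nat) list \<Rightarrow> bool" where
  "grown n es \<longleftrightarrow> set es \<subseteq> {(a, b). a < b \<and> b < n} \<and> cubic {..<n} (edge_of ` set es) \<and>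
     cut4 {..<n} (edge_of ` set es)"

text \<open>An inadmissible insertion yields the empty list, so a nonempty result certifies that
  every step was legal. In this way \<open>cut4\<close>, a statement about all vertex sets, is
  obtained from a short sequence of insertions starting at K4.\<close>

fun grow :: "nat \<Rightarrow> (nat \<times> nat) list \<Rightarrow> ((nat \<times> nat) \<times> (nat \<times> nat)) list \<Rightarrow> (nat \<times> nat) list" where
  "grow n es [] = es"
| "grow n es (((a, b), (c, d)) # ps) =
    (if (a, b) \<in> set es \<and> (c, d) \<in> set es \<and> a \<noteq> c \<and> a \<noteq> d \<and> b \<noteq> c \<and> b \<noteq> d
     then grow (n + 2) ((a, n) # (b, n) # (c, n + 1) # (d, n + 1) # (n, n + 1) #
       filter (\<lambda>e. e \<noteq> (a, b) \<and> e \<noteq> (c, d)) es) ps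
     else [])"

lemma grown_step:
  assumes g: "grown n es" and ab: "(a, b) \<in> set es" and cd: "(c, d) \<in> set es"
    and disj: "a \<noteq> c" "a \<noteq> d" "b \<noteq> c" "b \<noteq> d"
  shows "grown (n + 2) ((a, n) # (b, n) # (c, n + 1) # (d, n + 1) # (n, n + 1) #
    filter (\<lambda>e. e \<noteq> (a, b) \<and> e \<noteq> (c, d)) es)" (is "grown _ ?es")
proof -
  let ?E = "edge_of ` set es"
  have lt: "set es \<subseteq> {(a, b). a < b \<and> b < n}" "cubic {..<n} ?E" "cut4 {..<n} ?E"
    using g by (auto simp: grown_def)
  have sub: "set es \<subseteq> {(a, b). a < b}" using lt(1) by auto
  have "set (filter (\<lambda>e. e \<noteq> (a, b) \<and> e \<noteq> (c, d)) es) = set es - {(a, b), (c, d)}" by auto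
  moreover have "edge_of ` (set es - {(a, b), (c, d)}) = ?E - edge_of ` {(a, b), (c, d)}"
    by (rule inj_on_image_set_diff[OF edge_of_inj]) (use sub ab cd in auto)
  moreover have "edge_of ` {(a, b), (c, d)} = {{a, b}, {c, d}}" by (simp add: edge_of_def)
  ultimately have F: "edge_of ` set (filter (\<lambda>e. e \<noteq> (a, b) \<and> e \<noteq> (c, d)) es) = ?E - {{a, b}, {c, d}}"
    by simp
  have "edge_of ` set ?es = ins n (n + 1) a b c d ?E"
    unfolding list.set(2) image_insert F ins_def
    by (simp only: edge_of_def fst_conv snd_conv Un_insert_right Un_empty_right)
  moreover have "{a, b} \<in> ?E" "{c, d} \<in> ?E" using ab cd by (force simp: edge_of_def)+
  moreover have "insert n (insert (n + 1) {..<n}) = {..<n + 2}" by auto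
  moreover have "n \<notin> {..<n}" "n + 1 \<notin> {..<n}" "n \<noteq> n + 1" "{a, b} \<inter> {c, d} = {}" using disj by auto
  ultimately have "cubic {..<n + 2} (edge_of ` set ?es)" "cut4 {..<n + 2} (edge_of ` set ?es)"
    using ins_cubic[of "{..<n}" ?E a b c d n "n + 1"] ins_cut4[of "{..<n}" ?E a b c d n "n + 1"] lt(2,3)
    by metis+
  moreover have "set ?es \<subseteq> {(a, b). a < b \<and> b < n + 2}" using lt(1) ab cd by auto
  ultimately show ?thesis by (simp add: grown_def)
qed

lemma grow_grown: "grown n es \<Longrightarrow> grow n es ps \<noteq> [] \<Longrightarrow> grown (n + 2 * length ps) (grow n es ps)"
proof (induction n es ps rule: grow.induct)
  case (2 n es a b c d ps)
  then show ?case using grown_step[of n es a b c d] by (simp split: if_splits)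
qed simp

definition K4 :: "(nat \<times> nat) list" where
  "K4 = [(0, 1), (0, 2), (0, 3), (1, 2), (1, 3), (2, 3)]"

text \<open>On four vertices the cut condition concerns only partitions into two pairs, and all four
  edges between the pairs are present.\<close>

lemma grown_K4: "grown 4 K4"
proof -
  let ?E = "edge_of ` set K4"
  have E: "?E = {{0, 1}, {0, 2}, {0, 3}, {1, 2}, {1, 3}, {2, 3}}"
    by (simp add: K4_def edge_of_def)
  have V: "x < 4 \<longleftrightarrow> x = 0 \<or> x = 1 \<or> x = 2 \<or> x = 3" for x :: nat by auto
  have all: "{x, y} \<in> ?E" if "x < 4" "y < 4" "x \<noteq> y" for x y
    using that unfolding E V by (elim disjE) (simp_all add: insert_commute)
  have sg: "simple_graph {..<4} ?E" unfolding simple_graph_def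
  proof (intro conjI ballI)
    have "set K4 \<subseteq> {(a, b). a < b \<and> b < 4}" by (simp add: K4_def)
    moreover fix e assume "e \<in> ?E"
    ultimately obtain a b where "e = {a, b}" "a < b" "b < 4" by (auto simp: edge_of_def)
    then show "\<exists>u v. e = {u, v} \<and> u \<noteq> v \<and> u \<in> {..<4} \<and> v \<in> {..<4}"
      by (intro exI[of _ a] exI[of _ b]) auto
  qed simp
  have deg: "degree ?E v = 3" if "v < 4" for v
  proof -
    have "{e \<in> ?E. v \<in> e} = (\<lambda>y. {v, y}) ` ({..<4} - {v})"
    proof
      show "{e \<in> ?E. v \<in> e} \<subseteq> (\<lambda>y. {v, y}) ` ({..<4} - {v})"
      proof
        fix e assume "e \<in> {e \<in> ?E. v \<in> e}"
        then obtain x y where "e = {x, y}" "x \<noteq> y" "x < 4" "y < 4" "v \<in> e"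
          using simple_graph_edgeE[OF sg, of e] by (metis (mono_tags, lifting) lessThan_iff mem_Collect_eq)
        then have "\<exists>z. e = {v, z} \<and> z < 4 \<and> z \<noteq> v" by (metis insertE insert_commute singletonD)
        then show "e \<in> (\<lambda>y. {v, y}) ` ({..<4} - {v})" by blast
      qed
      show "(\<lambda>y. {v, y}) ` ({..<4} - {v}) \<subseteq> {e \<in> ?E. v \<in> e}" using all that by auto
    qed
    moreover have "inj_on (\<lambda>y. {v, y}) ({..<4} - {v})" by (auto simp: inj_on_def doubleton_eq_iff)
    ultimately show ?thesis using that by (simp add: degree_def card_image)
  qed
  have "cut4 {..<4} ?E" unfolding cut4_def
  proof (intro allI impI, elim conjE)
    fix X :: "nat set" assume X: "X \<subseteq> {..<4}" "2 \<le> card X" "2 \<le> card ({..<4} - X)"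
    have two: "\<exists>x \<in> A. \<exists>y \<in> A. x \<noteq> y" if "2 \<le> card A" for A :: "nat set"
    proof -
      obtain x where x: "x \<in> A" using \<open>2 \<le> card A\<close> by (metis card.empty equals0I not_numeral_le_zero)
      have "card (A - {x}) \<noteq> 0" using that x by (simp add: card_Diff_singleton)
      then obtain y where "y \<in> A - {x}" by (metis card.empty equals0I)
      then show ?thesis using x by blast
    qed
    obtain x y z w where xy: "x \<in> X" "y \<in> X" "x \<noteq> y" and zw: "z \<in> {..<4} - X" "w \<in> {..<4} - X" "z \<noteq> w"
      using two[OF X(2)] two[OF X(3)] by blast
    have "{{x, z}, {x, w}, {y, z}, {y, w}} \<subseteq> cut_edges ?E X"
      using xy zw X(1) all by (auto simp: cut_edges_pair)
    moreover have "card {{x, z}, {x, w}, {y, z}, {y, w}} = 4"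
    proof -
      have "x \<noteq> z" "x \<noteq> w" "y \<noteq> z" "y \<noteq> w" using xy zw by auto
      then show ?thesis using xy(3) zw(3) by (simp add: doubleton_eq_iff)
    qed
    moreover have "finite (cut_edges ?E X)" by (simp add: cut_edges_def)
    ultimately show "4 \<le> card (cut_edges ?E X)" by (metis card_mono)
  qed
  then show ?thesis using sg deg by (auto simp: grown_def cubic_def K4_def)
qed

section \<open>Executable checks for cycles, trees and girth\<close>

definition ordered :: "nat \<times> nat \<Rightarrow> nat \<times> nat" where
  "ordered p = (if fst p < snd p then p else (snd p, fst p))"

lemma edge_of_ordered [simp]: "edge_of (ordered p) = edge_of p"
  by (simp add: edge_of_def ordered_def insert_commute)

definition cycle_pairs :: "nat list \<Rightarrow> (nat \<times> nat) list" where
  "cycle_pairs xs = map ordered ((last xs, hd xs) # zip xs (tl xs))"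

lemma edges_cycle_pairs: "edge_of ` set (cycle_pairs xs) = cedges xs"
proof -
  have "edge_of ` set (zip xs (tl xs)) = pedges xs"
    by (induction xs rule: pedges.induct) (auto simp: edge_of_def)
  then show ?thesis by (simp add: cycle_pairs_def cedges_def image_image) (simp add: edge_of_def)
qed

fun tree_order :: "nat list \<Rightarrow> (nat \<times> nat) list \<Rightarrow> bool" where
  "tree_order vs [] = True"
| "tree_order vs ((u, w) # es) = (u \<in> set vs \<and> w \<notin> set vs \<and> tree_order (w # vs) es)"

text \<open>The cardinality is included in order to see that the tree is spanning: n distinct
  vertices below n are all of them.\<close>

lemma tree_order_tree:
  assumes "tree (set vs) T" "tree_order vs es" "distinct vs"
  shows "tree (set vs \<union> snd ` set es) (T \<union> edge_of ` set es) \<and>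
    card (set vs \<union> snd ` set es) = length vs + length es"
  using assms
proof (induction vs es arbitrary: T rule: tree_order.induct)
  case (1 vs)
  then show ?case by (simp add: distinct_card)
next
  case (2 vs u w es)
  then have "tree (insert w (set vs)) (insert {u, w} T)" by (intro tree.leaf) auto
  then have "tree (set (w # vs) \<union> snd ` set es) (insert {u, w} T \<union> edge_of ` set es)
      \<and> card (set (w # vs) \<union> snd ` set es) = length (w # vs) + length es"
    using 2(1)[of "insert {u, w} T"] 2(3,4) by simp
  then show ?case by (simp add: edge_of_def)
qed

definition nbrs :: "(nat \<times> nat) list \<Rightarrow> nat \<Rightarrow> nat list" where
  "nbrs es v = concat (map (\<lambda>p. if fst p = v then [snd p] else if snd p = v then [fst p] else []) es)"

lemma nbrs_iff: "y \<in> set (nbrs es x) \<longleftrightarrow> {x, y} \<in> edge_of ` set es"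
proof -
  have one: "y \<in> set (if fst p = x then [snd p] else if snd p = x then [fst p] else []) \<longleftrightarrow> {x, y} = edge_of p" for p
    by (cases "fst p = x"; cases "snd p = x") (auto simp: edge_of_def doubleton_eq_iff)
  have "y \<in> set (nbrs es x) \<longleftrightarrow>
      (\<exists>p \<in> set es. y \<in> set (if fst p = x then [snd p] else if snd p = x then [fst p] else []))"
    unfolding nbrs_def set_concat set_map by blast
  then show ?thesis unfolding one image_iff .
qed

text \<open>The walks of length at most two from v that do not return to v, listed by their end
  vertices. A repetition in this list is a cycle of length at most four through v.\<close>

definition nearby :: "nat list list \<Rightarrow> nat \<Rightarrow> nat list" where
  "nearby N v = v # N ! v @ concat (map (\<lambda>u. filter (\<lambda>w. w \<noteq> v) (N ! u)) (N ! v))"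

definition girth_ok :: "nat \<Rightarrow> nat list list \<Rightarrow> bool" where
  "girth_ok n N = list_all (\<lambda>v. distinct (nearby N v)) [0..<n]"

lemma distinct_concat_map_disjoint:
  "distinct (concat (map f xs)) \<Longrightarrow> x \<in> set xs \<Longrightarrow> z \<in> set xs \<Longrightarrow> x \<noteq> z \<Longrightarrow> set (f x) \<inter> set (f z) = {}"
  by (induction xs) auto

lemma girth_ok_no_short_cycle:
  assumes ok: "girth_ok n (map (nbrs es) [0..<n])" and lt: "set es \<subseteq> {(a, b). a < b \<and> b < n}"
  shows "no_short_cycle (edge_of ` set es)"
  unfolding no_short_cycle_def
proof (intro allI impI)
  let ?E = "edge_of ` set es" and ?N = "map (nbrs es) [0..<n]"
  fix x y z assume *: "{x, y} \<in> ?E \<and> {y, z} \<in> ?E \<and> x \<noteq> z"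
  have ltE: "u < n \<and> v < n \<and> u \<noteq> v" if uv: "{u, v} \<in> ?E" for u v
  proof -
    obtain r where "{u, v} = edge_of r" "r \<in> set es" using uv by blast
    then obtain p q where "{u, v} = {p, q}" "(p, q) \<in> set es" by (cases r) (auto simp: edge_of_def)
    moreover from this have "p < q" "q < n" using lt by auto
    ultimately show ?thesis by (auto simp: doubleton_eq_iff)
  qed
  have N: "u \<in> set (?N ! v) \<longleftrightarrow> {v, u} \<in> ?E" if "v < n" for u v using that by (simp add: nbrs_iff)
  have lts: "x < n" "y < n" "z < n" "x \<noteq> y" "z \<noteq> y" using * ltE by blast+
  have "distinct (nearby ?N y)" using ok lts by (simp add: girth_ok_def list_all_iff)
  then have d1: "set (?N ! y) \<inter> set (filter (\<lambda>w. w \<noteq> y) (?N ! x)) = {}"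
    and d2: "distinct (concat (map (\<lambda>u. filter (\<lambda>w. w \<noteq> y) (?N ! u)) (?N ! y)))"
    if "x \<in> set (?N ! y)"
    using that unfolding nearby_def by auto
  have yx: "x \<in> set (?N ! y)" "z \<in> set (?N ! y)"
    using * N[OF lts(2)] by (auto simp: insert_commute)
  have "{x, z} \<notin> ?E"
    using d1[OF yx(1)] yx(2) N[OF lts(1), of z] lts(5) by auto
  moreover have "w = y" if "{x, w} \<in> ?E \<and> {w, z} \<in> ?E" for w
  proof (rule ccontr)
    assume "w \<noteq> y"
    have "{z, w} \<in> ?E" using that by (simp add: insert_commute)
    then have "w \<in> set (filter (\<lambda>w. w \<noteq> y) (?N ! x))" "w \<in> set (filter (\<lambda>w. w \<noteq> y) (?N ! z))"
      using that N[OF lts(1)] N[OF lts(3)] \<open>w \<noteq> y\<close> by simp_all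
    then show False using distinct_concat_map_disjoint[OF d2[OF yx(1)] yx] * by blast
  qed
  ultimately show "{x, z} \<notin> ?E \<and> (\<forall>w. {x, w} \<in> ?E \<and> {w, z} \<in> ?E \<longrightarrow> w = y)" by blast
qed

section \<open>Refuting 3-edge-colourings by backtracking\<close>

definition touch :: "nat \<times> nat \<Rightarrow> nat \<times> nat \<Rightarrow> bool" where
  "touch e f \<longleftrightarrow> fst e = fst f \<or> fst e = snd f \<or> snd e = fst f \<or> snd e = snd f"

text \<open>For each edge, the positions of the earlier edges it touches, counted backwards.\<close>

fun back_refs :: "(nat \<times> nat) list \<Rightarrow> (nat \<times> nat) list \<Rightarrow> nat list list" where
  "back_refs [] ds = []"
| "back_refs (e # es) ds = filter (\<lambda>k. touch e (ds ! k)) [0..<length ds] # back_refs es (e # ds)"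

text \<open>The colours of the edges treated so far are stacked with the latest first, which fits
  references counted backwards. Reaching the empty list means that a complete colouring was found,
  hence the value \<open>False\<close>.\<close>

fun no_col :: "nat list list \<Rightarrow> nat list \<Rightarrow> bool" where
  "no_col [] cols = False"
| "no_col (ps # r) cols =
    ((if list_ex (\<lambda>k. cols ! k = 0) ps then True else no_col r (0 # cols)) \<and>
     (if list_ex (\<lambda>k. cols ! k = 1) ps then True else no_col r (1 # cols)) \<and>
     (if list_ex (\<lambda>k. cols ! k = 2) ps then True else no_col r (2 # cols)))"

text \<open>The branch of the search that follows an actual colouring \<open>f\<close> is never
  pruned, since \<open>f\<close> gives touching edges different colours; it would end in the empty
  list.\<close>

lemma no_col_sound:
  assumes "no_col (back_refs es ds) (map f ds)"
    and "\<And>e d. e \<in> set es \<union> set ds \<Longrightarrow> d \<in> set es \<union> set ds \<Longrightarrow> e \<noteq> d \<Longrightarrow> touch e d \<Longrightarrow> f e \<noteq> f d"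
    and "\<And>e. e \<in> set es \<Longrightarrow> f e < 3" and "distinct es" "set es \<inter> set ds = {}"
  shows False
  using assms
proof (induction es arbitrary: ds)
  case (Cons e es)
  let ?ps = "filter (\<lambda>k. touch e (ds ! k)) [0..<length ds]"
  have "\<not> list_ex (\<lambda>k. map f ds ! k = f e) ?ps"
  proof
    assume "list_ex (\<lambda>k. map f ds ! k = f e) ?ps"
    then obtain k where k: "k < length ds" "touch e (ds ! k)" "f (ds ! k) = f e"
      by (auto simp: list_ex_iff)
    then have "ds ! k \<in> set ds" by simp
    moreover from this have "e \<noteq> ds ! k" using Cons.prems(5) by auto
    ultimately show False using Cons.prems(2)[of e "ds ! k"] k by auto
  qed
  moreover have "f e = 0 \<or> f e = 1 \<or> f e = 2" using Cons.prems(3)[of e] by auto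
  ultimately have "no_col (back_refs es (e # ds)) (map f (e # ds))"
    using Cons.prems(1) by auto
  then show False
    by (rule Cons.IH) (use Cons.prems(2-5) in auto)
qed simp

text \<open>Colours may be permuted, so two touching edges can be given the colours 0 and 1 in
  advance; the stack has the later one first.\<close>

fun uncol :: "(nat \<times> nat) list \<Rightarrow> bool" where
  "uncol (e # e' # es) = (touch e e' \<and> no_col (back_refs es [e', e]) [1, 0])"
| "uncol _ = False"

lemma uncol_sound:
  assumes u: "uncol us" and d: "distinct us" and lt: "set us \<subseteq> {(a, b). a < b}"
  shows "\<not> (\<exists>c. edge_colouring3 (edge_of ` set us) c)"
proof
  assume "\<exists>c. edge_colouring3 (edge_of ` set us) c"
  then obtain c where c0: "edge_colouring3 (edge_of ` set us) c" by blast
  have c1: "c (edge_of e) < 3" if "e \<in> set us" for e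
    using c0 that by (simp add: edge_colouring3_def)
  have c2: "c (edge_of e) \<noteq> c (edge_of f)"
    if "e \<in> set us" "f \<in> set us" "edge_of e \<noteq> edge_of f" "edge_of e \<inter> edge_of f \<noteq> {}" for e f
    using c0 that unfolding edge_colouring3_def by (meson imageI)
  obtain e1 e2 es where us: "us = e1 # e2 # es" using u by (cases us rule: uncol.cases) auto
  have ne: "c (edge_of e) \<noteq> c (edge_of f)" if "e \<in> set us" "f \<in> set us" "e \<noteq> f" "touch e f" for e f
  proof (rule c2[OF that(1,2)])
    show "edge_of e \<noteq> edge_of f" using inj_onD[OF edge_of_inj, of e f] that lt by blast
    show "edge_of e \<inter> edge_of f \<noteq> {}" using that(4) by (auto simp: touch_def edge_of_def)
  qed
  \<comment> \<open>The renaming of colours that takes those of the first two edges to 0 and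
    1.\<close>
  define s where "s = (\<lambda>x. if x = c (edge_of e1) then 0 else if x = c (edge_of e2) then 1 else 2 :: nat)"
  define f where "f = (\<lambda>e. s (c (edge_of e)))"
  have t: "touch e1 e2" "e1 \<noteq> e2" using u d us by auto
  have e12: "e1 \<in> set us" "e2 \<in> set us" using us by simp_all
  have 12: "c (edge_of e1) \<noteq> c (edge_of e2)" using ne[OF e12 t(2,1)] .
  have inj: "s x \<noteq> s y" if "x < 3" "y < 3" "x \<noteq> y" for x y
    using that 12 c1[OF e12(1)] c1[OF e12(2)] unfolding s_def by (simp split: if_splits)
  have f12: "f e1 = 0" "f e2 = 1" using 12 by (auto simp: f_def s_def)
  show False
  proof (rule no_col_sound[of es "[e2, e1]" f])
    show "no_col (back_refs es [e2, e1]) (map f [e2, e1])" using u us f12 by simp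
    fix e assume "e \<in> set es" then show "f e < 3" by (simp add: f_def s_def)
  next
    fix e d assume "e \<in> set es \<union> set [e2, e1]" "d \<in> set es \<union> set [e2, e1]" "e \<noteq> d" "touch e d"
    moreover from this have "e \<in> set us" "d \<in> set us" using us by auto
    ultimately show "f e \<noteq> f d" unfolding f_def using inj[OF c1 c1 ne] by blast
  qed (use d us in auto)
qed

text \<open>The finitely checkable part of \<open>hist_snark\<close>. Being cubic and
  \<open>cut4\<close> do not occur because the edge list is produced by \<open>grow\<close>. The
  three clauses relating \<open>es\<close>, \<open>ts\<close> and \<open>fs\<close> say that
  \<open>es\<close> is the disjoint union of the tree edges and the edges of the outer
  cycles.\<close>

definition valid_data :: "nat \<Rightarrow> (nat \<times> nat) list \<Rightarrow> (nat \<times> nat) list \<Rightarrow> (nat \<times> nat) list \<Rightarrow> (nat \<times> nat) list \<Rightarrow>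
    nat list list \<Rightarrow> (nat \<times> nat) list \<Rightarrow> nat \<Rightarrow> bool" where
  "valid_data n es te ts fs cs us k \<longleftrightarrow> tree_order [0] te \<and> length te = n - 1 \<and> es \<noteq> [] \<and>
     list_all (\<lambda>e. e \<in> set es) ts \<and> list_all (\<lambda>e. e \<in> set es \<and> e \<notin> set ts) fs \<and>
     list_all (\<lambda>e. e \<in> set ts \<or> e \<in> set fs) es \<and> distinct (concat cs) \<and> list_all (\<lambda>xs. 3 \<le> length xs) cs \<and>
     girth_ok n (map (nbrs es) [0..<n]) \<and> distinct us \<and> list_all (\<lambda>e. e \<in> set es) us \<and> uncol us \<and>
     distinct ts \<and> k \<le> length (filter (\<lambda>e. e \<notin> set us) ts)"

text \<open>The data found by the search: the insertions leading from K4 to the graph, the tree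
  edges in an order in which the tree grows from vertex 0, the outer cycles, a non-colourable
  subgraph listed in the order in which its colouring is attempted, and the guaranteed number of
  tree edges outside it.\<close>

definition certificate :: "((nat \<times> nat) \<times> (nat \<times> nat)) list \<Rightarrow> (nat \<times> nat) list \<Rightarrow>
    nat list list \<Rightarrow> (nat \<times> nat) list \<Rightarrow> nat \<Rightarrow> bool" where
  "certificate prog te cs us k = valid_data (4 + 2 * length prog) (grow 4 K4 prog) te (map ordered te)
     (concat (map cycle_pairs cs)) cs us k"

definition all_free :: "nat list list \<Rightarrow> (nat \<times> nat) list \<Rightarrow> bool" where
  "all_free cs us = list_all (\<lambda>xs. ordered (last xs, hd xs) \<notin> set us) cs"

lemma certificate_hist_snark:
  assumes "certificate prog te cs us k"
  obtains n E T where "hist_snark {..<n} E T cs (edge_of ` set us)" "k \<le> card (T - edge_of ` set us)"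
    "set us \<subseteq> {(a, b). a < b}"
proof -
  define n es ts fs where "n = 4 + 2 * length prog" and "es = grow 4 K4 prog" and "ts = map ordered te"
    and "fs = concat (map cycle_pairs cs)"
  have v: "tree_order [0] te" "length te = n - 1" "es \<noteq> []" "set ts \<subseteq> set es"
      "\<And>e. e \<in> set fs \<Longrightarrow> e \<in> set es \<and> e \<notin> set ts" "set es \<subseteq> set ts \<union> set fs"
      "distinct (concat cs)" "\<And>xs. xs \<in> set cs \<Longrightarrow> 3 \<le> length xs"
      "girth_ok n (map (nbrs es) [0..<n])" "distinct us" "set us \<subseteq> set es" "uncol us" "distinct ts"
      "k \<le> length (filter (\<lambda>e. e \<notin> set us) ts)"
    using assms unfolding certificate_def valid_data_def n_def es_def ts_def fs_def list_all_iff by blast+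
  have g: "grown n es" using grow_grown[OF grown_K4] v(3) by (simp add: n_def es_def)
  then have lt: "set es \<subseteq> {(a, b). a < b \<and> b < n}" and cub: "cubic {..<n} (edge_of ` set es)"
    and cut: "cut4 {..<n} (edge_of ` set es)" by (auto simp: grown_def)
  let ?E = "edge_of ` set es" and ?T = "edge_of ` set ts" and ?U = "edge_of ` set us"
  have inj: "inj_on edge_of (set es)" by (rule inj_on_subset[OF edge_of_inj]) (use lt in auto)
  have T: "?T = edge_of ` set te" by (simp add: ts_def image_image)
  have tr: "tree {..<n} ?T"
  proof -
    have "tree (set [0]) {}" using tree.single[of 0] by simp
    then have *: "tree ({0} \<union> snd ` set te) ?T" "card ({0} \<union> snd ` set te) = 1 + length te"
      using tree_order_tree[OF _ v(1)] T by force+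
    have "{0} \<union> snd ` set te \<subseteq> {..<n}"
    proof -
      have "snd p < n" if "p \<in> set te" for p
      proof -
        have "ordered p \<in> set es" using v(4) that by (auto simp: ts_def)
        then show ?thesis using lt by (auto simp: ordered_def split: if_splits)
      qed
      then show ?thesis by (auto simp: n_def)
    qed
    \<comment> \<open>Vertex 0 and the n - 1 distinct new ends of tree edges are n vertices below
      n.\<close>
    moreover have "card ({0} \<union> snd ` set te) = card {..<n}" using *(2) v(2) by (simp add: n_def)
    ultimately have "{0} \<union> snd ` set te = {..<n}" by (intro card_subset_eq) auto
    then show ?thesis using *(1) by simp
  qed
  have diff: "?E - ?T = \<Union> (cedges ` set cs)"
  proof -
    have "set es - set ts = set fs" using v(5,6) by blast
    then have "?E - ?T = edge_of ` set fs" using inj_on_image_set_diff[OF inj Diff_subset v(4)] by simp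
    also have "\<dots> = \<Union> ((\<lambda>xs. edge_of ` set (cycle_pairs xs)) ` set cs)" by (auto simp: fs_def)
    finally show ?thesis by (simp add: edges_cycle_pairs)
  qed
  have ltu: "set us \<subseteq> {(a, b). a < b}" using v(11) lt by auto
  have "hist_decomp {..<n} ?E ?T cs"
    unfolding hist_decomp_def using cub tr v(4,7,8) diff by blast
  then have hs: "hist_snark {..<n} ?E ?T cs ?U"
    unfolding hist_snark_def
    using cut girth_ok_no_short_cycle[OF v(9) lt] v(11) uncol_sound[OF v(12,10) ltu] by blast
  have "?T - ?U = edge_of ` (set ts - set us)"
    using inj_on_image_set_diff[OF inj, of "set ts" "set us"] v(4,11) by auto
  moreover have "card (edge_of ` (set ts - set us)) = card (set ts - set us)"
    by (rule card_image) (rule inj_on_subset[OF inj], use v(4) in auto)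
  moreover have "set ts - set us = set (filter (\<lambda>e. e \<notin> set us) ts)" by auto
  moreover have "card (set (filter (\<lambda>e. e \<notin> set us) ts)) = length (filter (\<lambda>e. e \<notin> set us) ts)"
    by (rule distinct_card) (simp add: v(13))
  ultimately have "card (?T - ?U) = length (filter (\<lambda>e. e \<notin> set us) ts)" by simp
  then show ?thesis using that[OF hs _ ltu] v(14) by simp
qed

lemma certificate_attains:
  assumes "certificate prog te cs us k"
  shows "attains k {#} (mset (map length cs))"
  using certificate_hist_snark[OF assms] unfolding attains_def by (metis empty_le)

lemma certificate_attains_free:
  assumes "certificate prog te cs us k" "all_free cs us"
  shows "attains k (mset (map length cs)) (mset (map length cs))"
proof -
  obtain n E T where *: "hist_snark {..<n} E T cs (edge_of ` set us)" "k \<le> card (T - edge_of ` set us)"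
    "set us \<subseteq> {(a, b). a < b}" using certificate_hist_snark[OF assms(1)] .
  have "hist_decomp {..<n} E T cs" using *(1) by (simp add: hist_snark_def)
  have "free (edge_of ` set us) xs" if "xs \<in> set cs" for xs
    unfolding free_def
  proof
    assume "{last xs, hd xs} \<in> edge_of ` set us"
    then obtain p where p: "p \<in> set us" "{last xs, hd xs} = edge_of p" by auto
    then have "p = ordered (last xs, hd xs)"
      using *(3) by (cases p) (auto simp: edge_of_def ordered_def doubleton_eq_iff)
    then show False using assms(2) that p(1) by (simp add: all_free_def list_all_iff)
  qed
  then have "filter (free (edge_of ` set us)) cs = cs" by (simp add: filter_id_conv)
  then show ?thesis unfolding attains_def using * by (metis subset_mset.order_refl)
qed

text \<open>A cubic graph of girth five on ten vertices, hence the Petersen graph. All 15 edges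
  belong to \<open>U\<close>, so no tree edge is spare.\<close>

lemma certificate_6:
  "certificate
    [((0, 1), (2, 3)), ((0, 2), (3, 5)), ((0, 3), (2, 5))]
    [(0, 4), (4, 1), (1, 2), (1, 3), (2, 6), (2, 9), (3, 7), (3, 8), (4, 5)]
    [[0, 6, 7, 5, 9, 8]]
    [(5, 9), (4, 5), (5, 7), (3, 7), (6, 7), (2, 9), (2, 6), (1, 2), (1, 4), (1, 3), (0, 6), (0, 4), (0, 8),
    (3, 8), (8, 9)] 0"
  by code_simp

text \<open>A tree with ten leaves and all inner degrees three has 18 vertices, so this is a snark
  of order 18, one of the two Blanusa snarks.\<close>

lemma certificate_10:
  "certificate
    [((0, 1), (2, 3)), ((1, 4), (0, 3)), ((2, 5), (1, 3)), ((0, 7), (4, 6)), ((1, 2), (3, 5)), ((3, 7), (6,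
    11)), ((4, 11), (7, 14))]
    [(0, 4), (4, 5), (4, 16), (5, 8), (8, 2), (5, 13), (13, 3), (8, 9), (16, 11), (13, 12), (16, 17), (17,
    7), (7, 6), (6, 1), (6, 15), (7, 10), (17, 14)]
    [[0, 10, 11, 15, 14, 3, 9, 1, 12, 2]]
    [(3, 9), (8, 9), (1, 9), (2, 8), (5, 8), (2, 12), (1, 12), (12, 13), (5, 13), (3, 13), (3, 14), (4, 5),
    (0, 2), (1, 6), (0, 4), (4, 16), (0, 10), (11, 16), (10, 11), (11, 15), (6, 15), (14, 15), (7, 10), (6,
    7), (16, 17), (14, 17), (7, 17)] 0"
  by code_simp

lemma certificate_11:
  "certificate
    [((0, 3), (1, 2)), ((2, 3), (4, 5)), ((4, 7), (2, 6)), ((6, 7), (4, 8)), ((7, 10), (4, 11)), ((3, 4), (2,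
    5)), ((5, 7), (2, 9)), ((7, 16), (10, 11))]
    [(0, 1), (0, 2), (0, 4), (2, 15), (2, 17), (15, 5), (17, 9), (9, 6), (6, 3), (6, 10), (9, 8), (10, 12),
    (12, 7), (10, 19), (19, 11), (12, 13), (15, 14), (17, 16), (19, 18)]
    [[4, 13, 11, 8, 7, 18, 16, 5, 1, 3, 14]]
    [(0, 1), (0, 2), (0, 4), (1, 3), (1, 5), (5, 15), (2, 15), (14, 15), (3, 14), (4, 14), (3, 6), (5, 16),
    (2, 17), (4, 13), (16, 17), (9, 17), (6, 9), (16, 18), (8, 9), (6, 10), (12, 13), (10, 12), (7, 12), (7,
    8), (7, 18), (8, 11), (11, 13), (10, 19), (18, 19), (11, 19)] 0"
  by code_simp

lemma certificate_12:
  "certificate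
    [((0, 2), (1, 3)), ((3, 5), (1, 2)), ((3, 6), (4, 5)), ((6, 8), (5, 9)), ((0, 4), (9, 11)), ((2, 7), (5,
    6)), ((4, 12), (5, 11)), ((11, 13), (2, 4)), ((0, 1), (6, 15))]
    [(0, 3), (3, 2), (3, 8), (8, 9), (8, 10), (10, 6), (10, 11), (11, 17), (17, 5), (5, 1), (1, 7), (1, 20),
    (5, 15), (11, 18), (18, 13), (15, 14), (15, 21), (17, 16), (16, 4), (16, 12), (18, 19)]
    [[19, 2, 14, 7, 6, 21, 20, 0, 12, 13, 9, 4]]
    [(6, 10), (6, 7), (6, 21), (15, 21), (20, 21), (1, 7), (7, 14), (1, 20), (1, 5), (14, 15), (5, 15), (2,
    14), (0, 20), (5, 17), (0, 3), (0, 12), (2, 3), (2, 19), (3, 8), (8, 10), (10, 11), (11, 17), (8, 9),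
    (11, 18), (18, 19), (13, 18), (12, 13), (9, 13), (16, 17), (12, 16), (4, 16), (4, 19), (4, 9)] 0"
  by code_simp

text \<open>All 27 edges lie in \<open>U\<close>, so nothing can be attached to this graph. For this
  reason three or more fives start from a separate certificate.\<close>

lemma certificate_5_5:
  "certificate
    [((0, 2), (1, 3)), ((4, 5), (2, 3)), ((1, 5), (0, 3)), ((2, 7), (4, 6)), ((6, 7), (8, 9)), ((1, 8), (4,
    11)), ((11, 15), (1, 2))]
    [(0, 9), (9, 3), (3, 5), (3, 7), (7, 10), (10, 2), (7, 12), (9, 13), (10, 11), (11, 6), (11, 16), (16,
    15), (15, 4), (15, 14), (14, 1), (14, 8), (16, 17)]
    [[0, 1, 17, 2, 4], [8, 5, 6, 12, 13]]
    [(2, 4), (0, 4), (4, 15), (15, 16), (14, 15), (2, 17), (16, 17), (1, 17), (0, 1), (1, 14), (11, 16), (8,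
    14), (2, 10), (0, 9), (10, 11), (6, 11), (7, 10), (3, 7), (3, 9), (3, 5), (5, 8), (5, 6), (8, 13), (9,
    13), (6, 12), (7, 12), (12, 13)] 0"
  by code_simp

text \<open>The seed for all single cycles of length at least 13: nine spare tree edges, and a
  closing edge outside \<open>U\<close>.\<close>

lemma certificate_13:
  "certificate
    [((1, 3), (0, 2)), ((0, 3), (2, 5)), ((0, 6), (1, 2)), ((3, 6), (4, 5)), ((2, 7), (6, 8)), ((8, 13), (1,
    4)), ((3, 10), (5, 7)), ((12, 13), (7, 17)), ((7, 19), (13, 14)), ((2, 12), (0, 1))]
    [(0, 8), (8, 9), (9, 1), (1, 15), (1, 23), (9, 2), (2, 3), (2, 22), (3, 4), (3, 16), (8, 14), (16, 10),
    (10, 6), (6, 7), (6, 13), (7, 12), (7, 20), (10, 11), (13, 18), (13, 21), (16, 17), (17, 5), (17, 19)]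
    [[4, 15, 14, 21, 20, 19, 18, 12, 22, 23, 0, 5, 11]]
    [(13, 21), (6, 13), (13, 18), (18, 19), (12, 18), (20, 21), (19, 20), (7, 20), (7, 12), (6, 7), (12, 22),
    (14, 21), (2, 22), (22, 23), (1, 23), (0, 23), (8, 14), (0, 8), (8, 9), (2, 9), (1, 9), (14, 15), (1,
    15), (4, 15), (0, 5), (5, 11)] 9"
  by code_simp

lemma free_13:
  "all_free
    [[4, 15, 14, 21, 20, 19, 18, 12, 22, 23, 0, 5, 11]]
    [(13, 21), (6, 13), (13, 18), (18, 19), (12, 18), (20, 21), (19, 20), (7, 20), (7, 12), (6, 7), (12, 22),
    (14, 21), (2, 22), (22, 23), (1, 23), (0, 23), (8, 14), (0, 8), (8, 9), (2, 9), (1, 9), (14, 15), (1,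
    15), (4, 15), (0, 5), (5, 11)]"
  by code_simp

text \<open>Further cycles are only attached to this pair, for which six spare tree edges are
  enough.\<close>

lemma certificate_5_6:
  "certificate
    [((1, 3), (0, 2)), ((4, 5), (2, 3)), ((2, 5), (6, 7)), ((4, 6), (8, 9)), ((0, 5), (1, 2)), ((12, 13), (3,
    4)), ((6, 10), (2, 8)), ((4, 10), (3, 7))]
    [(0, 12), (12, 5), (5, 6), (5, 8), (6, 9), (6, 16), (9, 7), (7, 2), (2, 13), (2, 17), (7, 19), (19, 3),
    (9, 11), (12, 14), (19, 18), (18, 4), (4, 1), (4, 15), (18, 10)]
    [[0, 3, 15, 14, 13, 1], [10, 11, 8, 17, 16]]
    [(3, 15), (14, 15), (4, 15), (13, 14), (12, 14), (1, 4), (1, 13), (0, 1), (0, 12), (0, 3), (5, 12), (4,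
    18), (5, 8), (5, 6), (8, 17), (8, 11), (10, 11), (10, 18), (10, 16), (6, 16), (16, 17), (9, 11), (6, 9),
    (2, 17)] 6"
  by code_simp

lemma certificate_5_7:
  "certificate
    [((2, 3), (0, 1)), ((0, 2), (4, 5)), ((2, 6), (0, 5)), ((0, 9), (5, 7)), ((1, 3), (2, 8)), ((9, 10), (4,
    7)), ((1, 12), (8, 13)), ((16, 17), (2, 4)), ((5, 11), (4, 15))]
    [(0, 3), (0, 6), (0, 10), (3, 4), (3, 12), (4, 19), (19, 2), (2, 1), (1, 5), (1, 16), (2, 13), (4, 21),
    (6, 7), (6, 8), (8, 9), (8, 17), (10, 11), (10, 14), (21, 15), (19, 18), (21, 20)]
    [[14, 9, 5, 20, 11, 7, 15], [16, 18, 17, 13, 12]]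
    [(2, 13), (2, 19), (1, 2), (13, 17), (12, 13), (17, 18), (18, 19), (16, 18), (12, 16), (1, 16), (1, 5),
    (8, 17), (8, 9), (5, 9), (5, 20), (9, 14), (6, 8), (14, 15), (10, 14), (7, 15), (6, 7), (7, 11), (10,
    11), (11, 20), (15, 21), (20, 21)] 6"
  by code_simp

lemma certificate_6_6:
  "certificate
    [((0, 2), (1, 3)), ((3, 5), (0, 4)), ((3, 6), (1, 5)), ((5, 9), (0, 7)), ((2, 4), (9, 10)), ((10, 11),
    (5, 6)), ((9, 13), (0, 3)), ((4, 12), (14, 15)), ((6, 15), (12, 18))]
    [(0, 11), (11, 7), (7, 4), (7, 6), (6, 8), (6, 20), (11, 14), (14, 10), (10, 5), (10, 13), (13, 12), (12,
    2), (2, 1), (2, 3), (12, 21), (13, 16), (16, 9), (14, 19), (19, 15), (16, 17), (19, 18)]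
    [[4, 5, 15, 20, 21, 18], [0, 17, 3, 8, 9, 1]]
    [(18, 21), (4, 18), (18, 19), (20, 21), (12, 21), (15, 19), (14, 19), (15, 20), (5, 15), (4, 5), (5, 10),
    (10, 14), (10, 13), (12, 13), (2, 12), (13, 16), (1, 2), (2, 3), (16, 17), (9, 16), (3, 17), (0, 17), (0,
    1), (1, 9), (3, 8), (8, 9)] 6"
  by code_simp

lemma certificate_5_8:
  "certificate
    [((0, 3), (1, 2)), ((1, 5), (0, 2)), ((1, 3), (0, 4)), ((4, 5), (1, 6)), ((0, 7), (8, 9)), ((5, 6), (1,
    11)), ((7, 12), (2, 3)), ((3, 8), (7, 16)), ((11, 15), (2, 5)), ((8, 18), (0, 9))]
    [(0, 1), (0, 12), (0, 23), (1, 8), (1, 15), (8, 13), (8, 22), (15, 14), (15, 20), (20, 11), (20, 21),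
    (21, 2), (2, 7), (2, 17), (17, 3), (3, 4), (3, 18), (4, 9), (4, 10), (21, 5), (7, 6), (7, 19), (17, 16)]
    [[22, 18, 19, 16, 12, 13, 9, 23], [10, 5, 14, 6, 11]]
    [(5, 21), (5, 10), (5, 14), (14, 15), (6, 14), (20, 21), (15, 20), (11, 20), (6, 11), (10, 11), (1, 15),
    (4, 10), (1, 8), (0, 1), (0, 12), (0, 23), (9, 23), (4, 9), (9, 13), (8, 13), (12, 13), (22, 23), (8,
    22), (18, 22), (16, 19), (12, 16), (18, 19)] 6"
  by code_simp

lemma certificate_6_7:
  "certificate
    [((0, 3), (1, 2)), ((1, 3), (0, 2)), ((0, 7), (2, 5)), ((5, 9), (3, 4)), ((9, 10), (7, 8)), ((8, 13), (2,
    9)), ((10, 11), (1, 5)), ((10, 12), (14, 15)), ((5, 10), (7, 13)), ((2, 3), (13, 21))]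
    [(0, 1), (0, 4), (0, 8), (4, 5), (4, 11), (11, 3), (3, 6), (3, 22), (22, 2), (2, 7), (2, 15), (8, 9), (8,
    14), (11, 16), (16, 10), (10, 18), (10, 20), (18, 12), (16, 17), (18, 19), (22, 23), (23, 13), (23, 21)]
    [[20, 21, 7, 6, 1, 17, 5], [12, 9, 15, 19, 14, 13]]
    [(12, 13), (12, 18), (9, 12), (9, 15), (8, 9), (15, 19), (18, 19), (14, 19), (13, 14), (8, 14), (0, 8),
    (10, 18), (0, 1), (0, 4), (10, 16), (10, 20), (4, 5), (5, 20), (5, 17), (16, 17), (1, 17), (4, 11), (11,
    16), (7, 21), (2, 22), (3, 6), (6, 7), (1, 6), (3, 11), (20, 21)] 6"
  by code_simp

text \<open>The seed for the pairs {5, b} with b at least 9, by lengthening the second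
  cycle.\<close>

lemma certificate_5_9:
  "certificate
    [((0, 2), (1, 3)), ((1, 2), (4, 5)), ((0, 3), (1, 5)), ((5, 7), (2, 6)), ((1, 6), (0, 8)), ((6, 12), (8,
    13)), ((8, 15), (5, 10)), ((10, 11), (0, 4)), ((5, 9), (15, 16)), ((0, 19), (1, 12)), ((22, 23), (13,
    15))]
    [(0, 22), (22, 19), (19, 4), (4, 2), (4, 7), (19, 18), (18, 10), (18, 11), (22, 24), (24, 23), (24, 25),
    (25, 13), (25, 15), (15, 14), (14, 6), (14, 12), (15, 21), (21, 16), (21, 20), (20, 5), (5, 3), (5, 17),
    (20, 9), (9, 1), (9, 8)]
    [[23, 12, 13, 0, 1], [16, 17, 10, 7, 6, 11, 2, 3, 8]]
    [(11, 18), (18, 19), (10, 18), (2, 11), (6, 11), (7, 10), (6, 7), (4, 7), (4, 19), (2, 4), (10, 17), (19,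
    22), (2, 3), (6, 14), (14, 15), (12, 14), (12, 23), (12, 13), (13, 25), (15, 25), (24, 25), (22, 24),
    (23, 24), (0, 13), (0, 22), (3, 8), (0, 1), (16, 17)] 9"
  by code_simp

lemma free_5_9:
  "all_free
    [[23, 12, 13, 0, 1], [16, 17, 10, 7, 6, 11, 2, 3, 8]]
    [(11, 18), (18, 19), (10, 18), (2, 11), (6, 11), (7, 10), (6, 7), (4, 7), (4, 19), (2, 4), (10, 17), (19,
    22), (2, 3), (6, 14), (14, 15), (12, 14), (12, 23), (12, 13), (13, 25), (15, 25), (24, 25), (22, 24),
    (23, 24), (0, 13), (0, 22), (3, 8), (0, 1), (16, 17)]"
  by code_simp

text \<open>The seed for the pairs {6, b} with b at least 8.\<close>

lemma certificate_6_8: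
  "certificate
    [((1, 2), (0, 3)), ((1, 3), (4, 5)), ((0, 2), (3, 5)), ((2, 3), (8, 9)), ((3, 6), (5, 7)), ((2, 8), (3,
    10)), ((2, 4), (1, 6)), ((0, 8), (1, 17)), ((16, 17), (0, 1)), ((6, 12), (9, 11)), ((2, 14), (11, 23))]
    [(0, 5), (0, 18), (0, 21), (21, 1), (5, 9), (5, 13), (13, 7), (18, 8), (13, 12), (12, 3), (12, 22), (22,
    6), (18, 19), (21, 20), (20, 16), (16, 2), (2, 10), (2, 24), (16, 4), (10, 11), (10, 15), (24, 14), (20,
    17), (22, 23), (24, 25)]
    [[17, 19, 1, 4, 7, 6], [15, 14, 8, 11, 25, 23, 9, 3]]
    [(8, 11), (10, 11), (11, 25), (8, 18), (8, 14), (2, 10), (10, 15), (14, 15), (14, 24), (2, 24), (24, 25),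
    (2, 16), (23, 25), (4, 16), (16, 20), (0, 18), (18, 19), (1, 19), (1, 4), (1, 21), (0, 21), (20, 21),
    (17, 20), (17, 19), (6, 7), (9, 23), (4, 7), (3, 9)] 9"
  by code_simp

lemma free_6_8:
  "all_free
    [[17, 19, 1, 4, 7, 6], [15, 14, 8, 11, 25, 23, 9, 3]]
    [(8, 11), (10, 11), (11, 25), (8, 18), (8, 14), (2, 10), (10, 15), (14, 15), (14, 24), (2, 24), (24, 25),
    (2, 16), (23, 25), (4, 16), (16, 20), (0, 18), (18, 19), (1, 19), (1, 4), (1, 21), (0, 21), (20, 21),
    (17, 20), (17, 19), (6, 7), (9, 23), (4, 7), (3, 9)]"
  by code_simp

text \<open>The seed for all pairs with both lengths at least 7; both of its cycles are
  lengthened.\<close>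

lemma certificate_7_7:
  "certificate
    [((1, 3), (0, 2)), ((2, 3), (4, 5)), ((1, 2), (0, 5)), ((1, 8), (0, 3)), ((5, 7), (8, 9)), ((10, 11), (3,
    6)), ((6, 15), (7, 12)), ((0, 9), (3, 11)), ((1, 10), (11, 19)), ((2, 6), (9, 13)), ((6, 7), (3, 15))]
    [(0, 18), (18, 9), (9, 5), (5, 2), (2, 8), (2, 22), (5, 12), (8, 10), (8, 13), (9, 23), (10, 14), (10,
    20), (20, 1), (14, 11), (14, 15), (15, 16), (15, 25), (25, 3), (18, 19), (20, 21), (25, 24), (24, 6),
    (24, 7), (7, 4), (7, 17)]
    [[4, 1, 0, 11, 21, 19, 3], [6, 16, 17, 12, 13, 23, 22]]
    [(5, 12), (5, 9), (2, 5), (2, 8), (2, 22), (12, 13), (8, 13), (13, 23), (22, 23), (9, 23), (12, 17), (8,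
    10), (9, 18), (10, 14), (10, 20), (0, 18), (18, 19), (11, 14), (0, 11), (11, 21), (19, 21), (20, 21), (1,
    20), (0, 1), (3, 19), (6, 16), (1, 4), (16, 17)] 9"
  by code_simp

lemma free_7_7:
  "all_free
    [[4, 1, 0, 11, 21, 19, 3], [6, 16, 17, 12, 13, 23, 22]]
    [(5, 12), (5, 9), (2, 5), (2, 8), (2, 22), (12, 13), (8, 13), (13, 23), (22, 23), (9, 23), (12, 17), (8,
    10), (9, 18), (10, 14), (10, 20), (0, 18), (18, 19), (11, 14), (0, 11), (11, 21), (19, 21), (20, 21), (1,
    20), (0, 1), (3, 19), (6, 16), (1, 4), (16, 17)]"
  by code_simp

lemma certificate_5_5_5:
  "certificate
    [((0, 3), (1, 2)), ((2, 5), (3, 4)), ((2, 3), (6, 7)), ((0, 2), (6, 9)), ((1, 3), (4, 5)), ((5, 6), (12,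
    13)), ((2, 10), (6, 14)), ((16, 17), (9, 11)), ((5, 14), (3, 7)), ((7, 21), (9, 19)), ((3, 21), (7, 9)),
    ((8, 9), (20, 21))]
    [(0, 1), (0, 4), (0, 10), (4, 7), (4, 13), (10, 11), (11, 6), (10, 16), (11, 19), (19, 18), (19, 23),
    (23, 9), (9, 25), (9, 26), (26, 8), (8, 2), (8, 3), (3, 12), (3, 24), (23, 22), (26, 27), (27, 20), (20,
    5), (20, 14), (14, 15), (14, 17), (27, 21)]
    [[22, 21, 24, 25, 7], [1, 12, 15, 13, 5], [16, 18, 17, 6, 2]]
    [(10, 11), (11, 19), (6, 11), (2, 6), (6, 17), (10, 16), (2, 16), (16, 18), (17, 18), (18, 19), (14, 17),
    (0, 10), (14, 20), (14, 15), (0, 1), (0, 4), (5, 20), (1, 5), (5, 13), (13, 15), (4, 13), (12, 15), (1,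
    12), (21, 24), (7, 22), (21, 22), (24, 25), (7, 25)] 6"
  by code_simp


section \<open>Snarks with a single outer cycle\<close>

text \<open>Choose a repetition of vertices with the least gap. The vertices in between are then
  distinct, and the gap is at least three because a gap of one would be a loop and a gap of two a
  reversal.\<close>

lemma closed_walk_cycle:
  fixes w :: "nat \<Rightarrow> 'a"
  assumes edge: "\<And>i. i < m \<Longrightarrow> {w i, w (Suc i)} \<in> F \<and> w i \<noteq> w (Suc i)"
    and nb: "\<And>i. Suc i < m \<Longrightarrow> w i \<noteq> w (Suc (Suc i))"
    and rep: "a < b" "b \<le> m" "w a = w b"
  shows "\<exists>xs. is_cycle F xs \<and> set xs \<subseteq> w ` {..m}"
proof -
  define P where "P = (\<lambda>d. \<exists>a b. a < b \<and> b \<le> m \<and> w a = w b \<and> b - a = d)"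
  have "P (b - a)" using rep by (auto simp: P_def)
  then have least: "P (LEAST d. P d)" "\<And>d. P d \<Longrightarrow> (LEAST d. P d) \<le> d" by (auto intro: LeastI Least_le)
  then obtain a b where ab: "a < b" "b \<le> m" "w a = w b" "b - a = (LEAST d. P d)" unfolding P_def by blast
  have min: "b - a \<le> j - i" if "i < j" "j \<le> m" "w i = w j" for i j
    using least(2)[of "j - i"] that ab(4) by (auto simp: P_def)
  have inj: "i = j" if "a \<le> i" "i < b" "a \<le> j" "j < b" "w i = w j" for i j
  proof (rule ccontr)
    assume "i \<noteq> j"
    then consider "i < j" | "j < i" by linarith
    then show False using min[of i j] min[of j i] that ab by cases auto
  qed
  have "b \<noteq> Suc a" using edge[of a] ab by auto
  moreover have "b \<noteq> Suc (Suc a)" using nb[of a] ab by auto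
  ultimately have len: "3 \<le> b - a" using ab(1) by linarith
  let ?xs = "map w [a..<b]"
  have "is_cycle F ?xs" unfolding is_cycle_def
  proof (intro conjI allI impI)
    show "3 \<le> length ?xs" using len by simp
    show "distinct ?xs" using inj by (auto simp: distinct_map inj_on_def)
    fix i assume "i < length ?xs"
    then have i: "a + i < b" by simp
    show "{?xs ! i, ?xs ! (Suc i mod length ?xs)} \<in> F"
    proof (cases "Suc (a + i) < b")
      case True
      then show ?thesis using edge[of "a + i"] ab i by simp
    next
      case False
      then have "Suc (a + i) = b" using i by simp
      then have "Suc i = length ?xs" by simp
      then have "Suc i mod length ?xs = 0" by (simp only: mod_self)
      then show ?thesis using edge[of "a + i"] ab i \<open>Suc (a + i) = b\<close> by simp
    qed
  qed
  moreover have "set ?xs \<subseteq> w ` {..m}" using ab by auto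
  ultimately show ?thesis by blast
qed

text \<open>A walk that can always be continued without turning back must repeat a vertex of the
  finite set. \<open>P\<close> is a property of directed edges that is handed on along the walk, and
  this allows two quite different uses: finding an outer cycle, and showing that a tree has no
  endless branch.\<close>

lemma walk_forever_cycle:
  assumes fin: "finite A" and start: "P x0 y0"
    and P: "\<And>x y. P x y \<Longrightarrow> {x, y} \<in> F \<and> x \<noteq> y \<and> x \<in> A \<and> (\<exists>z. z \<noteq> x \<and> P y z)"
  shows "\<exists>xs. is_cycle F xs \<and> set xs \<subseteq> A"
proof -
  define step where "step = (\<lambda>(x, y). (y, SOME z. z \<noteq> x \<and> P y z))"
  define g where "g = (\<lambda>i. (step ^^ i) (x0, y0))"
  define w where "w = (\<lambda>i. fst (g i))"
  have st: "snd (step p) \<noteq> fst p \<and> P (snd p) (snd (step p)) \<and> fst (step p) = snd p" if "P (fst p) (snd p)" for p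
    using someI_ex[of "\<lambda>z. z \<noteq> fst p \<and> P (snd p) z"] P[OF that] by (auto simp: step_def split: prod.splits)
  have gS: "g (Suc i) = step (g i)" for i by (simp add: g_def)
  have gP: "P (fst (g i)) (snd (g i))" for i
  proof (induction i)
    case 0 then show ?case using start by (simp add: g_def)
  next
    case (Suc i) then show ?case using st[OF Suc] by (simp add: gS)
  qed
  have next1: "snd (g i) = w (Suc i)" for i using st[OF gP[of i]] by (simp add: w_def gS)
  have next2: "w (Suc (Suc i)) \<noteq> w i" for i
    using st[OF gP[of i]] next1[of "Suc i"] by (simp add: w_def gS)
  have e: "{w i, w (Suc i)} \<in> F \<and> w i \<noteq> w (Suc i)" and inA: "w i \<in> A" for i
    using P[OF gP[of i]] next1[of i] by (auto simp: w_def)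
  have "\<not> inj_on w {..card A}"
  proof
    assume "inj_on w {..card A}"
    moreover have "w ` {..card A} \<subseteq> A" using inA by auto
    ultimately have "card {..card A} \<le> card A" using card_inj_on_le fin by blast
    then show False by simp
  qed
  then obtain i j where ij: "i \<le> card A" "j \<le> card A" "w i = w j" "i \<noteq> j" by (auto simp: inj_on_def)
  have "\<exists>a b. a < b \<and> b \<le> card A \<and> w a = w b"
    using ij by (metis linorder_neqE_nat)
  then obtain a b where "a < b" "b \<le> card A" "w a = w b" by blast
  from closed_walk_cycle[of "card A" w F, OF _ _ this] obtain xs where "is_cycle F xs" "set xs \<subseteq> w ` {..card A}"
    using e next2 by metis
  then show ?thesis using inA by blast
qed

text \<open>Steps between directed edges, because not turning back is then a condition on a single
  step and closures of the relation can be used.\<close>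

definition nbstep :: "'a set set \<Rightarrow> 'a \<times> 'a \<Rightarrow> 'a \<times> 'a \<Rightarrow> bool" where
  "nbstep F p q \<longleftrightarrow> fst q = snd p \<and> snd q \<noteq> fst p \<and> {fst p, snd p} \<in> F \<and> {fst q, snd q} \<in> F"

lemma nbstep_rev: "(nbstep F)\<^sup>*\<^sup>* (u, v) (x, y) \<Longrightarrow> (nbstep F)\<^sup>*\<^sup>* (y, x) (v, u)"
proof (induction "(x, y)" arbitrary: x y rule: rtranclp_induct)
  case (step p)
  obtain a b where p: "p = (a, b)" by fastforce
  then have "nbstep F (y, x) (b, a)" using step(2) by (auto simp: nbstep_def insert_commute)
  moreover have "(nbstep F)\<^sup>*\<^sup>* (b, a) (v, u)" using step(3)[OF p] .
  ultimately show ?case by (rule converse_rtranclp_into_rtranclp)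
qed simp

text \<open>The walk may turn back at its closing vertex x: the minimal repetition only uses the
  absence of reversals strictly inside the walk.\<close>

lemma closed_nbwalk_cycle:
  assumes w: "(nbstep F)\<^sup>*\<^sup>* (x, y) (z, x)" and noloop: "\<And>a. {a} \<notin> F" and xy: "{x, y} \<in> F"
  shows "has_cycle F"
proof -
  obtain k where "(nbstep F ^^ k) (x, y) (z, x)" using w by (meson rtranclp_imp_relpowp)
  then obtain f where f: "f 0 = (x, y)" "f k = (z, x)" "\<And>i. i < k \<Longrightarrow> nbstep F (f i) (f (Suc i))"
    by (auto simp: relpowp_fun_conv)
  define w where "w = (\<lambda>i. if i \<le> k then fst (f i) else snd (f k))"
  have snd: "snd (f i) = w (Suc i)" if "i \<le> k" for i
    using f(3)[of i] that by (cases "i = k") (auto simp: w_def nbstep_def)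
  have fF: "{fst (f i), snd (f i)} \<in> F" if le: "i \<le> k" for i
  proof (cases "i = 0")
    case False
    then obtain j where "i = Suc j" "j < k" using le False by (cases i) auto
    then show ?thesis using f(3)[of j] unfolding nbstep_def by metis
  qed (use f xy in simp)
  have ne: "a \<noteq> b" if "{a, b} \<in> F" for a b using that noloop by auto
  have "\<exists>xs. is_cycle F xs \<and> set xs \<subseteq> w ` {..Suc k}"
  proof (rule closed_walk_cycle[where a = 0 and b = "Suc k"])
    fix i assume "i < Suc k"
    then have "i \<le> k" by simp
    then show "{w i, w (Suc i)} \<in> F \<and> w i \<noteq> w (Suc i)"
      using fF[of i] snd[of i] ne[of "w i" "w (Suc i)"] by (simp add: w_def)
  next
    fix i assume "Suc i < Suc k"
    then show "w i \<noteq> w (Suc (Suc i))" using f(3)[of i] snd[of "Suc i"] by (auto simp: w_def nbstep_def)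
  qed (use f in \<open>auto simp: w_def\<close>)
  then show ?thesis by (auto simp: has_cycle_def)
qed

lemma girth_no_short_cycle:
  assumes sg: "simple_graph V E" and g: "girth_ge E 5"
  shows "no_short_cycle E"
proof (rule no_short_cycleI)
  fix x y z assume *: "{x, y} \<in> E" "{y, z} \<in> E" "{z, x} \<in> E" "x \<noteq> z"
  then have "x \<noteq> y" "y \<noteq> z" using simple_graph_pairD(1)[OF sg] by blast+
  then have "is_cycle E [x, y, z]" using * unfolding is_cycle_iff by (auto simp: cedges_def)
  then show False using g by (force simp: girth_ge_def)
next
  fix x y z w assume *: "{x, y} \<in> E" "{y, z} \<in> E" "{z, w} \<in> E" "{w, x} \<in> E" "x \<noteq> z" "y \<noteq> w"
  then have "x \<noteq> y" "y \<noteq> z" "z \<noteq> w" "w \<noteq> x" using simple_graph_pairD(1)[OF sg] by blast+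
  then have "is_cycle E [x, y, z, w]" using * unfolding is_cycle_iff by (auto simp: cedges_def)
  then show False using g by (force simp: girth_ge_def)
qed

section \<open>Outer cycles of an arbitrary Hist\<close>

context
  fixes V :: "'a set" and E T :: "'a set set"
  assumes cub: "cubic V E" and hist: "hist V E T"
begin

lemma hist_sg: "simple_graph V E" using cub by (simp add: cubic_def)

lemma hist_TE: "T \<subseteq> E" using hist by (simp add: hist_def spanning_tree_def)

lemma hist_finite: "finite V" "finite E" "finite T"
  using hist_sg simple_graph_finite[OF hist_sg] finite_subset[OF hist_TE] by (auto simp: simple_graph_def)

lemma hist_outer_degree:
  assumes "v \<in> V"
  shows "card {e \<in> E - T. v \<in> e} = (if v \<in> leaves V T then 2 else 0)"
proof -
  have "{e \<in> E. v \<in> e} = {e \<in> T. v \<in> e} \<union> {e \<in> E - T. v \<in> e}" using hist_TE by blast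
  moreover have "card ({e \<in> T. v \<in> e} \<union> {e \<in> E - T. v \<in> e}) = card {e \<in> T. v \<in> e} + card {e \<in> E - T. v \<in> e}"
    using hist_finite by (intro card_Un_disjoint) auto
  ultimately have 3: "degree T v + card {e \<in> E - T. v \<in> e} = 3"
    using cub assms unfolding cubic_def degree_def by metis
  have "degree T v = 1 \<or> degree T v = 3" using hist assms by (simp add: hist_def)
  then show ?thesis using 3 assms unfolding leaves_def by fastforce
qed

text \<open>Leaves have two non-tree edges and other vertices none, so a walk in the component can
  always go on and contains a cycle. The cycle already uses both non-tree edges at each of its
  vertices, hence it is closed under adjacency and fills the component.\<close>

lemma outer_component_cycle:
  assumes v: "v \<in> leaves V T"
  shows "\<exists>xs. is_cycle (E - T) xs \<and> set xs = {u. (adj (E - T))\<^sup>*\<^sup>* v u}"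
proof -
  let ?F = "E - T"
  define C where "C = {u. (adj ?F)\<^sup>*\<^sup>* v u}"
  have edge: "x \<in> leaves V T" if "{x, y} \<in> ?F" for x y
  proof -
    have "x \<in> V" using simple_graph_pairD(2)[OF hist_sg] that by blast
    moreover have "{e \<in> ?F. x \<in> e} \<noteq> {}" using that by blast
    moreover have "finite {e \<in> ?F. x \<in> e}" using hist_finite by simp
    ultimately have "card {e \<in> ?F. x \<in> e} \<noteq> 0" by simp
    then show ?thesis using hist_outer_degree[OF \<open>x \<in> V\<close>] by metis
  qed
  have CL: "C \<subseteq> leaves V T"
  proof
    fix u assume "u \<in> C"
    then have "(adj ?F)\<^sup>*\<^sup>* v u" by (simp add: C_def)
    then show "u \<in> leaves V T"
      by (rule reach_closed[OF _ v]) (use edge in \<open>metis insert_commute\<close>)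
  qed
  have two: "card {e \<in> ?F. y \<in> e} = 2" if "y \<in> C" for y
    using CL that hist_outer_degree[of y] by (auto simp: leaves_def)
  have other: "\<exists>z. z \<noteq> x \<and> {y, z} \<in> ?F" if yC: "y \<in> C" for x y
  proof -
    obtain e f where ef: "{e \<in> ?F. y \<in> e} = {e, f}" "e \<noteq> f" using two[OF yC] by (auto simp: card_2_iff)
    have mem: "e \<in> ?F" "y \<in> e" "f \<in> ?F" "y \<in> f" using ef(1) by blast+
    have "\<exists>z. g = {y, z}" if "g \<in> ?F" "y \<in> g" for g
      using simple_graph_edgeE[OF hist_sg, of g] that by (metis DiffD1 insertE insert_commute singletonD)
    then obtain z1 z2 where "e = {y, z1}" "f = {y, z2}" using mem by blast
    then show ?thesis using ef(2) mem by metis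
  qed
  have Cstep: "y \<in> C" if "x \<in> C" "{x, y} \<in> ?F" for x y
    using that by (auto simp: C_def adj_def intro: rtranclp.rtrancl_into_rtrancl)
  have vC: "v \<in> C" by (simp add: C_def)
  obtain y0 where y0: "{v, y0} \<in> ?F" using other[OF vC] by blast
  have "finite C" using CL hist_finite(1) by (metis (no_types, lifting) leaves_def finite_subset mem_Collect_eq subsetI)
  then have "\<exists>xs. is_cycle ?F xs \<and> set xs \<subseteq> C"
  proof (rule walk_forever_cycle[where P = "\<lambda>x y. x \<in> C \<and> {x, y} \<in> ?F"])
    show "v \<in> C \<and> {v, y0} \<in> ?F" using vC y0 by blast
    fix x y assume xy: "x \<in> C \<and> {x, y} \<in> ?F"
    then have "y \<in> C" "x \<noteq> y" using Cstep simple_graph_pairD(1)[OF hist_sg] by blast+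
    then show "{x, y} \<in> ?F \<and> x \<noteq> y \<and> x \<in> C \<and> (\<exists>z. z \<noteq> x \<and> y \<in> C \<and> {y, z} \<in> ?F)"
      using xy other[of y x] by blast
  qed
  then obtain xs where xs: "is_cycle ?F xs" "set xs \<subseteq> C" by blast
  then have cyc: "3 \<le> length xs" "distinct xs" "cedges xs \<subseteq> ?F" by (simp_all add: is_cycle_iff)
  have closed: "y \<in> set xs" if "x \<in> set xs" "{x, y} \<in> ?F" for x y
  proof -
    have "{e \<in> cedges xs. x \<in> e} = {e \<in> ?F. x \<in> e}"
    proof (rule card_subset_eq)
      show "finite {e \<in> ?F. x \<in> e}" using hist_finite by simp
      show "{e \<in> cedges xs. x \<in> e} \<subseteq> {e \<in> ?F. x \<in> e}" using cyc(3) by blast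
      show "card {e \<in> cedges xs. x \<in> e} = card {e \<in> ?F. x \<in> e}"
        using cedges_degree[OF cyc(2,1) that(1)] two xs(2) that(1) by auto
    qed
    then have "{x, y} \<in> cedges xs" using that(2) by blast
    moreover have "xs \<noteq> []" using cyc(1) by auto
    ultimately show ?thesis using cedges_subset by blast
  qed
  have "C \<subseteq> set xs"
  proof
    fix u assume "u \<in> C"
    have h: "hd xs \<in> set xs" using cyc(1) by (cases xs) auto
    then have "(adj ?F)\<^sup>*\<^sup>* v (hd xs)" using xs(2) by (auto simp: C_def)
    then have "(adj ?F)\<^sup>*\<^sup>* (hd xs) u" using adj_star_sym \<open>u \<in> C\<close> unfolding C_def by (metis mem_Collect_eq rtranclp_trans)
    then show "u \<in> set xs" by (rule reach_closed[OF _ h closed])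
  qed
  then show ?thesis using xs by (auto simp: C_def)
qed

lemma outer_cycle_edges:
  assumes cyc: "is_cycle (E - T) xs" and xs: "set xs = leaves V T"
  shows "E - T = cedges xs"
proof
  have c: "3 \<le> length xs" "distinct xs" "cedges xs \<subseteq> E - T" using cyc by (simp_all add: is_cycle_iff)
  then show "cedges xs \<subseteq> E - T" by blast
  show "E - T \<subseteq> cedges xs"
  proof
    fix e assume e: "e \<in> E - T"
    then obtain x y where xy: "e = {x, y}" "x \<in> V" using simple_graph_edgeE[OF hist_sg, of e] by blast
    have fin: "finite {e \<in> E - T. x \<in> e}" using hist_finite by simp
    moreover have "e \<in> {e \<in> E - T. x \<in> e}" using e xy by simp
    ultimately have "card {e \<in> E - T. x \<in> e} \<noteq> 0" using card_0_eq by blast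
    then have two: "card {e \<in> E - T. x \<in> e} = 2" "x \<in> leaves V T"
      using hist_outer_degree[OF xy(2)] by metis+
    have "{e \<in> cedges xs. x \<in> e} = {e \<in> E - T. x \<in> e}"
    proof (rule card_subset_eq[OF fin])
      show "{e \<in> cedges xs. x \<in> e} \<subseteq> {e \<in> E - T. x \<in> e}" using c(3) by blast
      show "card {e \<in> cedges xs. x \<in> e} = card {e \<in> E - T. x \<in> e}"
        using cedges_degree[OF c(2,1)] two xs by simp
    qed
    then show "e \<in> cedges xs" using \<open>e \<in> {e \<in> E - T. x \<in> e}\<close> by blast
  qed
qed

lemma outer_cycles_finite: "finite (outer_cycles V E T)"
  using hist_finite(1) by (simp add: outer_cycles_def leaves_def)

end

text \<open>Colours are the three nonzero elements of Klein's four-group, so that in a proper colouring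
  the colours at a vertex of degree three sum to zero.\<close>

datatype klein = K0 | K1 | K2 | K3

fun kadd :: "klein \<Rightarrow> klein \<Rightarrow> klein" where
  "kadd K0 y = y" | "kadd K1 K0 = K1" | "kadd K1 K1 = K0" | "kadd K1 K2 = K3" | "kadd K1 K3 = K2"
| "kadd K2 K0 = K2" | "kadd K2 K1 = K3" | "kadd K2 K2 = K0" | "kadd K2 K3 = K1"
| "kadd K3 K0 = K3" | "kadd K3 K1 = K2" | "kadd K3 K2 = K1" | "kadd K3 K3 = K0"

fun others :: "klein \<Rightarrow> klein \<times> klein" where
  "others K1 = (K2, K3)" | "others K2 = (K1, K3)" | "others K3 = (K1, K2)" | "others K0 = (K0, K0)"

section \<open>Enumerating and colouring labelled binary trees\<close>

datatype bt = L nat | N bt bt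

fun labels :: "bt \<Rightarrow> nat set" where
  "labels (L i) = {i}"
| "labels (N l r) = labels l \<union> labels r"

fun distinct_labels :: "bt \<Rightarrow> bool" where
  "distinct_labels (L i) = True"
| "distinct_labels (N l r) = (labels l \<inter> labels r = {} \<and> distinct_labels l \<and> distinct_labels r)"

text \<open>\<open>x\<close> is the colour of the edge above the root of the tree, and
  \<open>f\<close> gives the colour of the edge at each leaf. The set equation makes the three
  colours at an inner vertex distinct and nonzero.\<close>

fun colours :: "bt \<Rightarrow> klein \<Rightarrow> (nat \<Rightarrow> klein) \<Rightarrow> bool" where
  "colours (L i) x f = (f i = x)"
| "colours (N l r) x f = (\<exists>y z. {x, y, z} = {K1, K2, K3} \<and> colours l y f \<and> colours r z f)"

text \<open>Starting with colour \<open>e\<close> on the last edge of the outer cycle, the leaf colours determine the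
  colours of the following edges as partial sums; none of them may be zero.\<close>

fun closes :: "klein \<Rightarrow> klein \<Rightarrow> klein list \<Rightarrow> bool" where
  "closes e s [] = (s = K0)"
| "closes e s (t # ts) = (if kadd s t = e then False else closes e (kadd s t) ts)"

text \<open>A stack of subtrees with the colours of the edges above them; at an inner vertex both
  orders of the two remaining colours are tried. The number is fuel, and running out of it means
  failure, which is sound. With an empty stack the three possible colours of the last cycle edge are
  tested.\<close>

fun search :: "nat \<Rightarrow> (bt \<times> klein) list \<Rightarrow> klein list \<Rightarrow> bool" where
  "search n [] acc = (if closes K1 K0 acc then True else if closes K2 K0 acc then True else closes K3 K0 acc)"
| "search 0 (p # st) acc = False"
| "search (Suc n) ((t, x) # st) acc = (case t of L i \<Rightarrow> search n st (acc[i := x]) | N l r \<Rightarrow>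
     (let (y, z) = others x in if search n ((l, y) # (r, z) # st) acc then True
      else search n ((l, z) # (r, y) # st) acc))"

definition circ_dist :: "nat \<Rightarrow> nat \<Rightarrow> nat \<Rightarrow> nat" where
  "circ_dist l i j = (let d = (if i \<le> j then j - i else i - j) in min d (l - d))"

text \<open>Whether a leaf \<open>i\<close> hanging off the root of the tree would lie on a cycle of length at most four.\<close>

fun near :: "nat \<Rightarrow> nat \<Rightarrow> bt \<Rightarrow> bool" where
  "near l i (L j) = (circ_dist l i j < 3)"
| "near l i (N x y) = ((case x of L j \<Rightarrow> circ_dist l i j < 2 | _ \<Rightarrow> False) \<or>
     (case y of L j \<Rightarrow> circ_dist l i j < 2 | _ \<Rightarrow> False))"

text \<open>Conditions between two sibling subtrees, each necessary for girth five. They only have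
  to prune the enumeration, so no trees that violate the girth in other ways are looked for.\<close>

fun compatible :: "nat \<Rightarrow> bt \<Rightarrow> bt \<Rightarrow> bool" where
  "compatible l (L i) y = (\<not> near l i y)"
| "compatible l (N a b) (L j) = (\<not> near l j (N a b))"
| "compatible l x y = True"

fun splits :: "nat list \<Rightarrow> (nat list \<times> nat list) list" where
  "splits [] = [([], [])]"
| "splits (x # xs) = concat (map (\<lambda>(a, b). [(x # a, b), (a, x # b)]) (splits xs))"

text \<open>The first label always goes to the left subtree, so that swapping children does not
  produce a tree twice. The second argument is fuel; the number of labels suffices.\<close>

fun trees :: "nat \<Rightarrow> nat \<Rightarrow> nat list \<Rightarrow> bt list" where
  "trees l 0 xs = []"
| "trees l (Suc k) xs = (case xs of [] \<Rightarrow> [] | x # ys \<Rightarrow> (if ys = [] then [L x] else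
     concat (map (\<lambda>(a, b). if b = [] then [] else let es = trees l k b in
       concat (map (\<lambda>t. map (N t) (filter (compatible l t) es)) (trees l k (x # a)))) (splits ys))))"

text \<open>Positions 0 and i are leaves with a common neighbour, from which the rest of the tree
  \<open>t\<close> hangs. Up to renaming colours their edges have colours \<open>K1\<close> and
  \<open>K2\<close>, and so the edge to \<open>t\<close> has \<open>K3\<close>. For at most nine
  leaves \<open>t\<close> has at most seven, hence at most 13 nodes, and 30 units of fuel are
  enough.\<close>

definition all_colourable :: "nat \<Rightarrow> nat \<Rightarrow> bool" where
  "all_colourable l i = list_all (\<lambda>t. if compatible l (L i) t \<and> compatible l (L 0) t
     then search 30 [(t, K3)] ((replicate l K0)[0 := K1, i := K2]) else True)
     (trees l l (filter (\<lambda>j. j \<noteq> i) [1..<l]))"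

lemma kadd_third: "x \<noteq> K0 \<Longrightarrow> y \<noteq> K0 \<Longrightarrow> x \<noteq> y \<Longrightarrow> kadd x y \<noteq> K0 \<and> kadd x y \<noteq> x \<and> kadd x y \<noteq> y"
  by (cases x; cases y) auto

lemma kadd_assoc: "kadd (kadd x y) z = kadd x (kadd y z)"
  by (cases x; cases y; cases z) auto

lemma kadd_eq_0: "kadd x y = K0 \<longleftrightarrow> x = y"
  by (cases x; cases y) auto

text \<open>The trees on the stack have disjoint label sets, so a leaf colour once written to the
  accumulator is never overwritten.\<close>

lemma search_sound:
  assumes "search n st acc"
    and "\<And>t x. (t, x) \<in> set st \<Longrightarrow> distinct_labels t \<and> x \<noteq> K0 \<and> labels t \<subseteq> {..<length acc}"
    and "sorted_wrt (\<lambda>p q. labels (fst p) \<inter> labels (fst q) = {}) st"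
  shows "\<exists>f e. (\<forall>(t, x) \<in> set st. colours t x f) \<and>
    (\<forall>i < length acc. i \<notin> \<Union> (labels ` fst ` set st) \<longrightarrow> f i = acc ! i) \<and>
    e \<noteq> K0 \<and> closes e K0 (map f [0..<length acc])"
  using assms
proof (induction n st acc rule: search.induct)
  case (1 n acc)
  then obtain e where "e \<noteq> K0" "closes e K0 acc" by (auto split: if_splits)
  then show ?case by (intro exI[of _ "(!) acc"] exI[of _ e]) (simp add: map_nth)
next
  case (3 n t x st acc)
  show ?case
  proof (cases t)
    case (L i)
    have i: "i < length acc" using 3(5)[of t x] L by auto
    have disj: "i \<notin> \<Union> (labels ` fst ` set st)" using 3(6) L by auto
    have s: "search n st (acc[i := x])" using 3(4) L by simp
    have pre: "distinct_labels t' \<and> x' \<noteq> K0 \<and> labels t' \<subseteq> {..<length (acc[i := x])}"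
      if "(t', x') \<in> set st" for t' x' using that 3(5)[of t' x'] by simp
    have srt: "sorted_wrt (\<lambda>p q. labels (fst p) \<inter> labels (fst q) = {}) st" using 3(6) by simp
    obtain f e where f: "\<forall>(t, x) \<in> set st. colours t x f"
      "\<forall>j < length (acc[i := x]). j \<notin> \<Union> (labels ` fst ` set st) \<longrightarrow> f j = acc[i := x] ! j"
      "e \<noteq> K0" "closes e K0 (map f [0..<length (acc[i := x])])"
      using 3(1)[OF L s pre srt] by blast
    then have "f i = x" using i disj by simp
    moreover have "f j = acc ! j" if "j < length acc" "j \<notin> \<Union> (labels ` fst ` set ((t, x) # st))" for j
    proof -
      have "j \<noteq> i" using that L by simp
      then show ?thesis using f(2) that by simp
    qed
    ultimately show ?thesis using f(1,3,4) L by (intro exI[of _ f] exI[of _ e]) auto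
  next
    case (N l r)
    obtain y z where yz: "others x = (y, z)" by fastforce
    have x: "x \<noteq> K0" "distinct_labels t" "labels t \<subseteq> {..<length acc}" using 3(5)[of t x] by auto
    then have xyz: "{x, y, z} = {K1, K2, K3}" "{x, z, y} = {K1, K2, K3}" "y \<noteq> K0" "z \<noteq> K0"
      using yz by (cases x; auto)+
    have ok: "\<exists>f e. (\<forall>(t, x) \<in> set ((t, x) # st). colours t x f) \<and>
        (\<forall>i < length acc. i \<notin> \<Union> (labels ` fst ` set ((t, x) # st)) \<longrightarrow> f i = acc ! i) \<and>
        e \<noteq> K0 \<and> closes e K0 (map f [0..<length acc])"
      if fe: "\<exists>f e. (\<forall>(t, x) \<in> set ((l, p) # (r, q) # st). colours t x f) \<and>
        (\<forall>i < length acc. i \<notin> \<Union> (labels ` fst ` set ((l, p) # (r, q) # st)) \<longrightarrow> f i = acc ! i) \<and>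
        e \<noteq> K0 \<and> closes e K0 (map f [0..<length acc])" and pq: "{x, p, q} = {K1, K2, K3}" for p q
    proof -
      obtain f e where "\<forall>(t, x) \<in> set ((l, p) # (r, q) # st). colours t x f"
        "\<forall>i < length acc. i \<notin> \<Union> (labels ` fst ` set ((l, p) # (r, q) # st)) \<longrightarrow> f i = acc ! i"
        "e \<noteq> K0" "closes e K0 (map f [0..<length acc])" using fe by blast
      then show ?thesis using pq N by (intro exI[of _ f] exI[of _ e]) auto
    qed
    have pre: "distinct_labels t' \<and> x' \<noteq> K0 \<and> labels t' \<subseteq> {..<length acc}"
      if "(t', x') \<in> set ((l, p) # (r, q) # st)" "p \<noteq> K0" "q \<noteq> K0" for t' x' p q
      using that x N 3(5)[of t' x'] by auto
    have srt: "sorted_wrt (\<lambda>p q. labels (fst p) \<inter> labels (fst q) = {}) ((l, p) # (r, q) # st)" for p q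
      using 3(6) x(2) N by auto
    show ?thesis
    proof (cases "search n ((l, y) # (r, z) # st) acc")
      case True
      show ?thesis
        by (rule ok[OF 3(2)[OF N yz[symmetric] refl True] xyz(1)]) (use pre xyz srt in blast)+
    next
      case False
      then have s: "search n ((l, z) # (r, y) # st) acc" using 3(4) N yz by simp
      show ?thesis
        by (rule ok[OF 3(3)[OF N yz[symmetric] refl False s] xyz(2)]) (use pre xyz srt in blast)+
    qed
  qed
qed simp

lemma splits_filter: "(filter P xs, filter (\<lambda>x. \<not> P x) xs) \<in> set (splits xs)"
proof (induction xs)
  case (Cons x xs)
  have "set (splits (x # xs)) = (\<Union>p \<in> set (splits xs). {(x # fst p, snd p), (fst p, x # snd p)})"
    by (simp add: case_prod_unfold)
  note eq = this
  show ?case unfolding eq by (rule UN_I[OF Cons]) simp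
qed simp

lemma trees_node:
  assumes AB: "(A, B) \<in> set (splits ys)" "l \<in> set (trees n k (x # A))" "r \<in> set (trees n k B)"
    and ne: "B \<noteq> []" "ys \<noteq> []" and c: "compatible n l r"
  shows "N l r \<in> set (trees n (Suc k) (x # ys))"
proof -
  let ?F = "\<lambda>(a, b). if b = [] then [] else let es = trees n k b in
       concat (map (\<lambda>t. map (N t) (filter (compatible n t) es)) (trees n k (x # a)))"
  have "N l r \<in> set (?F (A, B))" using AB(2,3) ne(1) c by (simp add: Let_def image_iff)
  then have "N l r \<in> set (concat (map ?F (splits ys)))" using AB(1) unfolding set_concat set_map by blast
  moreover have "trees n (Suc k) (x # ys) = concat (map ?F (splits ys))"
    using ne(2) by (simp only: trees.simps list.case if_False)
  ultimately show ?thesis by simp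
qed

text \<open>\<open>branch T xs u v D t\<close>: the component \<open>D\<close> of \<open>v\<close> in \<open>T - uv\<close> is a binary tree \<open>t\<close> rooted at \<open>v\<close>, whose
  leaves are labelled by their positions in \<open>xs\<close>.\<close>

inductive branch :: "'a set set \<Rightarrow> 'a list \<Rightarrow> 'a \<Rightarrow> 'a \<Rightarrow> 'a set \<Rightarrow> bt \<Rightarrow> bool" for T xs where
  leaf: "(\<And>y. {v, y} \<in> T \<longleftrightarrow> y = u) \<Longrightarrow> i < length xs \<Longrightarrow> v = xs ! i \<Longrightarrow> branch T xs u v {v} (L i)"
| node: "(\<And>y. {v, y} \<in> T \<longleftrightarrow> y = u \<or> y = a \<or> y = b) \<Longrightarrow> distinct [u, a, b] \<Longrightarrow> v \<notin> set xs \<Longrightarrow>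
    branch T xs v a D1 l \<Longrightarrow> branch T xs v b D2 r \<Longrightarrow> branch T xs u v (insert v (D1 \<union> D2)) (N l r)"

lemma branch_edge: "branch T xs u v D t \<Longrightarrow> {v, u} \<in> T \<and> v \<in> D"
  by (induction rule: branch.induct) auto

text \<open>Turns overlaps of branches into closed walks without reversals, to which the acyclicity
  of the tree can be applied.\<close>

lemma branch_walk: "branch T xs u v D t \<Longrightarrow> w \<in> D \<Longrightarrow> \<exists>p. (nbstep T)\<^sup>*\<^sup>* (u, v) (p, w)"
proof (induction arbitrary: w rule: branch.induct)
  case (leaf v u i)
  then show ?case by blast
next
  case (node v u a b D1 l D2 r)
  have uv: "{u, v} \<in> T" "{v, a} \<in> T" "{v, b} \<in> T" using node(1)[of u] node(1)[of a] node(1)[of b]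
    by (simp_all add: insert_commute)
  have "nbstep T (u, v) (v, a)" "nbstep T (u, v) (v, b)" using uv node(2) by (auto simp: nbstep_def)
  then show ?case using node.IH node.prems by (metis UnE converse_rtranclp_into_rtranclp insertE rtranclp.rtrancl_refl)
qed

text \<open>A branch can be left only through the edge from its root to the parent. Started at a
  leaf of the tree, it therefore exhausts the tree.\<close>

lemma branch_closed: "branch T xs u v D t \<Longrightarrow> w \<in> D \<Longrightarrow> {w, y} \<in> T \<Longrightarrow> y \<in> D \<or> w = v \<and> y = u"
proof (induction arbitrary: w y rule: branch.induct)
  case (node v u a b D1 l D2 r)
  have "a \<in> D1" "b \<in> D2" using branch_edge[OF node(4)] branch_edge[OF node(5)] by simp_all
  from node.prems(1) consider "w = v" | "w \<in> D1" | "w \<in> D2" by blast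
  then show ?case
  proof cases
    case 1
    then have "y = u \<or> y = a \<or> y = b" using node(1)[of y] node.prems(2) by simp
    then show ?thesis using 1 \<open>a \<in> D1\<close> \<open>b \<in> D2\<close> by blast
  next
    case 2
    then have "y \<in> D1 \<or> y = v" using node.IH(1)[OF 2 node.prems(2)] by blast
    then show ?thesis by blast
  next
    case 3
    then have "y \<in> D2 \<or> y = v" using node.IH(2)[OF 3 node.prems(2)] by blast
    then show ?thesis by blast
  qed
next
  case (leaf v u i)
  then have "w = v" by simp
  then show ?case using leaf(1)[of y] leaf.prems(2) by simp
qed

section \<open>Branches in an acyclic graph\<close>

context
  fixes T :: "'a set set" and xs :: "'a list"
  assumes acyc: "\<not> has_cycle T" and noloop: "\<And>a. {a} \<notin> T" and dist: "distinct xs"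
    and pair: "\<And>e. e \<in> T \<Longrightarrow> \<exists>x y. e = {x, y}"
begin

lemma edge_at: "e \<in> T \<Longrightarrow> w \<in> e \<Longrightarrow> \<exists>y. e = {w, y}"
  using pair by (metis insertE insert_commute singletonD)

lemma branch_parent: "branch T xs u v D t \<Longrightarrow> u \<notin> D"
proof
  assume b: "branch T xs u v D t" "u \<in> D"
  obtain p where p: "(nbstep T)\<^sup>*\<^sup>* (u, v) (p, u)" using branch_walk[OF b] by (rule exE)
  have "{u, v} \<in> T" using branch_edge[OF b(1)] by (simp add: insert_commute)
  then have "has_cycle T" by (rule closed_nbwalk_cycle[OF p noloop])
  then show False using acyc by simp
qed

text \<open>From a common vertex w walk up the first branch to v and down the second one back to w.
  The turn at v is no reversal because a and b differ, so this would be a cycle in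
  \<open>T\<close>.\<close>

lemma branch_disjoint:
  assumes "branch T xs v a D1 l" "branch T xs v b D2 r" "a \<noteq> b"
  shows "D1 \<inter> D2 = {}"
proof (rule ccontr)
  assume "D1 \<inter> D2 \<noteq> {}"
  then obtain w where w: "w \<in> D1" "w \<in> D2" by blast
  obtain p q where pq: "(nbstep T)\<^sup>*\<^sup>* (v, a) (p, w)" "(nbstep T)\<^sup>*\<^sup>* (v, b) (q, w)"
    using branch_walk[OF assms(1) w(1)] branch_walk[OF assms(2) w(2)] by blast
  have e: "{a, v} \<in> T" "{v, b} \<in> T" using branch_edge[OF assms(1)] branch_edge[OF assms(2)] by (simp_all add: insert_commute)
  have rev_walk: "(nbstep T)\<^sup>*\<^sup>* (w, p) (a, v)" by (rule nbstep_rev[OF pq(1)])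
  have turn: "nbstep T (a, v) (v, b)" using e assms(3) by (simp add: nbstep_def)
  have cl: "(nbstep T)\<^sup>*\<^sup>* (w, p) (q, w)"
    by (rule rtranclp_trans[OF rev_walk converse_rtranclp_into_rtranclp[OF turn pq(2)]])
  have "{w, p} \<in> T"
  proof (cases "(w, p) = (a, v)")
    case False
    then obtain z where "nbstep T (w, p) z" using rev_walk by (metis converse_rtranclpE)
    then show ?thesis by (simp add: nbstep_def)
  qed (use e in auto)
  then have "has_cycle T" by (rule closed_nbwalk_cycle[OF cl noloop])
  then show False using acyc by simp
qed

lemma branch_labels:
  "branch T xs u v D t \<Longrightarrow> labels t = {i. i < length xs \<and> xs ! i \<in> D} \<and> distinct_labels t"
proof (induction rule: branch.induct)
  case (leaf v u i)
  then show ?case using dist by (auto simp: nth_eq_iff_index_eq)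
next
  case (node v u a b D1 l D2 r)
  have "D1 \<inter> D2 = {}" using branch_disjoint[OF node(4,5)] node(2) by simp
  moreover have "xs ! i \<noteq> v" if "i < length xs" for i using node(3) that by auto
  ultimately show ?case using node.IH by auto
qed

text \<open>Colourings of the two sub-branches are glued. Each covers its own edge to v, and these
  edges have different colours that also differ from the colour above v, so the colouring is proper
  at v as well.\<close>

lemma branch_colouring:
  "branch T xs u v D t \<Longrightarrow> colours t x f \<Longrightarrow> x \<noteq> K0 \<Longrightarrow>
    \<exists>c. c {u, v} = x \<and> (\<forall>w \<in> D. inj_on c {e \<in> T. w \<in> e} \<and> K0 \<notin> c ` {e \<in> T. w \<in> e}) \<and>
      (\<forall>i < length xs. xs ! i \<in> D \<longrightarrow> (\<forall>y. {xs ! i, y} \<in> T \<longrightarrow> c {xs ! i, y} = f i))"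
proof (induction arbitrary: x rule: branch.induct)
  case (leaf v u i)
  have one: "e = {v, u}" if "e \<in> T" "v \<in> e" for e
    using edge_at[OF that] leaf(1) that(1) by metis
  have "inj_on (\<lambda>_. x) {e \<in> T. v \<in> e}" using one by (auto simp: inj_on_def)
  moreover have "j = i" if "j < length xs" "xs ! j = v" for j
    using that leaf(2,3) dist by (simp add: nth_eq_iff_index_eq)
  ultimately show ?case using leaf(4,5) by (intro exI[of _ "\<lambda>_. x"]) auto
next
  case (node v u a b D1 l D2 r)
  obtain y z where yz: "{x, y, z} = {K1, K2, K3}" "colours l y f" "colours r z f"
    using node.prems(1) by auto
  have K0: "K0 \<notin> {x, y, z}" unfolding yz(1) by simp
  have neq: "x \<noteq> y" "x \<noteq> z" "y \<noteq> z"
  proof -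
    have "card {x, y, z} = 3" unfolding yz(1) by simp
    then show "x \<noteq> y" "x \<noteq> z" "y \<noteq> z" by (auto simp: card_insert_if split: if_splits)
  qed
  obtain c1 where c1: "c1 {v, a} = y" "\<forall>w \<in> D1. inj_on c1 {e \<in> T. w \<in> e} \<and> K0 \<notin> c1 ` {e \<in> T. w \<in> e}"
      "\<forall>i < length xs. xs ! i \<in> D1 \<longrightarrow> (\<forall>y. {xs ! i, y} \<in> T \<longrightarrow> c1 {xs ! i, y} = f i)"
    using node.IH(1)[OF yz(2)] K0 by blast
  obtain c2 where c2: "c2 {v, b} = z" "\<forall>w \<in> D2. inj_on c2 {e \<in> T. w \<in> e} \<and> K0 \<notin> c2 ` {e \<in> T. w \<in> e}"
      "\<forall>i < length xs. xs ! i \<in> D2 \<longrightarrow> (\<forall>y. {xs ! i, y} \<in> T \<longrightarrow> c2 {xs ! i, y} = f i)"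
    using node.IH(2)[OF yz(3)] K0 by blast
  have whole: "branch T xs u v (insert v (D1 \<union> D2)) (N l r)" by (rule branch.node[OF node(1-5)])
  have out: "u \<notin> D1" "u \<notin> D2" "v \<notin> D1" "v \<notin> D2" "a \<in> D1" "b \<in> D2"
    using branch_parent[OF whole] branch_parent[OF node(4)] branch_parent[OF node(5)] branch_edge[OF node(4)] branch_edge[OF node(5)]
    by blast+
  have disj: "D1 \<inter> D2 = {}" using branch_disjoint[OF node(4,5)] node(2) by simp
  \<comment> \<open>The edges va and vb count as parts of the sub-branches, since they meet D1 and
    D2. The edge uv meets neither set and receives the default x.\<close>
  define c where "c = (\<lambda>e. if e \<inter> D1 \<noteq> {} then c1 e else if e \<inter> D2 \<noteq> {} then c2 e else x)"
  have cD1: "c e = c1 e" if "w \<in> D1" "w \<in> e" for w e using that by (auto simp: c_def)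
  have cD2: "c e = c2 e" if we: "w \<in> D2" "w \<in> e" "e \<in> T" for w e
  proof -
    obtain y' where y': "e = {w, y'}" using edge_at[OF we(3,2)] by blast
    have "y' \<notin> D1"
    proof
      assume "y' \<in> D1"
      moreover have "{y', w} \<in> T" using we y' by (simp add: insert_commute)
      ultimately have "w \<in> D1 \<or> w = v" using branch_closed[OF node(4)] by blast
      then show False using we disj out by blast
    qed
    then have "e \<inter> D1 = {}" "e \<inter> D2 \<noteq> {}" using y' we disj by auto
    then show ?thesis by (simp add: c_def)
  qed
  have vb: "{v, b} \<in> T" using node(1) by blast
  have cv: "c {v, u} = x" "c {v, a} = y" "c {v, b} = z"
    using out c1(1) c2(1) cD1[of a "{v, a}"] cD2[of b "{v, b}"] vb by (auto simp: c_def)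
  have atv: "e = {v, u} \<or> e = {v, a} \<or> e = {v, b}" if "e \<in> T" "v \<in> e" for e
    using edge_at[OF that] node(1) that(1) by metis
  show ?case
  proof (intro exI[of _ c] conjI ballI allI impI)
    show "c {u, v} = x" using cv by (simp add: insert_commute)
  next
    fix w assume "w \<in> insert v (D1 \<union> D2)"
    then consider "w = v" | "w \<in> D1" | "w \<in> D2" by blast
    then show "inj_on c {e \<in> T. w \<in> e}"
    proof cases
      case 1
      show ?thesis
      proof (rule inj_onI)
        fix e e' assume "e \<in> {e \<in> T. w \<in> e}" "e' \<in> {e \<in> T. w \<in> e}" "c e = c e'"
        then show "e = e'" using atv[of e] atv[of e'] cv neq 1 by auto
      qed
    next
      case 2
      then show ?thesis using c1(2) cD1[OF 2] by (simp add: inj_on_def)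
    next
      case 3
      then show ?thesis using c2(2) cD2[OF 3] by (simp add: inj_on_def)
    qed
  next
    fix w assume "w \<in> insert v (D1 \<union> D2)"
    then consider "w = v" | "w \<in> D1" | "w \<in> D2" by blast
    then show "K0 \<notin> c ` {e \<in> T. w \<in> e}"
    proof cases
      case 1
      then show ?thesis using atv cv K0 by force
    next
      case 2
      then show ?thesis using c1(2) cD1[OF 2] by force
    next
      case 3
      then show ?thesis using c2(2) cD2[OF 3] by force
    qed
  next
    fix i y' assume i: "i < length xs" "xs ! i \<in> insert v (D1 \<union> D2)" "{xs ! i, y'} \<in> T"
    then consider "xs ! i \<in> D1" | "xs ! i \<in> D2" using node(3) nth_mem by blast
    then show "c {xs ! i, y'} = f i"
    proof cases
      case 1
      then show ?thesis using c1(3) cD1[OF 1] i by auto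
    next
      case 2
      then show ?thesis using c2(3) cD2[OF 2 _ i(3)] i by auto
    qed
  qed
qed

end

section \<open>Girth conditions on branches\<close>

lemma circ_dist_adjacent:
  assumes "xs \<noteq> []" "i < length xs" "j < length xs" "i \<noteq> j" "circ_dist (length xs) i j < 2"
  shows "{xs ! i, xs ! j} \<in> cedges xs"
proof -
  have step: "{xs ! k, xs ! (Suc k mod length xs)} \<in> cedges xs" if "k < length xs" for k
    using that assms(1) by (auto simp: cedges_nth)
  have "j = Suc i mod length xs \<or> i = Suc j mod length xs"
    using assms(2-5) by (auto simp: circ_dist_def Let_def mod_Suc split: if_splits)
  then show ?thesis using step[OF assms(2)] step[OF assms(3)] by (metis insert_commute)
qed

lemma circ_dist_two:
  assumes "xs \<noteq> []" "i < length xs" "j < length xs" "i \<noteq> j" "circ_dist (length xs) i j < 3"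
  shows "{xs ! i, xs ! j} \<in> cedges xs \<or> (\<exists>m \<in> set xs. {xs ! i, m} \<in> cedges xs \<and> {m, xs ! j} \<in> cedges xs)"
proof (cases "circ_dist (length xs) i j < 2")
  case True
  then show ?thesis using circ_dist_adjacent assms by blast
next
  case False
  let ?n = "length xs"
  have step: "{xs ! k, xs ! (Suc k mod ?n)} \<in> cedges xs" if "k < ?n" for k
    using that assms(1) by (auto simp: cedges_nth)
  have two: "\<exists>m \<in> set xs. {xs ! k, m} \<in> cedges xs \<and> {m, xs ! (Suc (Suc k mod ?n) mod ?n)} \<in> cedges xs" if "k < ?n" for k
  proof -
    have "Suc k mod ?n < ?n" using that by (intro mod_less_divisor) linarith
    then show ?thesis using step[OF that] step[of "Suc k mod ?n"] nth_mem by blast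
  qed
  have "j = Suc (Suc i mod ?n) mod ?n \<or> i = Suc (Suc j mod ?n) mod ?n"
    using assms(2-5) False by (auto simp: circ_dist_def Let_def mod_Suc split: if_splits)
  then show ?thesis using two[OF assms(2)] two[OF assms(3)] by (metis insert_commute)
qed

context
  fixes E T :: "'a set set" and xs :: "'a list"
  assumes nsc: "no_short_cycle E" and TE: "T \<subseteq> E" and CE: "cedges xs \<subseteq> E" and ne: "xs \<noteq> []"
begin

text \<open>The two or three tree edges between the leaves, together with a short way between them
  along the outer cycle, would close a cycle of length at most four.\<close>

lemma branch_not_near:
  assumes b: "branch T xs u v D t" and i: "i < length xs" "{u, xs ! i} \<in> T" "xs ! i \<noteq> v" and u: "u \<notin> set xs"
  shows "\<not> near (length xs) i t"
  using b
proof (cases rule: branch.cases)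
  case (leaf j)
  have uv: "{xs ! i, u} \<in> E" "{u, xs ! j} \<in> E"
    using TE i(2) branch_edge[OF b] leaf(5) by (auto simp: insert_commute)
  have "\<not> circ_dist (length xs) i j < 3"
  proof
    assume "circ_dist (length xs) i j < 3"
    moreover have "i \<noteq> j" using i(3) leaf(5) by blast
    ultimately consider "{xs ! i, xs ! j} \<in> E" | m where "m \<in> set xs" "{xs ! i, m} \<in> E" "{m, xs ! j} \<in> E"
      using circ_dist_two[OF ne i(1) leaf(4)] CE by blast
    then show False
    proof cases
      case 1 then show ?thesis using no_short_cycle_triangle[OF nsc uv] i(3) leaf(5) by blast
    next
      case (2 m)
      then have "m = u" using no_short_cycle_quad[OF nsc uv, of m] i(3) leaf(5) by blast
      then show ?thesis using 2(1) u by blast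
    qed
  qed
  then show ?thesis using leaf by simp
next
  case (node a b' D1 l D2 r)
  have uv: "{xs ! i, u} \<in> E" "{u, v} \<in> E"
    using TE i(2) branch_edge[OF b] by (auto simp: insert_commute)
  have child: "\<not> circ_dist (length xs) i j < 2" if c: "branch T xs v w D' (L j)" "{v, w} \<in> T" "w \<noteq> u" for w D' j
  proof
    assume d: "circ_dist (length xs) i j < 2"
    have wj: "w = xs ! j" "j < length xs" using c(1) by (auto elim: branch.cases)
    have vw: "{v, w} \<in> E" using TE c(2) by blast
    have "i \<noteq> j"
    proof
      assume "i = j"
      then have "{xs ! i, v} \<in> E" using vw wj by (simp add: insert_commute)
      then show False using no_short_cycle_triangle[OF nsc uv i(3)] by blast
    qed
    then have "{xs ! i, w} \<in> E" using circ_dist_adjacent[OF ne i(1) wj(2) _ d] CE wj by blast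
    moreover have "{w, v} \<in> E" using vw by (simp add: insert_commute)
    ultimately have "w = u" using no_short_cycle_quad[OF nsc uv i(3)] by blast
    then show False using c(3) by blast
  qed
  have "{v, a} \<in> T" "{v, b'} \<in> T" using node(3) by blast+
  then have "\<not> (case l of L j \<Rightarrow> circ_dist (length xs) i j < 2 | _ \<Rightarrow> False)"
    "\<not> (case r of L j \<Rightarrow> circ_dist (length xs) i j < 2 | _ \<Rightarrow> False)"
    using child[of a D1] child[of b' D2] node(4,6,7) by (auto split: bt.splits)
  then show ?thesis using node(2) by simp
qed

lemma branch_compatible:
  assumes "branch T xs v a D1 l" "branch T xs v b D2 r" "a \<noteq> b" "v \<notin> set xs"
  shows "compatible (length xs) l r"
proof -
  have va: "{v, a} \<in> T" "{v, b} \<in> T"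
    using branch_edge[OF assms(1)] branch_edge[OF assms(2)] by (simp_all add: insert_commute)
  show ?thesis
  proof (cases l)
    case (L i)
    then have "a = xs ! i" "i < length xs" using assms(1) by (auto elim: branch.cases)
    then show ?thesis using branch_not_near[OF assms(2), of i] va assms(3,4) L by simp
  next
    case (N l1 l2)
    show ?thesis
    proof (cases r)
      case (L j)
      then have "b = xs ! j" "j < length xs" using assms(2) by (auto elim: branch.cases)
      then show ?thesis using branch_not_near[OF assms(1), of j] va assms(3,4) L N by simp
    qed (simp add: N)
  qed
qed

text \<open>The enumeration fixes which child comes first, so it yields a possibly different tree
  \<open>t'\<close>; this one describes the same branch because the order of children is immaterial
  for \<open>branch\<close>.\<close>

lemma trees_complete:
  assumes acyc: "\<not> has_cycle T" and noloop: "\<And>a. {a} \<notin> T" and dist: "distinct xs"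
    and pair: "\<And>e. e \<in> T \<Longrightarrow> \<exists>x y. e = {x, y}"
  shows "branch T xs u v D t \<Longrightarrow> distinct zs \<Longrightarrow> set zs = labels t \<Longrightarrow> length zs \<le> k \<Longrightarrow>
    \<exists>t' \<in> set (trees (length xs) k zs). branch T xs u v D t'"
proof (induction arbitrary: zs k rule: branch.induct)
  case (leaf v u i)
  then have zs: "zs = [i]" by (metis distinct.simps(2) labels.simps(1) list.set_cases list.set_intros(1,2)
        list.set(1) neq_Nil_conv singletonD insert_not_empty list.set_sel(1))
  then obtain k' where "k = Suc k'" using leaf(6) by (cases k) auto
  then show ?case using zs branch.leaf[OF leaf(1-3)] by simp
next
  case (node v u a b D1 l D2 r)
  have lab: "distinct_labels t" if "branch T xs u' v' D t" for u' v' D t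
    using branch_labels[OF acyc noloop dist _ that] pair by blast
  have whole: "branch T xs u v (insert v (D1 \<union> D2)) (N l r)" by (rule branch.node[OF node(1-5)])
  have disj: "labels l \<inter> labels r = {}" using lab[OF whole] by simp
  have nonempty: "labels t \<noteq> {}" for t by (induction t) auto
  have zs0: "zs \<noteq> []" using node.prems(2) nonempty[of "N l r"] by auto
  then obtain x ys where zs: "zs = x # ys" by (cases zs) auto
  obtain k' where k: "k = Suc k'" using node.prems(3) zs by (cases k) auto
  \<comment> \<open>The children are variables here, so that the same argument serves whichever
    child carries the first label x.\<close>
  have main: "\<exists>t' \<in> set (trees (length xs) k zs). branch T xs u v (insert v (D1' \<union> D2')) t'"
    if nb: "\<And>y. {v, y} \<in> T \<longleftrightarrow> y = u \<or> y = a' \<or> y = b'" and dd: "distinct [u, a', b']"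
      and br: "branch T xs v a' D1' l'" "branch T xs v b' D2' r'"
      and IH: "\<And>zs k. distinct zs \<Longrightarrow> set zs = labels l' \<Longrightarrow> length zs \<le> k \<Longrightarrow>
          \<exists>t' \<in> set (trees (length xs) k zs). branch T xs v a' D1' t'"
        "\<And>zs k. distinct zs \<Longrightarrow> set zs = labels r' \<Longrightarrow> length zs \<le> k \<Longrightarrow>
          \<exists>t' \<in> set (trees (length xs) k zs). branch T xs v b' D2' t'"
      and sets: "set zs = labels l' \<union> labels r'" "labels l' \<inter> labels r' = {}" "x \<in> labels l'"
    for a' b' D1' D2' l' r'
  proof -
    define A B where "A = filter (\<lambda>y. y \<in> labels l') ys" and "B = filter (\<lambda>y. \<not> y \<in> labels l') ys"
    have AB: "(A, B) \<in> set (splits ys)" unfolding A_def B_def by (rule splits_filter)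
    have d: "distinct (x # A)" "distinct B" using node.prems(1) zs by (auto simp: A_def B_def)
    have sA: "set (x # A) = labels l'" using sets zs by (auto simp: A_def)
    have sB: "set B = labels r'" using sets zs by (auto simp: B_def)
    have len: "length (x # A) \<le> k'" "length B \<le> k'"
    proof -
      have "length A + length B = length ys" unfolding A_def B_def by (rule sum_length_filter_compl)
      moreover have "B \<noteq> []" using sB nonempty[of r'] by auto
      moreover have "length ys \<le> k'" using node.prems(3) zs k by simp
      ultimately show "length (x # A) \<le> k'" "length B \<le> k'" by (cases B; simp)+
    qed
    obtain l2 where l2: "l2 \<in> set (trees (length xs) k' (x # A))" "branch T xs v a' D1' l2" using IH(1)[OF d(1) sA len(1)] by blast
    obtain r2 where r2: "r2 \<in> set (trees (length xs) k' B)" "branch T xs v b' D2' r2" using IH(2)[OF d(2) sB len(2)] by blast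
    have "B \<noteq> []" using sB nonempty[of r'] by auto
    then have "ys \<noteq> []" by (auto simp: B_def)
    have "compatible (length xs) l2 r2" using branch_compatible[OF l2(2) r2(2)] dd node(3) by simp
    then have "N l2 r2 \<in> set (trees (length xs) k zs)"
      unfolding zs k by (rule trees_node[OF AB l2(1) r2(1) \<open>B \<noteq> []\<close> \<open>ys \<noteq> []\<close>])
    moreover have "branch T xs u v (insert v (D1' \<union> D2')) (N l2 r2)"
      by (rule branch.node[OF nb dd node(3) l2(2) r2(2)])
    ultimately show ?thesis by blast
  qed
  have "x \<in> labels l \<or> x \<in> labels r" using node.prems(2) zs by auto
  then show ?case
  proof
    assume x: "x \<in> labels l"
    show ?thesis
    proof (rule main[OF node(1,2,4,5) _ _ _ disj x])
      show "\<exists>t' \<in> set (trees (length xs) k zs). branch T xs v a D1 t'"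
        if "distinct zs" "set zs = labels l" "length zs \<le> k" for zs k by (rule node.IH(1)[OF that])
      show "\<exists>t' \<in> set (trees (length xs) k zs). branch T xs v b D2 t'"
        if "distinct zs" "set zs = labels r" "length zs \<le> k" for zs k by (rule node.IH(2)[OF that])
      show "set zs = labels l \<union> labels r" using node.prems(2) by simp
    qed
  next
    assume x: "x \<in> labels r"
    have nb': "{v, y} \<in> T \<longleftrightarrow> y = u \<or> y = b \<or> y = a" for y using node(1)[of y] by blast
    have dd': "distinct [u, b, a]" using node(2) by auto
    have sets': "set zs = labels r \<union> labels l" "labels r \<inter> labels l = {}" using node.prems(2) disj by auto
    have "\<exists>t' \<in> set (trees (length xs) k zs). branch T xs u v (insert v (D2 \<union> D1)) t'"
    proof (rule main[OF nb' dd' node(5,4) _ _ sets' x])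
      show "\<exists>t' \<in> set (trees (length xs) k zs). branch T xs v b D2 t'"
        if "distinct zs" "set zs = labels r" "length zs \<le> k" for zs k by (rule node.IH(2)[OF that])
      show "\<exists>t' \<in> set (trees (length xs) k zs). branch T xs v a D1 t'"
        if "distinct zs" "set zs = labels l" "length zs \<le> k" for zs k by (rule node.IH(1)[OF that])
    qed
    then show ?thesis by (simp add: Un_commute)
  qed
qed

end

section \<open>Extending leaf colours to the outer cycle\<close>

primrec psum :: "(nat \<Rightarrow> klein) \<Rightarrow> nat \<Rightarrow> klein" where
  "psum f 0 = K0"
| "psum f (Suc k) = kadd (psum f k) (f k)"

lemma closes_psum:
  "closes e (psum f a) (map f [a..<n]) \<Longrightarrow> a \<le> n \<Longrightarrow> psum f n = K0 \<and> (\<forall>k. a < k \<and> k \<le> n \<longrightarrow> psum f k \<noteq> e)"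
proof (induction "n - a" arbitrary: a)
  case 0
  then have "n = a" by simp
  then show ?case using 0 by auto
next
  case (Suc d)
  then have an: "a < n" by simp
  then have "[a..<n] = a # [Suc a..<n]" by (simp add: upt_conv_Cons)
  then have c: "psum f (Suc a) \<noteq> e" "closes e (psum f (Suc a)) (map f [Suc a..<n])"
    using Suc.prems(1) by (auto split: if_splits)
  have "psum f n = K0 \<and> (\<forall>k. Suc a < k \<and> k \<le> n \<longrightarrow> psum f k \<noteq> e)"
    by (rule Suc.hyps(1)[OF _ c(2)]) (use Suc.hyps(2) an in auto)
  then show ?case using c(1) by (metis Suc_lessI)
qed

lemma cycle_edge_unique:
  assumes "distinct xs" "3 \<le> length xs" "i < length xs" "j < length xs"
    and eq: "{xs ! i, xs ! (Suc i mod length xs)} = {xs ! j, xs ! (Suc j mod length xs)}"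
  shows "i = j"
proof -
  have lt: "Suc i mod length xs < length xs" "Suc j mod length xs < length xs"
    using assms(2) by (auto intro!: mod_less_divisor)
  have "xs ! i = xs ! j \<or> xs ! i = xs ! (Suc j mod length xs) \<and> xs ! (Suc i mod length xs) = xs ! j"
    using eq by (auto simp: doubleton_eq_iff)
  then have "i = j \<or> i = Suc j mod length xs \<and> Suc i mod length xs = j"
    using assms(1,3,4) lt by (simp add: nth_eq_iff_index_eq)
  then show ?thesis using assms(2-4) by (auto simp: mod_Suc split: if_splits)
qed

definition colour_nat :: "klein \<Rightarrow> nat" where
  "colour_nat x = (case x of K1 \<Rightarrow> 0 | K2 \<Rightarrow> 1 | _ \<Rightarrow> 2)"

lemma colour_nat_inj: "x \<noteq> K0 \<Longrightarrow> y \<noteq> K0 \<Longrightarrow> x \<noteq> y \<Longrightarrow> colour_nat x \<noteq> colour_nat y"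
  by (cases x; cases y) (auto simp: colour_nat_def)

lemma colour_nat_less: "colour_nat x < 3"
  by (cases x) (auto simp: colour_nat_def)

text \<open>At a leaf the outgoing cycle edge receives the sum of the incoming cycle colour and the
  leaf colour. The three colours then sum to zero, and being nonzero they are distinct.
  \<open>closes\<close> guarantees that all partial results are nonzero and that the total of the
  leaf colours vanishes, so the colours agree after one round.\<close>

lemma colour_cycle_and_tree:
  fixes c :: "'a set \<Rightarrow> klein"
  assumes cyc: "distinct xs" "3 \<le> length xs" and CE: "E - T = cedges xs"
    and pairs: "\<And>e. e \<in> E \<Longrightarrow> \<exists>u v. e = {u, v}"
    and inner: "\<And>w. w \<notin> set xs \<Longrightarrow> inj_on c {e \<in> T. w \<in> e} \<and> K0 \<notin> c ` {e \<in> T. w \<in> e}"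
    and leaf: "\<And>i. i < length xs \<Longrightarrow> \<exists>y. {e \<in> T. xs ! i \<in> e} = {{xs ! i, y}} \<and> c {xs ! i, y} = f i \<and> f i \<noteq> K0"
    and e0: "e0 \<noteq> K0" "closes e0 K0 (map f [0..<length xs])"
  shows "\<exists>col. edge_colouring3 E col"
proof -
  let ?n = "length xs"
  let ?ed = "\<lambda>k. {xs ! k, xs ! (Suc k mod ?n)}"
  \<comment> \<open>\<open>h k\<close> is the colour of the cycle edge entering position k;
    \<open>h 0\<close> = \<open>e0\<close> belongs to the closing edge.\<close>
  define h where "h = (\<lambda>k. kadd e0 (psum f k))"
  have ps: "psum f ?n = K0" "\<And>k. k \<le> ?n \<Longrightarrow> psum f k \<noteq> e0"
  proof -
    have *: "psum f ?n = K0 \<and> (\<forall>k. 0 < k \<and> k \<le> ?n \<longrightarrow> psum f k \<noteq> e0)"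
      using closes_psum[of e0 f 0 ?n] e0(2) by simp
    then show "psum f ?n = K0" by blast
    fix k assume "k \<le> ?n"
    then show "psum f k \<noteq> e0" using * e0(1) by (cases k) auto
  qed
  have h0: "h k \<noteq> K0" if "k \<le> ?n" for k using ps(2)[OF that] by (auto simp: h_def kadd_eq_0)
  have hS: "h (Suc k) = kadd (h k) (f k)" for k by (simp add: h_def kadd_assoc)
  have hn: "h ?n = h 0" by (simp add: h_def ps(1))
  have tri: "h k \<noteq> f k \<and> h (Suc k) \<noteq> h k \<and> h (Suc k) \<noteq> f k" if "k < ?n" for k
  proof -
    have "f k \<noteq> K0" using leaf[OF that] by blast
    moreover have "h k \<noteq> f k" using h0[of "Suc k"] that by (simp add: hS kadd_eq_0)
    ultimately show ?thesis using kadd_third[of "h k" "f k"] h0[of k] that by (simp add: hS)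
  qed
  define C where "C = (\<lambda>e. if e \<in> T then c e else h (Suc (THE k. k < ?n \<and> e = ?ed k)))"
  have ne: "xs \<noteq> []" using cyc(2) by auto
  have edE: "?ed k \<in> E - T" if "k < ?n" for k using that ne CE by (auto simp: cedges_nth)
  have Ced: "C (?ed k) = h (Suc k)" if "k < ?n" for k
  proof -
    have "(THE j. j < ?n \<and> ?ed k = ?ed j) = k"
      by (rule the_equality) (use that cycle_edge_unique[OF cyc] in blast)+
    then show ?thesis using edE[OF that] by (simp add: C_def)
  qed
  have at_leaf: "e \<in> T \<and> C e = f k \<and> {e \<in> T. xs ! k \<in> e} = {e} \<or> e = ?ed k \<and> C e = h (Suc k)
      \<or> (\<exists>j < ?n. Suc j mod ?n = k \<and> e = ?ed j \<and> C e = h k)"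
    if k: "k < ?n" and e: "e \<in> E" "xs ! k \<in> e" for k e
  proof (cases "e \<in> T")
    case True
    obtain y where y: "{e \<in> T. xs ! k \<in> e} = {{xs ! k, y}}" "c {xs ! k, y} = f k" using leaf[OF k] by blast
    have "e \<in> {e \<in> T. xs ! k \<in> e}" using True e by simp
    then have "e = {xs ! k, y}" unfolding y(1) by simp
    then show ?thesis using True y by (simp add: C_def)
  next
    case False
    then have "e \<in> cedges xs" using e CE by blast
    then obtain j where j: "j < ?n" "e = ?ed j" using ne by (auto simp: cedges_nth)
    have jn: "Suc j mod ?n < ?n" using j(1) by (intro mod_less_divisor) linarith
    have "xs ! k = xs ! j \<or> xs ! k = xs ! (Suc j mod ?n)" using e(2) j(2) by blast
    then have "j = k \<or> Suc j mod ?n = k" using cyc(1) k j(1) jn by (auto simp: nth_eq_iff_index_eq)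
    then show ?thesis
    proof
      assume "j = k"
      then show ?thesis using j Ced by simp
    next
      assume jk: "Suc j mod ?n = k"
      have "h (Suc j) = h k"
      proof (cases "Suc j = ?n")
        case True then show ?thesis using jk hn by simp
      next
        case False then show ?thesis using jk j(1) by simp
      qed
      then show ?thesis using j jk Ced[OF j(1)] by auto
    qed
  qed
  have proper: "C e \<noteq> K0 \<and> (\<forall>g \<in> E. e \<noteq> g \<and> w \<in> g \<longrightarrow> C e \<noteq> C g)" if e: "e \<in> E" "w \<in> e" for e w
  proof (cases "w \<in> set xs")
    case False
    have inT: "g \<in> T" if "g \<in> E" "w \<in> g" for g
      using that CE False cedges_subset[OF ne, of g] by blast
    have "c e \<in> c ` {e \<in> T. w \<in> e}" using inT[OF e] e(2) by blast
    then have "c e \<noteq> K0" using inner[OF False] by metis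
    then have "C e \<noteq> K0" using inT[OF e] by (simp add: C_def)
    moreover have "C e \<noteq> C g" if "g \<in> E" "e \<noteq> g" "w \<in> g" for g
      using inT[OF e] inT[OF that(1,3)] inner[OF False] e that by (auto simp: C_def inj_on_def)
    ultimately show ?thesis by blast
  next
    case True
    then obtain k where k: "k < ?n" "w = xs ! k" by (auto simp: in_set_conv_nth)
    note at = at_leaf[OF k(1)]
    have same: "j = j'" if "j < ?n" "j' < ?n" "Suc j mod ?n = k" "Suc j' mod ?n = k" for j j'
      using that by (auto simp: mod_Suc split: if_splits)
    have nz: "f k \<noteq> K0" "h k \<noteq> K0" "h (Suc k) \<noteq> K0" using leaf[OF k(1)] h0[of k] h0[of "Suc k"] k(1) by auto
    have t: "h k \<noteq> f k" "h (Suc k) \<noteq> h k" "h (Suc k) \<noteq> f k" using tri[OF k(1)] by blast+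
    define P1 P2 P3 where "P1 = (\<lambda>g. {e \<in> T. xs ! k \<in> e} = {g})" and "P2 = (\<lambda>g. g = ?ed k)"
      and "P3 = (\<lambda>g. \<exists>j < ?n. Suc j mod ?n = k \<and> g = ?ed j)"
    have ax: "P1 g \<and> C g = f k \<or> P2 g \<and> C g = h (Suc k) \<or> P3 g \<and> C g = h k" if "g \<in> E" "w \<in> g" for g
      using at[OF that(1)] that(2) unfolding k(2) P1_def P2_def P3_def by blast
    have u1: "g = g'" if "P1 g" "P1 g'" for g g' using that unfolding P1_def by (metis singleton_inject)
    have u2: "g = g'" if "P2 g" "P2 g'" for g g' using that unfolding P2_def by simp
    have u3: "g = g'" if "P3 g" "P3 g'" for g g' using that same unfolding P3_def by metis
    have ae: "P1 e \<and> C e = f k \<or> P2 e \<and> C e = h (Suc k) \<or> P3 e \<and> C e = h k" by (rule ax[OF e])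
    have "C e \<noteq> C g" if g: "g \<in> E" "e \<noteq> g" "w \<in> g" for g
      using ax[OF g(1,3)] ae u1[of e g] u2[of e g] u3[of e g] g(2) t by auto
    moreover have "C e \<noteq> K0" using ae nz by metis
    ultimately show ?thesis by blast
  qed
  have "edge_colouring3 E (\<lambda>e. colour_nat (C e))"
    unfolding edge_colouring3_def
  proof (intro conjI ballI impI)
    fix e f assume ef: "e \<in> E" "f \<in> E" "e \<noteq> f \<and> e \<inter> f \<noteq> {}"
    then obtain w where w: "w \<in> e" "w \<in> f" by blast
    have "C e \<noteq> C f" "C e \<noteq> K0" "C f \<noteq> K0" using proper[OF ef(1) w(1)] proper[OF ef(2) w(2)] ef w by blast+
    then show "colour_nat (C e) \<noteq> colour_nat (C f)" by (intro colour_nat_inj)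
  qed (rule colour_nat_less)
  then show ?thesis by blast
qed

text \<open>Descend into a child that is not a leaf as long as there is one: the last inner vertex
  has two leaves as children.\<close>

lemma branch_cherry:
  "branch T xs u v D t \<Longrightarrow> (\<exists>i. t = L i) \<or> (\<exists>w i j z. i < length xs \<and> j < length xs \<and> w \<notin> set xs \<and>
     (\<forall>y. {w, y} \<in> T \<longleftrightarrow> y = z \<or> y = xs ! i \<or> y = xs ! j) \<and> distinct [z, xs ! i, xs ! j])"
proof (induction rule: branch.induct)
  case (node v u a b D1 l D2 r)
  show ?case
  proof (cases "(\<exists>i. l = L i) \<and> (\<exists>j. r = L j)")
    case True
    then obtain i j where "l = L i" "r = L j" by blast
    then have "a = xs ! i" "i < length xs" "b = xs ! j" "j < length xs" using node(4,5) by (auto elim: branch.cases)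
    then have "i < length xs \<and> j < length xs \<and> v \<notin> set xs \<and>
      (\<forall>y. {v, y} \<in> T \<longleftrightarrow> y = u \<or> y = xs ! i \<or> y = xs ! j) \<and> distinct [u, xs ! i, xs ! j]"
      using node(1,2,3) by simp
    then show ?thesis by blast
  next
    case False
    then show ?thesis using node.IH by blast
  qed
qed blast

lemma rotate_cycle:
  assumes "is_cycle F xs"
  shows "is_cycle F (rotate k xs)"
  unfolding is_cycle_def
proof (intro conjI allI impI)
  let ?n = "length xs"
  have c: "3 \<le> ?n" "distinct xs" "\<And>i. i < ?n \<Longrightarrow> {xs ! i, xs ! (Suc i mod ?n)} \<in> F"
    using assms by (auto simp: is_cycle_def)
  show "3 \<le> length (rotate k xs)" "distinct (rotate k xs)" using c by simp_all
  fix i assume "i < length (rotate k xs)"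
  then have i: "i < ?n" by simp
  have lt: "Suc i mod ?n < ?n" "(k + i) mod ?n < ?n" using i by (auto intro!: mod_less_divisor)
  have "rotate k xs ! i = xs ! ((k + i) mod ?n)" using i by (rule nth_rotate)
  moreover have "rotate k xs ! (Suc i mod ?n) = xs ! (Suc ((k + i) mod ?n) mod ?n)"
    using nth_rotate[OF lt(1), of k] by (simp add: mod_Suc_eq mod_add_right_eq)
  ultimately show "{rotate k xs ! i, rotate k xs ! (Suc i mod length (rotate k xs))} \<in> F"
    using c(3)[OF lt(2)] by simp
qed

section \<open>The computations for lengths 7, 8 and 9\<close>

lemma colourable_7_3: "all_colourable 7 3" by code_simp
lemma colourable_8_3: "all_colourable 8 3" by code_simp
lemma colourable_8_4: "all_colourable 8 4" by code_simp
lemma colourable_9_3: "all_colourable 9 3" by code_simp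
lemma colourable_9_4: "all_colourable 9 4" by code_simp

text \<open>d is the distance on the cycle of two leaves with a common neighbour: at least three by
  the girth, at most half the length by choice of direction. For length 5 there is no such
  d.\<close>

lemma small_all_colourable:
  assumes "n \<in> {5, 7, 8, 9}" "3 \<le> d" "2 * d \<le> n"
  shows "all_colourable n d"
proof -
  have "n = 7 \<and> d = 3 \<or> n = 8 \<and> d = 3 \<or> n = 8 \<and> d = 4 \<or> n = 9 \<and> d = 3 \<or> n = 9 \<and> d = 4"
    using assms by auto
  then show ?thesis
    using colourable_7_3 colourable_8_3 colourable_8_4 colourable_9_3 colourable_9_4 by auto
qed

section \<open>Colouring a cubic graph with one short outer cycle\<close>

context
  fixes V :: "'a set" and E T :: "'a set set"
  assumes cub: "cubic V E" and hist: "hist V E T"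
begin

lemma hist_tree_facts:
  "\<not> has_cycle T" "{a} \<notin> T" "e \<in> T \<Longrightarrow> \<exists>x y. e = {x, y}" "connected_on V T"
proof -
  note sg = hist_sg[OF cub hist] and TE = hist_TE[OF cub hist]
  show "\<not> has_cycle T" "connected_on V T" using hist by (auto simp: hist_def spanning_tree_def)
  show "{a} \<notin> T" using simple_graph_edgeE[OF sg, of "{a}"] TE by (metis doubleton_eq_iff insert_absorb2 subsetD)
  show "e \<in> T \<Longrightarrow> \<exists>x y. e = {x, y}" using simple_graph_edgeE[OF sg, of e] TE by blast
qed

lemma hist_nbrs_card: "card {y. {v, y} \<in> T} = degree T v"
proof -
  have "{e \<in> T. v \<in> e} = (\<lambda>y. {v, y}) ` {y. {v, y} \<in> T}"
  proof
    show "{e \<in> T. v \<in> e} \<subseteq> (\<lambda>y. {v, y}) ` {y. {v, y} \<in> T}"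
    proof
      fix e assume e: "e \<in> {e \<in> T. v \<in> e}"
      then obtain x y where "e = {x, y}" using hist_tree_facts(3) by blast
      then obtain z where "e = {v, z}" using e by (metis (mono_tags, lifting) insertE insert_commute mem_Collect_eq singletonD)
      then show "e \<in> (\<lambda>y. {v, y}) ` {y. {v, y} \<in> T}" using e by blast
    qed
  qed auto
  moreover have "inj_on (\<lambda>y. {v, y}) {y. {v, y} \<in> T}" by (auto simp: inj_on_def doubleton_eq_iff)
  ultimately show ?thesis by (simp add: degree_def card_image)
qed

lemma leaf_nbr:
  assumes "v \<in> leaves V T"
  shows "\<exists>u. \<forall>y. {v, y} \<in> T \<longleftrightarrow> y = u"
proof -
  have "card {y. {v, y} \<in> T} = 1" using assms hist_nbrs_card[of v] by (simp add: leaves_def)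
  then obtain u where "{y. {v, y} \<in> T} = {u}" by (rule card_1_singletonE)
  then show ?thesis by blast
qed

text \<open>If no branch belonged to a directed edge uv, then v would be no leaf and one of its two
  further edges would have no branch either. This continues forever without reversals and so
  produces a cycle in \<open>T\<close>.\<close>

lemma branch_exists:
  assumes xs: "set xs = leaves V T" and uv: "{u, v} \<in> T"
  shows "\<exists>D t. branch T xs u v D t"
proof (rule ccontr)
  assume none: "\<not> (\<exists>D t. branch T xs u v D t)"
  note sg = hist_sg[OF cub hist] and TE = hist_TE[OF cub hist]
  have "\<exists>zs. is_cycle T zs \<and> set zs \<subseteq> V"
  proof (rule walk_forever_cycle[where P = "\<lambda>x y. {x, y} \<in> T \<and> \<not> (\<exists>D t. branch T xs x y D t)"])
    show "finite V" using hist_finite[OF cub hist] by simp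
    show "{u, v} \<in> T \<and> \<not> (\<exists>D t. branch T xs u v D t)" using uv none by blast
    fix x y assume xy: "{x, y} \<in> T \<and> \<not> (\<exists>D t. branch T xs x y D t)"
    then have V: "x \<noteq> y" "x \<in> V" "y \<in> V" using simple_graph_pairD[OF sg] TE by blast+
    have yx: "{y, x} \<in> T" using xy by (simp add: insert_commute)
    have "\<exists>z. z \<noteq> x \<and> {y, z} \<in> T \<and> \<not> (\<exists>D t. branch T xs y z D t)"
    proof (cases "y \<in> leaves V T")
      case True
      then obtain i where i: "i < length xs" "y = xs ! i" using xs by (metis in_set_conv_nth)
      have "{y, z} \<in> T \<longleftrightarrow> z = x" for z using leaf_nbr[OF True] yx by metis
      then have "branch T xs x y {y} (L i)" using i by (intro branch.leaf)
      then show ?thesis using xy by blast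
    next
      case False
      then have "card {z. {y, z} \<in> T} = 3"
        using hist V(3) hist_nbrs_card[of y] by (auto simp: hist_def leaves_def)
      then have "card ({z. {y, z} \<in> T} - {x}) = 2" using yx by (simp add: card_Diff_singleton)
      then obtain a b where ab: "{z. {y, z} \<in> T} - {x} = {a, b}" "a \<noteq> b" by (auto simp: card_2_iff)
      have "{y, z} \<in> T \<longleftrightarrow> z = x \<or> z = a \<or> z = b" for z using ab(1) yx by blast
      moreover have "distinct [x, a, b]" using ab by auto
      moreover have "y \<notin> set xs" using False xs by simp
      ultimately have "\<not> (\<exists>D t. branch T xs y a D t) \<or> \<not> (\<exists>D t. branch T xs y b D t)"
        using branch.node[of y T x a b xs] xy by blast
      moreover have "a \<noteq> x" "b \<noteq> x" "{y, a} \<in> T" "{y, b} \<in> T" using ab by blast+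
      ultimately show ?thesis by blast
    qed
    then show "{x, y} \<in> T \<and> x \<noteq> y \<and> x \<in> V \<and> (\<exists>z. z \<noteq> x \<and> {y, z} \<in> T \<and> \<not> (\<exists>D t. branch T xs y z D t))"
      using xy V by blast
  qed
  then show False using hist_tree_facts(1) by (auto simp: has_cycle_def)
qed

lemma branch_covers:
  assumes b: "branch T xs r v D t" and r: "\<And>y. {r, y} \<in> T \<longleftrightarrow> y = v" "r \<in> V"
  shows "V \<subseteq> insert r D"
proof
  fix u assume "u \<in> V"
  then have "(adj T)\<^sup>*\<^sup>* r u" using hist_tree_facts(4) r(2) by (simp add: connected_on_def)
  then show "u \<in> insert r D"
  proof (rule reach_closed)
    fix x y assume "x \<in> insert r D" "{x, y} \<in> T"
    then show "y \<in> insert r D" using branch_closed[OF b, of x y] r(1)[of y] branch_edge[OF b] by blast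
  qed simp
qed

text \<open>Two leaves with a common neighbour w are brought to positions 0 and d by rotating the
  cycle, and the tree is rooted anew at position 0. What remains below w is one of the enumerated
  trees, and the colours found by the search extend to tree and cycle.\<close>

lemma single_cycle_colourable:
  assumes nsc: "no_short_cycle E" and cyc: "is_cycle (E - T) xs" and xs: "set xs = leaves V T"
    and len: "length xs \<in> {5, 7, 8, 9}"
  shows "\<exists>col. edge_colouring3 E col"
proof -
  let ?n = "length xs"
  note sg = hist_sg[OF cub hist] and TE = hist_TE[OF cub hist] and tf = hist_tree_facts
  have LV: "leaves V T \<subseteq> V" by (auto simp: leaves_def)
  have n3: "3 \<le> ?n" "distinct xs" using cyc by (auto simp: is_cycle_iff)
  have ne: "xs \<noteq> []" using n3 by auto
  have "xs ! 0 \<in> leaves V T" using xs ne nth_mem[of 0 xs] by auto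
  then obtain v0 where v0: "\<And>y. {xs ! 0, y} \<in> T \<longleftrightarrow> y = v0" using leaf_nbr by metis
  \<comment> \<open>Rooting at an arbitrary leaf serves to find two leaves with a common
    neighbour.\<close>
  obtain D0 t0 where b0: "branch T xs (xs ! 0) v0 D0 t0" using branch_exists[OF xs] v0 by blast
  have cov0: "V \<subseteq> insert (xs ! 0) D0"
    by (rule branch_covers[OF b0 v0]) (use \<open>xs ! 0 \<in> leaves V T\<close> LV in blast)
  have "t0 \<noteq> L i" for i
  proof
    assume "t0 = L i"
    then have "D0 = {v0}" using b0 by (auto elim: branch.cases)
    then have "set xs \<subseteq> {xs ! 0, v0}" using cov0 xs LV by blast
    then have "card (set xs) \<le> card {xs ! 0, v0}" by (intro card_mono) auto
    also have "\<dots> \<le> 2" by (simp add: card_insert_if)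
    finally show False using n3 by (simp add: distinct_card)
  qed
  then obtain w i j z where ch: "i < ?n" "j < ?n" "w \<notin> set xs" "\<And>y. {w, y} \<in> T \<longleftrightarrow> y = z \<or> y = xs ! i \<or> y = xs ! j"
    "distinct [z, xs ! i, xs ! j]" using branch_cherry[OF b0] by blast
  have "i \<noteq> j" using ch(5) by auto
  \<comment> \<open>Of the two directions between positions i and j on the cycle take the shorter
    one: p is its start and d its length.\<close>
  have "\<exists>p q d. p < ?n \<and> q < ?n \<and> (p + d) mod ?n = q \<and> d < ?n \<and> 0 < d \<and> 2 * d \<le> ?n \<and> {p, q} = {i, j}"
  proof -
    have *: "\<exists>p q d. p < ?n \<and> q < ?n \<and> (p + d) mod ?n = q \<and> d < ?n \<and> 0 < d \<and> 2 * d \<le> ?n \<and> {p, q} = {a, b}"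
      if ab: "a < b" "b < ?n" for a b
    proof (cases "2 * (b - a) \<le> ?n")
      case True
      then have "a < ?n \<and> b < ?n \<and> (a + (b - a)) mod ?n = b \<and> b - a < ?n \<and> 0 < b - a \<and> 2 * (b - a) \<le> ?n \<and> {a, b} = {a, b}"
        using ab by simp
      then show ?thesis by blast
    next
      case False
      have "b + (?n - (b - a)) = a + ?n" using ab by simp
      then have "(b + (?n - (b - a))) mod ?n = a" using ab by simp
      then have "b < ?n \<and> a < ?n \<and> (b + (?n - (b - a))) mod ?n = a \<and> ?n - (b - a) < ?n \<and> 0 < ?n - (b - a)
          \<and> 2 * (?n - (b - a)) \<le> ?n \<and> {b, a} = {a, b}"
      proof -
        have "?n - (b - a) < ?n" "0 < ?n - (b - a)" "2 * (?n - (b - a)) \<le> ?n" using ab False by arith+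
        then show ?thesis using ab \<open>(b + (?n - (b - a))) mod ?n = a\<close> by (simp add: insert_commute)
      qed
      then show ?thesis by blast
    qed
    show ?thesis
    proof (cases "i < j")
      case True then show ?thesis using *[OF True ch(2)] by simp
    next
      case False
      then have "j < i" using \<open>i \<noteq> j\<close> by simp
      then show ?thesis using *[of j i] ch(1) by (simp add: insert_commute)
    qed
  qed
  then obtain p q d where pq: "p < ?n" "q < ?n" "(p + d) mod ?n = q" "d < ?n" "0 < d" "2 * d \<le> ?n" "{p, q} = {i, j}"
    by blast
  define ys where "ys = rotate p xs"
  have ys: "is_cycle (E - T) ys" "set ys = leaves V T" "length ys = ?n" "distinct ys"
    using rotate_cycle[OF cyc] xs n3(2) by (simp_all add: ys_def)
  have y0: "ys ! 0 = xs ! p" and yd: "ys ! d = xs ! q"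
    using nth_rotate[of 0 xs p] nth_rotate[of d xs p] pq ne by (simp_all add: ys_def)
  have ney: "ys \<noteq> []" using ys(3) ne by auto
  have CE: "E - T = cedges ys" by (rule outer_cycle_edges[OF cub hist ys(1,2)])
  have "{xs ! p, xs ! q} = {xs ! i, xs ! j}" using pq(7) by (auto simp: doubleton_eq_iff)
  then have nbw: "\<And>y. {w, y} \<in> T \<longleftrightarrow> y = ys ! 0 \<or> y = ys ! d \<or> y = z" and dw: "distinct [ys ! 0, ys ! d, z]"
    using ch(4,5) y0 yd by (auto simp: doubleton_eq_iff)
  have wy: "w \<notin> set ys" using ch(3) xs ys(2) by simp
  have y0L: "ys ! 0 \<in> leaves V T" and ydL: "ys ! d \<in> leaves V T"
  proof -
    have "0 < length ys" "d < length ys" using ne ys(3) pq(4) by simp_all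
    then show "ys ! 0 \<in> leaves V T" "ys ! d \<in> leaves V T" using nth_mem ys(2) by blast+
  qed
  have wT: "{w, ys ! 0} \<in> T" "{w, ys ! d} \<in> T" "{w, z} \<in> T" using nbw by blast+
  have nb0: "\<And>y. {ys ! 0, y} \<in> T \<longleftrightarrow> y = w" using leaf_nbr[OF y0L] wT(1) by (metis insert_commute)
  have nbd: "\<And>y. {ys ! d, y} \<in> T \<longleftrightarrow> y = w" using leaf_nbr[OF ydL] wT(2) by (metis insert_commute)
  obtain D t where bz: "branch T ys w z D t" using branch_exists[OF ys(2) wT(3)] by blast
  have dl: "d < length ys" using pq(4) ys(3) by simp
  have bd: "branch T ys w (ys ! d) {ys ! d} (L d)" by (rule branch.leaf[OF nbd dl refl])
  \<comment> \<open>Seen from \<open>ys ! 0\<close>, the neighbour w carries the leaf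
    \<open>ys ! d\<close> and the branch at z; only the latter is left to be enumerated.\<close>
  define W where "W = insert w ({ys ! d} \<union> D)"
  have whole: "branch T ys (ys ! 0) w W (N (L d) s)" if "branch T ys w z D s" for s
    unfolding W_def by (rule branch.node[OF nbw dw wy bd that])
  have cov: "V \<subseteq> insert (ys ! 0) W"
    by (rule branch_covers[OF whole[OF bz] nb0]) (use y0L LV in blast)
  have pairT: "\<And>e. e \<in> T \<Longrightarrow> \<exists>x y. e = {x, y}" by (rule tf(3))
  have lab: "labels s = {k. k < length ys \<and> ys ! k \<in> B} \<and> distinct_labels s" if "branch T ys a b B s" for a b B s
    using branch_labels[OF tf(1) tf(2) ys(4) _ that] pairT by blast
  have "ys ! 0 \<notin> W" using branch_parent[OF tf(1) tf(2) ys(4) _ whole[OF bz]] pairT by blast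
  then have l0: "0 \<notin> labels t" using lab[OF bz] by (auto simp: W_def)
  have ld: "d \<notin> labels t" using lab[OF whole[OF bz]] by simp
  have lt: "labels t = set (filter (\<lambda>k. k \<noteq> d) [1..<?n])"
  proof
    show "labels t \<subseteq> set (filter (\<lambda>k. k \<noteq> d) [1..<?n])"
    proof
      fix k assume k: "k \<in> labels t"
      then have "k \<noteq> 0" "k \<noteq> d" using l0 ld by metis+
      moreover have "k < ?n" using k lab[OF bz] ys(3) by auto
      ultimately show "k \<in> set (filter (\<lambda>k. k \<noteq> d) [1..<?n])" by simp
    qed
    show "set (filter (\<lambda>k. k \<noteq> d) [1..<?n]) \<subseteq> labels t"
    proof
      fix k assume "k \<in> set (filter (\<lambda>k. k \<noteq> d) [1..<?n])"
      then have k: "k < length ys" "k \<noteq> 0" "k \<noteq> d" using ys(3) by auto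
      then have "ys ! k \<noteq> ys ! 0" "ys ! k \<noteq> ys ! d" "ys ! k \<noteq> w" "ys ! k \<in> V"
      proof -
        have "0 < length ys" using k(1) by linarith
        then show "ys ! k \<noteq> ys ! 0" "ys ! k \<noteq> ys ! d"
          using ys(4) dl k by (simp_all add: nth_eq_iff_index_eq)
        show "ys ! k \<noteq> w" "ys ! k \<in> V" using wy ys(2) LV nth_mem[OF k(1)] by blast+
      qed
      then have "ys ! k \<in> D" using cov by (auto simp: W_def)
      then show "k \<in> labels t" using lab[OF bz] k(1) by blast
    qed
  qed
  have CEE: "cedges ys \<subseteq> E" using CE by blast
  have "\<exists>t' \<in> set (trees (length ys) ?n (filter (\<lambda>k. k \<noteq> d) [1..<?n])). branch T ys w z D t'"
  proof (rule trees_complete[OF nsc TE CEE ney tf(1) tf(2) ys(4) _ bz])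
    show "length (filter (\<lambda>k. k \<noteq> d) [1..<?n]) \<le> ?n" by (rule order_trans[OF length_filter_le]) simp
  qed (use lt pairT in auto)
  then obtain s where s: "s \<in> set (trees ?n ?n (filter (\<lambda>k. k \<noteq> d) [1..<?n]))" "branch T ys w z D s"
    using ys(3) by auto
  have l0': "0 < length ys" using ney by simp
  note near = branch_not_near[OF nsc TE CEE ney]
  have "\<not> near ?n 0 (L d)" using near[OF bd l0' wT(1) _ wy] dw ys(3) by simp
  \<comment> \<open>Two leaves with a common neighbour at distance one or two on the cycle would
    give a triangle or a quadrilateral.\<close>
  then have d3: "3 \<le> d" using pq(6) by (auto simp: circ_dist_def Let_def split: if_splits)
  have "\<not> near ?n 0 s" "\<not> near ?n d s"
    using near[OF s(2) l0' wT(1) _ wy] near[OF s(2) dl wT(2) _ wy] dw ys(3) by auto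
  then have comp: "compatible ?n (L d) s \<and> compatible ?n (L 0) s" by simp
  let ?acc = "(replicate ?n K0)[0 := K1, d := K2]"
  have "all_colourable ?n d" by (rule small_all_colourable[OF len d3 pq(6)])
  then have srch: "search 30 [(s, K3)] ?acc"
    using s(1) comp unfolding all_colourable_def list_all_iff by metis
  have labs: "labels s = labels t" "distinct_labels s" using lab[OF s(2)] lab[OF bz] by simp_all
  have lacc: "length ?acc = ?n" by simp
  have "\<exists>f e. (\<forall>(t, x) \<in> set [(s, K3)]. colours t x f) \<and>
    (\<forall>i < length ?acc. i \<notin> \<Union> (labels ` fst ` set [(s, K3)]) \<longrightarrow> f i = ?acc ! i) \<and>
    e \<noteq> K0 \<and> closes e K0 (map f [0..<length ?acc])"
  proof (rule search_sound[OF srch])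
    fix t' x assume "(t', x) \<in> set [(s, K3)]"
    then show "distinct_labels t' \<and> x \<noteq> K0 \<and> labels t' \<subseteq> {..<length ?acc}" using labs lt by auto
  qed simp
  then obtain f e where f: "colours s K3 f" "\<And>i. i < ?n \<Longrightarrow> i \<notin> labels s \<Longrightarrow> f i = ?acc ! i"
    "e \<noteq> K0" "closes e K0 (map f [0..<?n])" by auto
  have n0: "0 < ?n" using n3 by linarith
  have acc: "?acc ! 0 = K1" "?acc ! d = K2" using pq(4,5) ne by (simp_all add: nth_list_update)
  have "f 0 = ?acc ! 0" by (rule f(2)[OF n0]) (simp add: labs l0)
  moreover have "f d = ?acc ! d" by (rule f(2)[OF pq(4)]) (simp add: labs ld)
  ultimately have f0: "f 0 = K1" "f d = K2" unfolding acc by simp_all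
  have col: "colours (N (L d) s) K1 f"
    unfolding colours.simps(2) by (intro exI[of _ K2] exI[of _ K3]) (use f(1) f0 in simp)
  have "\<exists>c. c {ys ! 0, w} = K1 \<and> (\<forall>u \<in> W. inj_on c {e \<in> T. u \<in> e} \<and> K0 \<notin> c ` {e \<in> T. u \<in> e}) \<and>
      (\<forall>i < length ys. ys ! i \<in> W \<longrightarrow> (\<forall>y. {ys ! i, y} \<in> T \<longrightarrow> c {ys ! i, y} = f i))"
    by (rule branch_colouring[OF tf(1) tf(2) ys(4) _ whole[OF s(2)] col]) (erule pairT, simp)
  then obtain c where c': "c {ys ! 0, w} = K1 \<and> (\<forall>u \<in> W. inj_on c {e \<in> T. u \<in> e} \<and> K0 \<notin> c ` {e \<in> T. u \<in> e}) \<and>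
      (\<forall>i < length ys. ys ! i \<in> W \<longrightarrow> (\<forall>y. {ys ! i, y} \<in> T \<longrightarrow> c {ys ! i, y} = f i))" by (rule exE)
  note c = conjunct1[OF c'] conjunct1[OF conjunct2[OF c']] conjunct2[OF conjunct2[OF c']]
  have edges_at: "{e \<in> T. u \<in> e} = {{u, y}}" if u: "\<And>x. {u, x} \<in> T \<longleftrightarrow> x = y" for u y
  proof
    show "{e \<in> T. u \<in> e} \<subseteq> {{u, y}}"
    proof
      fix e assume "e \<in> {e \<in> T. u \<in> e}"
      then have e: "e \<in> T" "u \<in> e" by simp_all
      then obtain x where "e = {u, x}" using pairT by (metis insertE insert_commute singletonD)
      then show "e \<in> {{u, y}}" using e(1) u by simp
    qed
    show "{{u, y}} \<subseteq> {e \<in> T. u \<in> e}" using u by blast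
  qed
  show ?thesis
  proof (rule colour_cycle_and_tree[of ys E T c f e])
    show "distinct ys" "3 \<le> length ys" "E - T = cedges ys" "e \<noteq> K0" using ys(3,4) n3 CE f(3) by simp_all
    show "closes e K0 (map f [0..<length ys])" using f(4) ys(3) by simp
    show "\<exists>u v. e = {u, v}" if "e \<in> E" for e using simple_graph_edgeE[OF sg that] by blast
    show "inj_on c {e \<in> T. u \<in> e} \<and> K0 \<notin> c ` {e \<in> T. u \<in> e}" if u: "u \<notin> set ys" for u
    proof (cases "u \<in> V")
      case True
      have "u \<noteq> ys ! 0" using u l0' by auto
      then have "u \<in> W" using True cov by blast
      then show ?thesis using c(2) by blast
    next
      case False
      then have none: "{e \<in> T. u \<in> e} = {}" using simple_graph_subset[OF sg] TE by blast
      show ?thesis unfolding none by simp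
    qed
    show "\<exists>y. {e \<in> T. ys ! i \<in> e} = {{ys ! i, y}} \<and> c {ys ! i, y} = f i \<and> f i \<noteq> K0" if i: "i < length ys" for i
    proof (cases "i = 0")
      case True
      show ?thesis by (intro exI[of _ w]) (use True edges_at[OF nb0] c(1) f0 in simp)
    next
      case False
      have iL: "ys ! i \<in> leaves V T" using ys(2) i nth_mem by blast
      obtain y where y: "\<And>x. {ys ! i, x} \<in> T \<longleftrightarrow> x = y" using leaf_nbr[OF iL] by metis
      have "ys ! i \<noteq> ys ! 0" using ys(4) i False l0' by (simp add: nth_eq_iff_index_eq)
      then have W: "ys ! i \<in> W" using iL LV cov by blast
      have yT: "{ys ! i, y} \<in> T" using y by blast
      have fi: "c {ys ! i, y} = f i" using c(3) i W yT by blast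
      have "c {ys ! i, y} \<in> c ` {e \<in> T. ys ! i \<in> e}" using yT by blast
      then have "c {ys ! i, y} \<noteq> K0" using c(2) W by metis
      then show ?thesis using edges_at[OF y] fi by (intro exI[of _ y] conjI) simp_all
    qed
  qed
qed

end

section \<open>The characterization\<close>

text \<open>Finitely many pairs come from certificates. The others arise by lengthening {5,9}, {6,8}
  or {7,7}, where in the last case first one cycle is lengthened to a and then the other to
  b.\<close>

lemma attains_pair:
  assumes "5 \<le> a" "a \<le> b" "b \<noteq> 5"
  shows "attains 6 {#} {#a, b#}"
proof -
  have free59: "attains 9 {#5, 9#} {#5, 9#}" and free68: "attains 9 {#6, 8#} {#6, 8#}"
    and free77: "attains 9 {#7, 7#} {#7, 7#}"
    using certificate_attains_free[OF certificate_5_9 free_5_9] certificate_attains_free[OF certificate_6_8 free_6_8]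
      certificate_attains_free[OF certificate_7_7 free_7_7]
    by (simp_all add: eval_nat_numeral add_mset_commute)
  have small: "attains 6 {#} {#5, 6#}" "attains 6 {#} {#5, 7#}" "attains 6 {#} {#5, 8#}" "attains 6 {#} {#6, 6#}"
    "attains 6 {#} {#6, 7#}"
    using certificate_attains[OF certificate_5_6] certificate_attains[OF certificate_5_7] certificate_attains[OF certificate_5_8]
      certificate_attains[OF certificate_6_6] certificate_attains[OF certificate_6_7]
    by (simp_all add: eval_nat_numeral add_mset_commute)
  have grow: "attains 6 {#} {#a', d#}" if "attains 9 {#a', c#} {#a', c#}" "c \<le> d" for a' c d
  proof -
    have "attains 9 (add_mset d {#a'#}) (add_mset d {#a'#})"
      by (rule attains_lengthen_le[OF _ that(2)]) (use that(1) in \<open>simp add: add_mset_commute\<close>)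
    then show ?thesis using attains_weaken[of 9 _ _ 6 "{#}"] by (simp add: add_mset_commute)
  qed
  consider "a = 5" "b = 6 \<or> b = 7 \<or> b = 8" | "a = 5" "9 \<le> b" | "a = 6" "b = 6 \<or> b = 7" | "a = 6" "8 \<le> b"
    | "7 \<le> a" using assms by linarith
  then show ?thesis
  proof cases
    case 1 then show ?thesis using small by auto
  next
    case 2 then show ?thesis using grow[OF free59] by simp
  next
    case 3 then show ?thesis using small by auto
  next
    case 4 then show ?thesis using grow[OF free68] by simp
  next
    case 5
    then have "attains 9 (add_mset a {#7#}) (add_mset a {#7#})"
      by (rule attains_lengthen_le[rotated]) (rule free77)
    then show ?thesis by (rule grow) (use 5 assms(2) in simp)
  qed
qed

text \<open>With at least two entries, not all equal to 5, start from a pair containing an entry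
  other than 5 and attach the rest. Two fives have a certificate of their own, and more fives start
  from {5,5,5}, which has enough spare tree edges.\<close>

lemma sufficient:
  fixes S :: "nat multiset"
  assumes ne: "S \<noteq> {#}" and ge: "\<forall>c \<in># S. 5 \<le> c" and one: "size S = 1 \<longrightarrow> (\<forall>c \<in># S. c = 6 \<or> 10 \<le> c)"
  shows "attains 0 {#} S"
proof -
  have weak: "attains 0 {#} M" if "attains k A M" for k A M by (rule attains_weaken[OF that]) auto
  show ?thesis
  proof (cases "\<exists>c. S = {#c#}")
    case True
    then obtain c where c: "S = {#c#}" by blast
    then consider "c = 6" | "c = 10" | "c = 11" | "c = 12" | "13 \<le> c" using one by fastforce
    then show ?thesis
    proof cases
      case 1 then show ?thesis using certificate_attains[OF certificate_6] c by (simp add: eval_nat_numeral)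
    next
      case 2 then show ?thesis using certificate_attains[OF certificate_10] c by (simp add: eval_nat_numeral)
    next
      case 3 then show ?thesis using certificate_attains[OF certificate_11] c by (simp add: eval_nat_numeral)
    next
      case 4 then show ?thesis using certificate_attains[OF certificate_12] c by (simp add: eval_nat_numeral)
    next
      case 5
      have "attains 9 {#13#} {#13#}"
        using certificate_attains_free[OF certificate_13 free_13] by (simp add: eval_nat_numeral)
      then have "attains 9 {#c#} {#c#}" by (rule attains_lengthen_le[OF _ 5])
      then show ?thesis unfolding c by (rule weak)
    qed
  next
    case multi: False
    show ?thesis
    proof (cases "\<exists>a \<in># S. a \<noteq> 5")
      case True
      then obtain a where a: "a \<in># S" "a \<noteq> 5" by blast
      then obtain S' where S': "S = add_mset a S'" by (meson mset_add)
      then have "S' \<noteq> {#}" using multi by auto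
      then obtain b N where N: "S' = add_mset b N" by (meson multiset_nonemptyE mset_add)
      have ab: "5 \<le> a" "5 \<le> b" using ge S' N by auto
      have "attains 6 {#} {#a, b#}"
      proof (cases "a \<le> b")
        case True then show ?thesis using attains_pair[OF ab(1) True] a(2) ab by simp
      next
        case False then show ?thesis using attains_pair[of b a] a(2) ab by (simp add: add_mset_commute)
      qed
      then have "attains 6 {#} (N + {#a, b#})" by (rule attains_add_all) (use ge S' N in auto)
      then have "attains 6 {#} S" by (simp add: S' N add_mset_commute)
      then show ?thesis by (rule weak)
    next
      case False
      then have five: "\<forall>c \<in># S. c = 5" by blast
      obtain a S1 where 1: "S = add_mset a S1" using ne by (meson multiset_nonemptyE mset_add)
      then have "S1 \<noteq> {#}" using multi by auto
      then obtain b S2 where 2: "S1 = add_mset b S2" by (meson multiset_nonemptyE mset_add)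
      have ab: "a = 5" "b = 5" using five 1 2 by auto
      show ?thesis
      proof (cases "S2 = {#}")
        case True
        then show ?thesis using certificate_attains[OF certificate_5_5] 1 2 ab by (simp add: eval_nat_numeral)
      next
        case False
        then obtain c N where 3: "S2 = add_mset c N" by (meson multiset_nonemptyE mset_add)
        have c: "c = 5" using five 1 2 3 by auto
        have "attains 6 {#} {#5, 5, 5#}"
          using certificate_attains[OF certificate_5_5_5] by (simp add: eval_nat_numeral)
        then have "attains 6 {#} (N + {#5, 5, 5#})" by (rule attains_add_all) (use ge 1 2 3 in auto)
        then have "attains 6 {#} S" by (simp add: 1 2 3 ab c)
        then show ?thesis by (rule weak)
      qed
    qed
  qed
qed

lemma necessary:
  assumes sn: "snark V E" and hist: "hist V E T"
  shows "\<forall>c \<in># oc V E T. 5 \<le> c" and "size (oc V E T) = 1 \<Longrightarrow> \<forall>c \<in># oc V E T. c = 6 \<or> 10 \<le> c"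
proof -
  have cub: "cubic V E" and girth: "girth_ge E 5" and nocol: "\<not> (\<exists>c. edge_colouring3 E c)"
    using sn by (simp_all add: snark_def)
  note sg = hist_sg[OF cub hist]
  have fin: "finite (outer_cycles V E T)" by (rule outer_cycles_finite[OF cub hist])
  have outer: "\<exists>xs. is_cycle (E - T) xs \<and> set xs = X \<and> card X = length xs" if X: "X \<in> outer_cycles V E T" for X
  proof -
    obtain v where v: "v \<in> leaves V T" "X = {u. (adj (E - T))\<^sup>*\<^sup>* v u}" using X unfolding outer_cycles_def by blast
    obtain xs where "is_cycle (E - T) xs" "set xs = X" using outer_component_cycle[OF cub hist v(1)] v(2) by blast
    moreover from this have "card X = length xs" using distinct_card[of xs] by (simp add: is_cycle_def)
    ultimately show ?thesis by blast
  qed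
  have five: "5 \<le> length xs" if "is_cycle (E - T) xs" for xs
  proof -
    have "is_cycle E xs" using that by (auto simp: is_cycle_iff)
    then show ?thesis using girth by (simp add: girth_ge_def)
  qed
  have elem: "\<exists>X \<in> outer_cycles V E T. c = card X" if "c \<in># oc V E T" for c
    using that fin by (auto simp: oc_def)
  show "\<forall>c \<in># oc V E T. 5 \<le> c"
  proof
    fix c assume "c \<in># oc V E T"
    then obtain X where X: "X \<in> outer_cycles V E T" "c = card X" using elem by blast
    obtain xs where "is_cycle (E - T) xs" "card X = length xs" using outer[OF X(1)] by blast
    then show "5 \<le> c" using five X(2) by simp
  qed
  assume "size (oc V E T) = 1"
  then have "card (outer_cycles V E T) = 1" using fin by (simp add: oc_def)
  then obtain X where X: "outer_cycles V E T = {X}" by (rule card_1_singletonE)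
  obtain xs where xs: "is_cycle (E - T) xs" "set xs = X" "card X = length xs" using outer X by blast
  \<comment> \<open>There is only one outer cycle, so it is the component of every leaf; conversely
    its vertices meet non-tree edges and must be leaves.\<close>
  have "set xs = leaves V T"
  proof
    show "leaves V T \<subseteq> set xs"
    proof
      fix u assume "u \<in> leaves V T"
      then have "{w. (adj (E - T))\<^sup>*\<^sup>* u w} \<in> outer_cycles V E T" unfolding outer_cycles_def by blast
      then have "{w. (adj (E - T))\<^sup>*\<^sup>* u w} = set xs" using X xs(2) by simp
      then show "u \<in> set xs" by blast
    qed
    show "set xs \<subseteq> leaves V T"
    proof
      fix u assume u: "u \<in> set xs"
      have c: "distinct xs" "3 \<le> length xs" "cedges xs \<subseteq> E - T" using xs(1) by (simp_all add: is_cycle_iff)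
      have "card {e \<in> cedges xs. u \<in> e} = 2" by (rule cedges_degree[OF c(1,2) u])
      then have "{e \<in> cedges xs. u \<in> e} \<noteq> {}" by (metis card.empty zero_neq_numeral)
      then obtain e where e: "e \<in> E - T" "u \<in> e" using c(3) by blast
      then have uV: "u \<in> V" using simple_graph_subset[OF sg] by blast
      have "finite {e \<in> E - T. u \<in> e}" using hist_finite[OF cub hist] by simp
      moreover have "e \<in> {e \<in> E - T. u \<in> e}" using e by simp
      ultimately have "card {e \<in> E - T. u \<in> e} \<noteq> 0" using card_0_eq by blast
      then show "u \<in> leaves V T" using hist_outer_degree[OF cub hist uV] by metis
    qed
  qed
  then have "length xs \<notin> {5, 7, 8, 9}"
    using single_cycle_colourable[OF cub hist girth_no_short_cycle[OF sg girth] xs(1)] nocol by blast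
  moreover have "5 \<le> length xs" by (rule five[OF xs(1)])
  ultimately have len: "length xs = 6 \<or> 10 \<le> length xs" by auto
  show "\<forall>c \<in># oc V E T. c = 6 \<or> 10 \<le> c"
  proof
    fix c assume "c \<in># oc V E T"
    then have "c = length xs" using elem X xs(3) by auto
    then show "c = 6 \<or> 10 \<le> c" using len by simp
  qed
qed

theorem theorem3:
  fixes S :: "nat multiset"
  assumes "S \<noteq> {#}"
    and "\<forall>c\<in>#S. c > 0"
  shows "(\<exists>(V :: nat set) E T. snark V E \<and> hist V E T \<and> oc V E T = S) \<longleftrightarrow>
         ((\<forall>c\<in>#S. c \<ge> 5) \<and> (size S = 1 \<longrightarrow> (\<forall>c\<in>#S. c = 6 \<or> c \<ge> 10)))"
proof
  assume "\<exists>(V :: nat set) E T. snark V E \<and> hist V E T \<and> oc V E T = S"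
  then obtain V :: "nat set" and E T where "snark V E" "hist V E T" "oc V E T = S" by blast
  then show "(\<forall>c\<in>#S. c \<ge> 5) \<and> (size S = 1 \<longrightarrow> (\<forall>c\<in>#S. c = 6 \<or> c \<ge> 10))"
    using necessary[of V E T] by simp
next
  assume "(\<forall>c\<in>#S. c \<ge> 5) \<and> (size S = 1 \<longrightarrow> (\<forall>c\<in>#S. c = 6 \<or> c \<ge> 10))"
  then have "attains 0 {#} S" using sufficient[OF assms(1)] by blast
  then obtain n E T cs U where *: "hist_snark {..<n :: nat} E T cs U" "mset (map length cs) = S"
    unfolding attains_def by blast
  show "\<exists>(V :: nat set) E T. snark V E \<and> hist V E T \<and> oc V E T = S"
    using hist_snark_snark[OF *(1)] *(2) by blast
qed

end
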